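(* Let $f,g\in\mathcal{C}^1(\mathbb{R}^2)$ be supported in $\mathbb{B}_{1/2}^\circ$ and let $M,N\in\mathbb{N}$. Then there exist constants $d_{f,g}>0$ (depending only on $f,g$) and $D[M,N]>0$ (depending only on $M,N$) such that $$\left\|S_{M,N}^{K}[f,g]-S_{M,N}(f\ast g)\right\|_\infty\le\frac{2d_{f,g}D[M,N]}{K}\qquad\text{for every }K\in\mathbb{N}\text{ with }K\ge K[M,N].$$
   Context: $\mathbb{N}=\{1,2,\dots\}$. $\mathbb{B}^\circ_{1/2}=\{\mathbf{x}\in\mathbb{R}^2:\|\mathbf{x}\|_2<\frac12\}$. $\mathrm{supp}(f)=\{\mathbf{x}: f(\mathbf{x})\neq 0\}$ and $f$ is supported in $X$ if $\mathrm{supp}(f)\subseteq X$. $\|f\|_\infty=\sup_{\mathbf{x}}|f(\mathbf{x})|$. $\mathcal{C}^1(\mathbb{R}^2)$ is the set of functions $\mathbb{R}^2\to\mathbb{C}$ all of whose partial derivatives of order $\le 1$ exist and are continuous. $(f\ast g)(\mathbf{x})=\int_{\mathbb{R}^2}f(\mathbf{y})g(\mathbf{x}-\mathbf{y})\,d\mathbf{y}$. Bessel notation: $J_m$ is the Bessel function of the first kind of order $m\in\mathbb{Z}$, $0<z_{m,1}<z_{m,2}<\cdots$ are its positive zeros, $K_{m,n}:=\lceil z_{m,n}/\pi\rceil$, and $K[M,N]:=\max\{K_{m,n}:0\le m\le M,\ 1\le n\le N\}$. In polar coordinates, $\Psi_{m,n}(r,\theta)=\frac{e^{\mathrm{i}m\theta}J_m(z_{m,n}r)}{\sqrt{\pi}\,|J_{m+1}(z_{m,n})|}$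 if $r\le 1$, and $0$ if $r>1$. The Fourier-Bessel coefficient is $C_{m,n}(h)=\int_0^{2\pi}\int_0^1 h(r,\theta)\overline{\Psi_{m,n}(r,\theta)}\,r\,dr\,d\theta$, and the partial sums are $S_{M,N}(h)=\sum_{m=-M}^M\sum_{n=1}^N C_{m,n}(h)\Psi_{m,n}$. Finite Fourier transform: for $L\in\mathbb{N}$, $\mathbf{k}\in\mathbb{Z}^2$, $\widehat f(\mathbf{k};L)=\delta^2\sum_{i=1}^L\sum_{j=1}^L f(x_i,x_j)e^{-\pi\mathrm{i}(k_1x_i+k_2x_j)}$ with $\delta=2/L$, $x_i=-1+(i-1)\delta$. Coefficients: for $\mathbf{k}=(k_1,k_2)\in\mathbb{Z}^2$, $\mathbf{c}(\mathbf{k};m,n)=\varepsilon_m\sqrt{\pi}(-1)^n\mathrm{i}^m z_{m,n}\frac{J_m(\pi\|\mathbf{k}\|_2)e^{-\mathrm{i}m\Phi(\mathbf{k})}}{2(\pi^2\|\mathbf{k}\|_2^2-z_{m,n}^2)}$, where $\varepsilon_m=1$ if $m\ge0$, $\varepsilon_m=(-1)^m$ if $m<0$, and $\Phi(\mathbf{k})=\mathrm{atan2}(k_2,k_1)$ is the polar angle of $\mathbf{k}$ (with value $0$ at $\mathbf{k}=0$). If $\pi\|\mathbf{k}\|_2=z_{m,n}$, the quotient $J_m(\pi\|\mathbf{k}\|_2)/(\pi^2\|\mathbf{k}\|_2^2-z_{m,n}^2)$ is understood as its limiting value $J_m'(z_{m,n})/(2z_{m,n})$. For $K\in\mathbb{N}$: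 $C_{m,n}^K[f,g]=\sum_{\mathbf{k}\in\mathbb{Z}^2,\ \|\mathbf{k}\|_\infty\le K}\mathbf{c}(\mathbf{k};m,n)\,\widehat f(\mathbf{k};2K+1)\,\widehat g(\mathbf{k};2K+1)$ and $S_{M,N}^K[f,g]=\sum_{m=-M}^M\sum_{n=1}^N C_{m,n}^K[f,g]\Psi_{m,n}$. *)

theory Defs
  imports "HOL-Analysis.Analysis"
begin

definition supported_in :: "(real \<times> real \<Rightarrow> complex) \<Rightarrow> (real \<times> real) set \<Rightarrow> bool" where
  "supported_in f X \<longleftrightarrow> {x. f x \<noteq> 0} \<subseteq> X"

definition C1_plane :: "(real \<times> real \<Rightarrow> complex) \<Rightarrow> bool" where
  "C1_plane f \<longleftrightarrow> continuous_on UNIV f \<and>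
     (\<exists>f1 f2. continuous_on UNIV f1 \<and> continuous_on UNIV f2 \<and>
       (\<forall>x y. ((\<lambda>t. f (t, y)) has_vector_derivative f1 (x, y)) (at x) \<and>
              ((\<lambda>t. f (x, t)) has_vector_derivative f2 (x, y)) (at y)))"

text \<open>The supremum is taken in the extended reals, so it is \<open>\<infinity>\<close> for unbounded functions.\<close>

definition sup_norm :: "(real \<times> real \<Rightarrow> complex) \<Rightarrow> ereal" where
  "sup_norm f = (SUP x. ereal (norm (f x)))"

definition convolution ::
    "(real \<times> real \<Rightarrow> complex) \<Rightarrow> (real \<times> real \<Rightarrow> complex) \<Rightarrow> real \<times> real \<Rightarrow> complex" where
  "convolution f g x = (LINT y|lborel. f y * g (x - y))"

definition polar_angle :: "real \<times> real \<Rightarrow> real" where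
  "polar_angle x = Arg (Complex (fst x) (snd x))"

text \<open>\<open>rGamma\<close> is the entire function \<open>1 / \<Gamma>\<close>: for \<open>m < 0\<close> the terms with \<open>k < - m\<close>, the only ones
  with a negative exponent, vanish.\<close>

definition besselJ :: "int \<Rightarrow> real \<Rightarrow> real" where
  "besselJ m x = (\<Sum>k. (- 1) ^ k / fact k * rGamma (real_of_int m + real k + 1) *
                        (x / 2) powi (2 * int k + m))"

text \<open>The \<open>n\<close>-th positive zero, for \<open>n \<ge> 1\<close>: the positive zero \<open>x\<close> such that exactly \<open>n\<close> positive
  zeros are at most \<open>x\<close>.\<close>

definition bessel_zero :: "int \<Rightarrow> nat \<Rightarrow> real" where
  "bessel_zero m n =
     (THE x. 0 < x \<and> besselJ m x = 0 \<and> finite {y. 0 < y \<and> y \<le> x \<and> besselJ m y = 0} \<and>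
             card {y. 0 < y \<and> y \<le> x \<and> besselJ m y = 0} = n)"

definition K_index :: "int \<Rightarrow> nat \<Rightarrow> int" where
  "K_index m n = \<lceil>bessel_zero m n / pi\<rceil>"

definition K_max :: "nat \<Rightarrow> nat \<Rightarrow> int" where
  "K_max M N = Max {K_index m n | m n. 0 \<le> m \<and> m \<le> int M \<and> 1 \<le> n \<and> n \<le> N}"

definition Psi_polar :: "int \<Rightarrow> nat \<Rightarrow> real \<Rightarrow> real \<Rightarrow> complex" where
  "Psi_polar m n r \<theta> =
     (if r \<le> 1 then exp (\<i> * of_int m * of_real \<theta>) * of_real (besselJ m (bessel_zero m n * r)) /
                    of_real (sqrt pi * \<bar>besselJ (m + 1) (bessel_zero m n)\<bar>)
      else 0)"

definition Psi :: "int \<Rightarrow> nat \<Rightarrow> real \<times> real \<Rightarrow> complex" where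
  "Psi m n x = Psi_polar m n (norm x) (polar_angle x)"

definition FB_coeff :: "int \<Rightarrow> nat \<Rightarrow> (real \<times> real \<Rightarrow> complex) \<Rightarrow> complex" where
  "FB_coeff m n h =
     (LINT \<theta>:{0..2 * pi}|lborel. (LINT r:{0..1}|lborel.
        h (r * cos \<theta>, r * sin \<theta>) * cnj (Psi_polar m n r \<theta>) * of_real r))"

definition FB_sum :: "nat \<Rightarrow> nat \<Rightarrow> (real \<times> real \<Rightarrow> complex) \<Rightarrow> real \<times> real \<Rightarrow> complex" where
  "FB_sum M N h x = (\<Sum>m = - int M..int M. \<Sum>n = 1..N. FB_coeff m n h * Psi m n x)"

definition grid :: "nat \<Rightarrow> nat \<Rightarrow> real" where
  "grid L i = - 1 + (real i - 1) * (2 / real L)"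

definition finite_FT :: "(real \<times> real \<Rightarrow> complex) \<Rightarrow> int \<times> int \<Rightarrow> nat \<Rightarrow> complex" where
  "finite_FT f k L =
     of_real ((2 / real L)\<^sup>2) *
     (\<Sum>i = 1..L. \<Sum>j = 1..L. f (grid L i, grid L j) *
        exp (- (of_real pi * \<i> * of_real (of_int (fst k) * grid L i + of_int (snd k) * grid L j))))"

definition eps_sign :: "int \<Rightarrow> real" where
  "eps_sign m = (if m \<ge> 0 then 1 else (- 1) powi m)"

definition real_pair :: "int \<times> int \<Rightarrow> real \<times> real" where
  "real_pair k = (of_int (fst k), of_int (snd k))"

text \<open>The quotient \<open>J_m(t) / (t\<^sup>2 - z\<^sup>2)\<close> with \<open>z = z_{m,n}\<close>, extended to \<open>t = z\<close> by its limit.\<close>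

definition bessel_quot :: "int \<Rightarrow> nat \<Rightarrow> real \<Rightarrow> real" where
  "bessel_quot m n t =
     (if t = bessel_zero m n then deriv (besselJ m) (bessel_zero m n) / (2 * bessel_zero m n)
      else besselJ m t / (t\<^sup>2 - (bessel_zero m n)\<^sup>2))"

definition c_coeff :: "int \<times> int \<Rightarrow> int \<Rightarrow> nat \<Rightarrow> complex" where
  "c_coeff k m n =
     of_real (eps_sign m * sqrt pi * (- 1) ^ n) * \<i> powi m * of_real (bessel_zero m n) *
     (of_real (bessel_quot m n (pi * norm (real_pair k))) *
      exp (- (\<i> * of_int m * of_real (polar_angle (real_pair k)))) / 2)"

definition approx_coeff ::
    "nat \<Rightarrow> int \<Rightarrow> nat \<Rightarrow> (real \<times> real \<Rightarrow> complex) \<Rightarrow> (real \<times> real \<Rightarrow> complex) \<Rightarrow> complex" where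
  "approx_coeff K m n f g =
     (\<Sum>k \<in> {- int K..int K} \<times> {- int K..int K}.
        c_coeff k m n * finite_FT f k (2 * K + 1) * finite_FT g k (2 * K + 1))"

definition approx_sum ::
    "nat \<Rightarrow> nat \<Rightarrow> nat \<Rightarrow> (real \<times> real \<Rightarrow> complex) \<Rightarrow> (real \<times> real \<Rightarrow> complex) \<Rightarrow>
     real \<times> real \<Rightarrow> complex" where
  "approx_sum K M N f g x =
     (\<Sum>m = - int M..int M. \<Sum>n = 1..N. approx_coeff K m n f g * Psi m n x)"

end

theory Submission
  imports Defs
begin

text \<open>
  Integrating a plane wave \<open>exp (\<i> \<pi> k \<cdot> x)\<close> against \<open>\<Psi>\<^bsub>m,n\<^esub>\<close> over the unit disc, first in the angle
  (Jacobi-Anger) and then in the radius (Lommel's integral), gives \<open>4 c(k; m, n)\<close>. Hence the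
  approximate coefficient is exactly the Fourier-Bessel coefficient of the trigonometric polynomial
  \<open>h\<^sub>K\<close> with coefficients \<open>F(k) G(k) / 4\<close>, where \<open>F\<close> and \<open>G\<close> are the finite Fourier transforms.
  At the points of \<open>(2 / L) \<int>\<^sup>2\<close>, where \<open>L = 2 K + 1\<close>, the
  polynomial \<open>h\<^sub>K\<close> equals a Riemann sum for \<open>h = f \<star> g\<close>, so that \<open>h\<^sub>K - h = O(1 / K)\<close> there. As \<open>f\<close> and
  \<open>g\<close> are Lipschitz, \<open>h\<close> has second differences of quadratic order, so its Fejer mean \<open>Q\<close> of degree
  \<open>K\<close> is uniformly within \<open>O(1 / K)\<close> of \<open>h\<close>. By the discrete Parseval identity the coefficients of
  \<open>h\<^sub>K - Q\<close> are \<open>O(1 / K)\<close> in \<open>l\<^sup>2\<close>, and the sequence \<open>c(k; m, n)\<close> is in \<open>l\<^sup>2\<close> because it decays like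
  \<open>|k|\<^sup>-\<^sup>2\<close>; Cauchy-Schwarz concludes. The sign \<open>(-1)\<^sup>n\<close> in \<open>c(k; m, n)\<close> requires the existence, simplicity
  and alternation of the positive zeros of \<open>J\<^sub>m\<close>.
\<close>

section \<open>Bessel functions of integer order\<close>

text \<open>The obstacle is that h_K is known to be close to h only at grid points, whereas a
  Fourier-Bessel coefficient sees it on the whole disc, and grid values control a trigonometric
  polynomial of degree \<open>K\<close> without loss only in mean square. Hence the comparison is
  made between coefficients in l^2, and it needs a second polynomial Q of the same degree because h
  itself is not one. Replacing h by Q costs no logarithm: for a merely Lipschitz function the Fejer
  error is O(log K / K), and it is the quadratic bound on second differences that improves it to O(1
  / K). The l^2 setting also suits the coefficients: the crude bound 1 for the absolute value of a
  Bessel function gives decay of order -2 in the frequency, which is square summable over the planar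
  lattice but not summable. The radius 1/2 of the supports puts the support of h inside one period
  square.\<close>

definition bessel_aux_coeff :: "nat \<Rightarrow> nat \<Rightarrow> real" where
  "bessel_aux_coeff m k = (- 1) ^ k / (fact k * fact (m + k))"

text \<open>The Bessel function with \<open>(x / 2) ^ m\<close> split off, in the variable
  \<open>y = x^2 / 4\<close>; up to the sign of \<open>y\<close> this is the Bessel-Clifford
  function. Being a power series, it can be differentiated termwise.\<close>

definition bessel_aux :: "nat \<Rightarrow> real \<Rightarrow> real" where
  "bessel_aux m y = (\<Sum>k. bessel_aux_coeff m k * y ^ k)"

lemma summable_bessel_aux: "summable (\<lambda>k. bessel_aux_coeff m k * y ^ k)"
proof (rule summable_comparison_test)
  show "summable (\<lambda>k. inverse (fact k) * \<bar>y\<bar> ^ k)"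
    by (rule summable_exp)
  have "norm (bessel_aux_coeff m k * y ^ k) \<le> inverse (fact k) * \<bar>y\<bar> ^ k" for k
  proof -
    have "(fact k :: real) * 1 \<le> fact k * fact (m + k)"
      by (intro mult_left_mono fact_ge_1) auto
    then have "\<bar>bessel_aux_coeff m k\<bar> \<le> inverse (fact k)"
      by (simp add: bessel_aux_coeff_def abs_mult power_abs divide_simps)
    then show ?thesis
      by (simp add: abs_mult power_abs mult_right_mono)
  qed
  then show "\<exists>N. \<forall>k\<ge>N. norm (bessel_aux_coeff m k * y ^ k) \<le> inverse (fact k) * \<bar>y\<bar> ^ k"
    by blast
qed

lemma DERIV_bessel_aux: "(bessel_aux m has_real_derivative - bessel_aux (Suc m) y) (at y)"
proof -
  have "diffs (bessel_aux_coeff m) k = - bessel_aux_coeff (Suc m) k" for k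
    by (simp add: diffs_def bessel_aux_coeff_def field_simps del: of_nat_Suc)
  then have "(\<Sum>k. diffs (bessel_aux_coeff m) k * y ^ k) = - bessel_aux (Suc m) y"
    by (simp add: bessel_aux_def suminf_minus summable_bessel_aux)
  with termdiffs_strong_converges_everywhere[OF summable_bessel_aux, of m y]
  show ?thesis by (simp add: bessel_aux_def[abs_def])
qed

text \<open>Comparison of the coefficients of \<open>y ^ Suc k\<close>: over the denominator
  \<open>fact (Suc k) * fact (Suc m + Suc k)\<close> the numerators combine to
  \<open>(m + 1) - (m + k + 2) = - (k + 1)\<close>, which cancels a factor of
  \<open>fact (Suc k)\<close>.\<close>

lemma bessel_aux_recurrence:
  "bessel_aux m y + y * bessel_aux (m + 2) y = (m + 1) * bessel_aux (Suc m) y"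
proof -
  define d where "d k = (real m + 1) * (bessel_aux_coeff (Suc m) k * y ^ k) - bessel_aux_coeff m k * y ^ k" for k
  have d: "summable d" unfolding d_def
    by (intro summable_diff summable_mult summable_bessel_aux)
  have "suminf d = (m + 1) * bessel_aux (Suc m) y - bessel_aux m y"
    unfolding d_def bessel_aux_def
    by (subst suminf_diff[symmetric])
       (simp_all add: suminf_mult summable_bessel_aux summable_mult add.commute)
  moreover have "d 0 = 0"
    using nonzero_mult_divide_mult_cancel_left[of "real m + 1" 1 "fact m"]
    by (simp add: d_def bessel_aux_coeff_def add.commute)
  moreover have "d (Suc k) = y * (bessel_aux_coeff (m + 2) k * y ^ k)" for k
  proof -
    have a: "(fact (Suc m + Suc k) :: real) = real (m + k + 2) * fact (m + Suc k)" by (simp add: algebra_simps)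
    have "(real m + 1) * bessel_aux_coeff (Suc m) (Suc k) - bessel_aux_coeff m (Suc k) = bessel_aux_coeff (m + 2) k"
    proof -
      have expand: "s / (p * q) = N * (s / (p * (N * q)))" if "N \<noteq> 0" for N s p q :: real
        using that by simp
      have "bessel_aux_coeff m (Suc k) = (m + k + 2) * ((- 1) ^ Suc k / (fact (Suc k) * fact (Suc m + Suc k)))"
        unfolding bessel_aux_coeff_def a by (rule expand) simp
      then have "(real m + 1) * bessel_aux_coeff (Suc m) (Suc k) - bessel_aux_coeff m (Suc k)
        = (real m + 1 - (m + k + 2)) * ((- 1) ^ Suc k / (fact (Suc k) * fact (Suc m + Suc k)))"
        by (simp only: bessel_aux_coeff_def left_diff_distrib mult.assoc)
      also have "\<dots> = (real k + 1) * ((- 1) ^ k / (fact (Suc k) * fact (Suc m + Suc k)))"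
        by (simp add: field_simps del: fact_Suc)
      also have "\<dots> = (- 1) ^ k / (fact k * fact (m + 2 + k))"
        by (simp add: divide_simps)
      finally show ?thesis by (simp add: bessel_aux_coeff_def)
    qed
    moreover have "d (Suc k) = ((real m + 1) * bessel_aux_coeff (Suc m) (Suc k) - bessel_aux_coeff m (Suc k)) * y ^ Suc k"
      unfolding d_def by (simp only: left_diff_distrib mult.assoc)
    ultimately show ?thesis by simp
  qed
  then have "(\<Sum>k. d (Suc k)) = y * bessel_aux (m + 2) y"
    by (simp add: bessel_aux_def suminf_mult summable_bessel_aux)
  ultimately show ?thesis using suminf_split_head[OF d] by (simp add: add.commute)
qed

lemma besselJ_of_nat: "besselJ (int m) x = (x / 2) ^ m * bessel_aux m (x\<^sup>2 / 4)"
proof -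
  have r: "rGamma (real_of_int (int m) + real k + 1) = inverse (fact (m + k))" for k
    using Gamma_fact[of "m + k", where 'a = real] by (simp add: rGamma_inverse_Gamma add_ac)
  have p: "(x / 2) powi (2 * int k + int m) = (x / 2) ^ m * (x\<^sup>2 / 4) ^ k" for k
  proof -
    have "(x / 2) powi (2 * int k + int m) = (x / 2) ^ (2 * k + m)"
      by (metis (mono_tags) of_nat_add of_nat_mult of_nat_numeral power_int_of_nat)
    also have "\<dots> = (x / 2) ^ m * ((x / 2)\<^sup>2) ^ k"
      unfolding power_add power_mult by (rule mult.commute)
    finally show ?thesis by (simp add: power_divide)
  qed
  have "besselJ (int m) x = (\<Sum>k. (x / 2) ^ m * (bessel_aux_coeff m k * (x\<^sup>2 / 4) ^ k))"
    unfolding besselJ_def bessel_aux_coeff_def r p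
  proof (intro arg_cong[where f = suminf] ext)
    have "a / b * inverse c * (d * e) = d * (a / (b * c) * e)" for a b c d e :: real
      by (simp add: divide_simps)
    then show "(- 1) ^ k / fact k * inverse (fact (m + k)) * ((x / 2) ^ m * (x\<^sup>2 / 4) ^ k)
        = (x / 2) ^ m * ((- 1) ^ k / (fact k * fact (m + k)) * (x\<^sup>2 / 4) ^ k)" for k .
  qed
  then show ?thesis
    by (simp add: bessel_aux_def suminf_mult summable_bessel_aux)
qed

text \<open>\<open>rGamma\<close> kills the first \<open>m\<close> terms. After shifting the index
  by \<open>m\<close> the factorials of \<open>k\<close> and \<open>m + k\<close> have traded
  places, and only the sign \<open>(- 1) ^ m\<close> is left over.\<close>

lemma besselJ_neg: "besselJ (- int m) x = (- 1) ^ m * besselJ (int m) x"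
proof -
  define a where "a k = (- 1) ^ k / fact k * rGamma (real_of_int (- int m) + real k + 1) *
                        (x / 2) powi (2 * int k + - int m)" for k
  have z: "a k = 0" if "k < m" for k
  proof -
    have "real_of_int (- int m) + real k + 1 = - real (m - k - 1)" using that by simp
    then have "rGamma (real_of_int (- int m) + real k + 1) = 0"
      by (simp only: rGamma_eq_zero_iff minus_of_nat_in_nonpos_Ints)
    then show ?thesis by (simp only: a_def mult_zero_left mult_zero_right)
  qed
  have s: "a (k + m) = (- 1) ^ m * ((x / 2) ^ m * (bessel_aux_coeff m k * (x\<^sup>2 / 4) ^ k))" for k
  proof -
    have "rGamma (real_of_int (- int m) + real (k + m) + 1) = inverse (fact k)"
      using Gamma_fact[of "k", where 'a = real] by (simp add: rGamma_inverse_Gamma add_ac)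
    moreover have "(x / 2) powi (2 * int (k + m) + - int m) = (x / 2) ^ m * (x\<^sup>2 / 4) ^ k"
    proof -
      have "2 * int (k + m) + - int m = int (2 * k + m)" by simp
      have "(x / 2) powi (2 * int (k + m) + - int m) = (x / 2) ^ (2 * k + m)"
        unfolding \<open>2 * int (k + m) + - int m = int (2 * k + m)\<close>
        by (rule power_int_of_nat)
      also have "\<dots> = (x / 2) ^ m * ((x / 2)\<^sup>2) ^ k"
        unfolding power_add power_mult by (rule mult.commute)
      finally show ?thesis by (simp add: power_divide)
    qed
    ultimately show ?thesis
      by (simp add: a_def bessel_aux_coeff_def power_add field_simps)
  qed
  have "(\<lambda>k. a (k + m)) sums ((- 1) ^ m * besselJ (int m) x)"
    unfolding s besselJ_of_nat bessel_aux_def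
    by (intro sums_mult summable_sums summable_bessel_aux)
  then have "a sums ((- 1) ^ m * besselJ (int m) x)"
    by (subst (asm) sums_iff_shift) (simp add: z)
  then show ?thesis unfolding besselJ_def a_def by (simp add: sums_iff)
qed

text \<open>Written with the power \<open>m - 1\<close> instead of a quotient by \<open>x\<close> so
  as to hold at \<open>x = 0\<close> too; for \<open>m = 0\<close> the truncated exponent is
  harmless because of the factor \<open>m\<close>.\<close>

lemma DERIV_besselJ:
  "(besselJ (int m) has_real_derivative m * (x / 2) ^ (m - 1) / 2 * bessel_aux m (x\<^sup>2 / 4) - besselJ (int (Suc m)) x) (at x)"
proof -
  have "((\<lambda>x. (x / 2) ^ m * bessel_aux m (x\<^sup>2 / 4)) has_real_derivative
     m * (x / 2) ^ (m - 1) * (1 / 2) * bessel_aux m (x\<^sup>2 / 4)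
      + (- bessel_aux (Suc m) (x\<^sup>2 / 4) * (2 * x / 4)) * (x / 2) ^ m) (at x)"
    by (intro DERIV_mult DERIV_chain'[OF _ DERIV_bessel_aux])
       (auto intro!: derivative_eq_intros)
  moreover have "besselJ (int m) = (\<lambda>x. (x / 2) ^ m * bessel_aux m (x\<^sup>2 / 4))"
    by (rule ext) (rule besselJ_of_nat)
  moreover have "besselJ (int (Suc m)) x = (x / 2) ^ Suc m * bessel_aux (Suc m) (x\<^sup>2 / 4)"
    by (rule besselJ_of_nat)
  ultimately show ?thesis
    by (simp only:) (simp add: algebra_simps)
qed

lemma besselJ_recurrence:
  "x * besselJ (int m) x + x * besselJ (int (m + 2)) x = 2 * (m + 1) * besselJ (int (Suc m)) x"
  using arg_cong[OF bessel_aux_recurrence[of m "x\<^sup>2 / 4"], of "\<lambda>t. x * (x / 2) ^ m * t"]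
  unfolding besselJ_of_nat
  by (simp add: algebra_simps power2_eq_square)

lemma continuous_besselJ: "continuous_on S (besselJ (int m))"
  using DERIV_besselJ by (meson DERIV_isCont continuous_at_imp_continuous_on)

lemma DERIV_besselJ_mult:
  assumes "x \<noteq> 0"
  shows "(besselJ (int m) has_real_derivative m / x * besselJ (int m) x - besselJ (int (Suc m)) x) (at x)"
proof -
  have "m * (x / 2) ^ (m - 1) / 2 * bessel_aux m (x\<^sup>2 / 4) = m / x * besselJ (int m) x"
    using assms by (cases m) (simp_all add: besselJ_of_nat field_simps del: of_nat_Suc)
  with DERIV_besselJ[of m x] show ?thesis by simp
qed

text \<open>Together with \<open>DERIV_besselJ_mult\<close> this closes the pair of orders
  \<open>m\<close>, \<open>m + 1\<close> under differentiation, so that the identities behind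
  Lommel's integrals and the Sturm comparison reduce to field arithmetic, without second
  derivatives.\<close>

lemma DERIV_besselJ_Suc:
  assumes "x \<noteq> 0"
  shows "(besselJ (int (Suc m)) has_real_derivative besselJ (int m) x - (real m + 1) / x * besselJ (int (Suc m)) x) (at x)"
proof -
  have "real (Suc m) / x * besselJ (int (Suc m)) x - besselJ (int (Suc (Suc m))) x
      = besselJ (int m) x - (real m + 1) / x * besselJ (int (Suc m)) x"
    using assms besselJ_recurrence[of x m] by (simp add: field_simps)
  from DERIV_cong[OF DERIV_besselJ_mult[OF assms] this] show ?thesis .
qed

lemma besselJ_pos_near_0: "\<forall>\<^sub>F x in at_right 0. besselJ (int m) x > 0"
proof -
  have "isCont (\<lambda>x. bessel_aux m (x\<^sup>2 / 4)) 0"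
    by (intro continuous_intros isCont_o2[OF _ DERIV_isCont[OF DERIV_bessel_aux]]) auto
  then have "((\<lambda>x. bessel_aux m (x\<^sup>2 / 4)) \<longlongrightarrow> bessel_aux m 0) (at 0)"
    by (simp add: isCont_def)
  moreover have "bessel_aux m 0 > 0"
    unfolding bessel_aux_def powser_zero by (simp add: bessel_aux_coeff_def)
  ultimately have "\<forall>\<^sub>F x in at 0. bessel_aux m (x\<^sup>2 / 4) > 0"
    by (rule order_tendstoD)
  then have "\<forall>\<^sub>F x in at_right 0. bessel_aux m (x\<^sup>2 / 4) > 0"
    by (rule filter_leD[rotated]) (simp add: at_le)
  moreover have "\<forall>\<^sub>F x in at_right 0. x > (0::real)"
    by (rule eventually_at_right_less)
  ultimately show ?thesis
    by eventually_elim (simp add: besselJ_of_nat)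
qed

text \<open>The chain rule is applied to \<open>DERIV_besselJ\<close>, not to its quotient form, so
  that \<open>c = 0\<close> is allowed: this value occurs for the frequency
  \<open>k = 0\<close>.\<close>

lemma DERIV_besselJ_scaled:
  assumes "r \<noteq> 0"
  shows "((\<lambda>r. besselJ (int m) (c * r)) has_real_derivative
    m / r * besselJ (int m) (c * r) - c * besselJ (int (Suc m)) (c * r)) (at r)"
proof -
  have eq: "(m * (c * r / 2) ^ (m - 1) / 2 * bessel_aux m ((c * r)\<^sup>2 / 4) - besselJ (int (Suc m)) (c * r)) * c
      = m / r * besselJ (int m) (c * r) - c * besselJ (int (Suc m)) (c * r)"
    using assms by (cases m) (simp_all add: besselJ_of_nat[of "Suc _"] field_simps del: of_nat_Suc)
  have "((\<lambda>r. c * r) has_real_derivative c) (at r)"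
    by (auto intro!: derivative_eq_intros)
  from DERIV_cong[OF DERIV_chain2[OF DERIV_besselJ this] eq] show ?thesis .
qed

lemma DERIV_besselJ_Suc_scaled:
  assumes "r \<noteq> 0"
  shows "((\<lambda>r. besselJ (int (Suc m)) (c * r)) has_real_derivative
    c * besselJ (int m) (c * r) - (real m + 1) / r * besselJ (int (Suc m)) (c * r)) (at r)"
proof -
  have "real (Suc m) / r * besselJ (int (Suc m)) (c * r) - c * besselJ (int (Suc (Suc m))) (c * r)
      = c * besselJ (int m) (c * r) - (real m + 1) / r * besselJ (int (Suc m)) (c * r)"
    using assms besselJ_recurrence[of "c * r" m] by (simp add: field_simps)
  from DERIV_cong[OF DERIV_besselJ_scaled[OF assms] this] show ?thesis .
qed

section \<open>Lommel's integrals\<close>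

lemma continuous_besselJ_scaled [continuous_intros]:
  "continuous_on S f \<Longrightarrow> continuous_on S (\<lambda>x. besselJ (int m) (f x))"
  by (rule continuous_on_compose2[OF continuous_besselJ[of UNIV]]) auto

text \<open>The antiderivative \<open>W\<close> is \<open>r\<close> times the Wronskian of the two
  scaled Bessel functions, in which the terms with \<open>m / r\<close> cancel; Bessel's equation
  for both gives its derivative. The factor \<open>a^2 - b^2\<close> stays on the left so that
  nothing is divided by zero.\<close>

lemma lommel_integral:
  "((\<lambda>r. (a\<^sup>2 - b\<^sup>2) * (r * besselJ (int m) (a * r) * besselJ (int m) (b * r))) has_integral
     a * besselJ (int (Suc m)) a * besselJ (int m) b - b * besselJ (int (Suc m)) b * besselJ (int m) a) {0..1}"
proof -
  define W where "W r = a * (r * besselJ (int (Suc m)) (a * r) * besselJ (int m) (b * r))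
      - b * (r * besselJ (int (Suc m)) (b * r) * besselJ (int m) (a * r))" for r
  have "(W has_vector_derivative (a\<^sup>2 - b\<^sup>2) * (r * besselJ (int m) (a * r) * besselJ (int m) (b * r))) (at r)"
    if "r \<in> {0<..<1}" for r
  proof -
    from that have r: "r \<noteq> 0" by auto
    have "(W has_real_derivative (a\<^sup>2 - b\<^sup>2) * (r * besselJ (int m) (a * r) * besselJ (int m) (b * r))) (at r)"
      unfolding W_def
      by (rule DERIV_cong, (rule DERIV_besselJ_Suc_scaled[OF r] DERIV_besselJ_scaled[OF r]
              DERIV_diff DERIV_add DERIV_cmult DERIV_mult DERIV_ident)+)
         (use r in \<open>simp add: field_simps power2_eq_square del: of_nat_Suc\<close>)
    then show ?thesis by (simp add: has_real_derivative_iff_has_vector_derivative)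
  qed
  moreover have "continuous_on {0..1} W"
    unfolding W_def by (intro continuous_intros)
  ultimately have "((\<lambda>r. (a\<^sup>2 - b\<^sup>2) * (r * besselJ (int m) (a * r) * besselJ (int m) (b * r)))
      has_integral W 1 - W 0) {0..1}"
    by (intro fundamental_theorem_of_calculus_interior) auto
  then show ?thesis by (simp add: W_def mult.assoc)
qed

text \<open>\<open>V\<close> is the classical antiderivative, half of \<open>r^2\<close> times
  (square of order \<open>m\<close> minus product of orders \<open>m - 1\<close> and
  \<open>m + 1\<close>), with order \<open>m - 1\<close> eliminated by the recurrence so that
  \<open>m = 0\<close> needs no separate case. At \<open>r = 1\<close> only the square of order
  \<open>m + 1\<close> survives.\<close>

lemma lommel_integral_zero:
  assumes z: "z \<noteq> 0" and zero: "besselJ (int m) z = 0"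
  shows "((\<lambda>r. r * (besselJ (int m) (z * r))\<^sup>2) has_integral (besselJ (int (Suc m)) z)\<^sup>2 / 2) {0..1}"
proof -
  define V where "V r = 1 / 2 * (r * besselJ (int m) (z * r))\<^sup>2 + 1 / 2 * (r * besselJ (int (Suc m)) (z * r))\<^sup>2
      - m / z * (r * besselJ (int m) (z * r) * besselJ (int (Suc m)) (z * r))" for r
  have "(V has_vector_derivative r * (besselJ (int m) (z * r))\<^sup>2) (at r)"
    if "r \<in> {0<..<1}" for r
  proof -
    from that have r: "r \<noteq> 0" by auto
    have "(V has_real_derivative r * (besselJ (int m) (z * r))\<^sup>2) (at r)"
      unfolding V_def power2_eq_square
      by (rule DERIV_cong, (rule DERIV_besselJ_Suc_scaled[OF r] DERIV_besselJ_scaled[OF r]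
              DERIV_diff DERIV_add DERIV_cmult DERIV_mult DERIV_ident)+)
         (use r z in \<open>simp add: field_simps power2_eq_square del: of_nat_Suc\<close>)
    then show ?thesis by (simp add: has_real_derivative_iff_has_vector_derivative)
  qed
  moreover have "continuous_on {0..1} V"
    unfolding V_def by (intro continuous_intros)
  ultimately have "((\<lambda>r. r * (besselJ (int m) (z * r))\<^sup>2) has_integral V 1 - V 0) {0..1}"
    by (intro fundamental_theorem_of_calculus_interior) auto
  then show ?thesis using zero by (simp add: V_def)
qed

section \<open>Positive zeros\<close>

text \<open>A common zero of both orders would make the second Lommel integral vanish. Its integrand
  is nonnegative and continuous, so \<open>besselJ m\<close> would vanish on all of
  \<open>(0, z]\<close>, against its positivity near \<open>0\<close>.\<close>

lemma besselJ_zero_simple: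
  assumes z: "z > 0" and zero: "besselJ (int m) z = 0"
  shows "besselJ (int (Suc m)) z \<noteq> 0"
proof
  assume "besselJ (int (Suc m)) z = 0"
  then have "((\<lambda>r. r * (besselJ (int m) (z * r))\<^sup>2) has_integral 0) {0..1}"
    using lommel_integral_zero[OF _ zero] z by simp
  then have *: "r * (besselJ (int m) (z * r))\<^sup>2 = 0" if "r \<in> {0..1}" for r
    using has_integral_0_cbox_imp_0[of 0 1 "\<lambda>r. r * (besselJ (int m) (z * r))\<^sup>2" r] that
    by (simp add: continuous_intros)
  have 0: "besselJ (int m) (z * r) = 0" if "r \<in> {0<..1}" for r
    using *[of r] that by auto
  from besselJ_pos_near_0[of m] obtain e where e: "e > 0" "\<And>y. 0 < y \<Longrightarrow> y < e \<Longrightarrow> besselJ (int m) y > 0"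
    unfolding eventually_at_right_field by auto
  define y where "y = min (e / 2) z"
  have "besselJ (int m) y > 0" "y \<le> z" "y > 0" using e z by (auto simp: y_def)
  with 0[of "y / z"] z show False by auto
qed

lemma DERIV_besselJ_at_zero:
  assumes "z > 0" and "besselJ (int m) z = 0"
  shows "(besselJ (int m) has_real_derivative - besselJ (int (Suc m)) z) (at z)"
  using DERIV_besselJ_mult[of z m] assms by simp

text \<open>An accumulation point of zeros is again a zero by continuity; positivity near
  \<open>0\<close> excludes the point \<open>0\<close>, and the nonzero derivative at simple zeros
  excludes every other one.\<close>

lemma finite_besselJ_zeros: "finite {y. 0 < y \<and> y \<le> x \<and> besselJ (int m) y = 0}"
proof (rule ccontr)
  let ?Z = "{y. 0 < y \<and> y \<le> x \<and> besselJ (int m) y = 0}"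
  assume "infinite ?Z"
  moreover have "?Z \<subseteq> {0..x}" by auto
  ultimately obtain p where p: "p islimpt ?Z" "p \<in> {0..x}"
    using compact_Icc[of 0 x] unfolding compact_eq_Bolzano_Weierstrass by metis
  have "besselJ (int m) p = 0"
  proof -
    have "closed {y. besselJ (int m) y = 0}"
      by (intro closed_Collect_eq continuous_intros)
    moreover have "p islimpt {y. besselJ (int m) y = 0}"
      using p(1) by (rule islimpt_subset) auto
    ultimately show ?thesis by (simp add: closed_limpt)
  qed
  show False
  proof (cases "p = 0")
    case True
    from besselJ_pos_near_0[of m] obtain e where e: "e > 0" "\<And>y. 0 < y \<Longrightarrow> y < e \<Longrightarrow> besselJ (int m) y > 0"
      unfolding eventually_at_right_field by auto
    from p(1) e(1) True obtain y where "y \<in> ?Z" "\<bar>y\<bar> < e"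
      unfolding islimpt_approachable by (auto simp: dist_real_def)
    with e(2)[of y] show False by auto
  next
    case False
    then have "p > 0" using p by simp
    note D = DERIV_besselJ_at_zero[OF this \<open>besselJ (int m) p = 0\<close>]
    have "((\<lambda>y. (besselJ (int m) y - besselJ (int m) p) / (y - p)) \<longlongrightarrow> - besselJ (int (Suc m)) p) (at p)"
      using D by (simp add: has_field_derivative_iff)
    then have "\<forall>\<^sub>F y in at p. (besselJ (int m) y - besselJ (int m) p) / (y - p) \<noteq> 0"
    proof (rule tendsto_imp_eventually_ne)
      show "- besselJ (int (Suc m)) p \<noteq> 0"
        using besselJ_zero_simple[OF \<open>p > 0\<close> \<open>besselJ (int m) p = 0\<close>] by simp
    qed
    then have "\<forall>\<^sub>F y in at p. y \<notin> ?Z"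
      by eventually_elim (use \<open>besselJ (int m) p = 0\<close> in auto)
    with p(1) show False by (simp add: islimpt_iff_eventually)
  qed
qed

text \<open>Sturm comparison of \<open>w = \<surd>x J\<^sub>m\<close>, which satisfies \<open>w'' + (1 - (m\<^sup>2 - 1/4) / x\<^sup>2) w = 0\<close>,
  with \<open>s = sin ((x - a) / 2)\<close>: the function \<open>W\<close> is the Wronskian \<open>w' s - w s'\<close>.\<close>

lemma besselJ_large_zero: "\<exists>x > X. besselJ (int m) x = 0"
proof (rule ccontr)
  assume no: "\<not> (\<exists>x > X. besselJ (int m) x = 0)"
  \<comment> \<open>From \<open>x \<ge> a\<close> follows \<open>x \<ge> 2 * m\<close>, so the
    coefficient \<open>1 - (m^2 - 1/4) / x^2\<close> is at least \<open>1/4\<close>, the squared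
    frequency of the comparison sine.\<close>
  define a where "a = \<bar>X\<bar> + 2 * real m + 2"
  have a: "a > X" "a > 0" "a \<ge> 2 * real m + 2" by (auto simp: a_def)
  define \<sigma> where "\<sigma> = sgn (besselJ (int m) a)"
  have \<sigma>: "\<sigma> * besselJ (int m) x > 0" if "x \<ge> a" for x
  proof -
    have nz: "besselJ (int m) y \<noteq> 0" if "y \<ge> a" for y using no a that by force
    have "\<sigma> * besselJ (int m) a > 0" using nz[of a] by (auto simp: \<sigma>_def sgn_if)
    moreover have "\<sigma> \<noteq> 0" using nz[of a] by (auto simp: \<sigma>_def sgn_if)
    moreover have "continuous_on {a..x} (\<lambda>y. \<sigma> * besselJ (int m) y)"
      by (intro continuous_intros)
    ultimately show ?thesis
      using IVT2'[of "\<lambda>y. \<sigma> * besselJ (int m) y" x 0 a] that nz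
      by (metis less_le_not_le linorder_not_less mult_eq_0_iff)
  qed
  define W where "W x = \<sigma> * (sqrt x * (((real m + 1 / 2) / x * besselJ (int m) x - besselJ (int (Suc m)) x) * sin ((x - a) / 2)
      - 1 / 2 * (besselJ (int m) x * cos ((x - a) / 2))))" for x
  define W' where "W' x = sqrt x * (\<sigma> * besselJ (int m) x) * sin ((x - a) / 2) * ((real m ^ 2 - 1 / 4) / x\<^sup>2 - 3 / 4)" for x
  have D: "(W has_real_derivative W' x) (at x)" if "x > 0" for x
  proof -
    have "inverse (sqrt x) / 2 = sqrt x / (2 * x)" using that by (simp add: field_simps)
    from DERIV_cong[OF DERIV_real_sqrt[OF that] this]
    have d4: "(sqrt has_real_derivative sqrt x / (2 * x)) (at x)" .
    from that have x: "x \<noteq> 0" by auto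
    have d1: "((\<lambda>x. sin ((x - a) / 2)) has_real_derivative cos ((x - a) / 2) / 2) (at x)"
      and d2: "((\<lambda>x. cos ((x - a) / 2)) has_real_derivative - sin ((x - a) / 2) / 2) (at x)"
      and d3: "((\<lambda>x. (real m + 1 / 2) / x) has_real_derivative - (real m + 1 / 2) / x\<^sup>2) (at x)"
      using x by (auto intro!: derivative_eq_intros simp: power2_eq_square)
    show ?thesis unfolding W_def W'_def
      by (rule DERIV_cong, (rule d1 d2 d3 DERIV_besselJ_Suc[OF x] DERIV_besselJ_mult[OF x] d4
              DERIV_diff DERIV_add DERIV_cmult DERIV_mult DERIV_ident)+)
         (use x in \<open>simp add: field_simps power2_eq_square del: of_nat_Suc\<close>)
  qed
  \<comment> \<open>The sine vanishes at both ends of the interval, where only the cosine term of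
    \<open>W\<close> remains. As the cosine passes from \<open>1\<close> to \<open>- 1\<close>,
    \<open>W\<close> would have to rise from a negative to a positive value, although its derivative
    is at most \<open>0\<close>.\<close>
  have "W (a + 2 * pi) \<le> W a"
  proof (rule DERIV_nonpos_imp_nonincreasing[where f = W])
    fix x assume x: "a \<le> x" "x \<le> a + 2 * pi"
    have "W' x \<le> 0"
    proof -
      have "sin ((x - a) / 2) \<ge> 0" using x by (intro sin_ge_zero) auto
      then have "sqrt x * (\<sigma> * besselJ (int m) x) * sin ((x - a) / 2) \<ge> 0"
        using a x by (intro mult_nonneg_nonneg[OF _ less_imp_le[OF \<sigma>[OF x(1)]]] mult_nonneg_nonneg) auto
      moreover have "(real m ^ 2 - 1 / 4) / x\<^sup>2 - 3 / 4 \<le> 0"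
      proof -
        have "(2 * real m)\<^sup>2 \<le> x\<^sup>2" using a x by (intro power_mono) auto
        then have "4 * real m ^ 2 \<le> x\<^sup>2" by (simp add: power_mult_distrib)
        then have "real m ^ 2 - 1 / 4 \<le> 3 / 4 * x\<^sup>2"
          using zero_le_power2[of x] by linarith
        moreover have "x\<^sup>2 > 0" using a x by simp
        ultimately have "(real m ^ 2 - 1 / 4) / x\<^sup>2 \<le> 3 / 4" by (simp only: pos_divide_le_eq)
        then show ?thesis by simp
      qed
      ultimately show ?thesis unfolding W'_def by (rule mult_nonneg_nonpos)
    qed
    then show "\<exists>y. (W has_real_derivative y) (at x) \<and> y \<le> 0"
      using D[of x] a x by auto
  qed auto
  moreover have "W a < 0"
    using \<sigma>[of a] a mult_pos_pos[of "sqrt a" "\<sigma> * besselJ (int m) a"] by (simp add: W_def algebra_simps)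
  moreover have "W (a + 2 * pi) > 0"
  proof -
    have "a + 2 * pi > 0" using a(2) pi_gt_zero by linarith
    then have "sqrt (a + 2 * pi) * (\<sigma> * besselJ (int m) (a + 2 * pi)) > 0"
      by (intro mult_pos_pos \<sigma>) auto
    then show ?thesis by (simp add: W_def algebra_simps)
  qed
  ultimately show False by simp
qed

lemma ex_nth_element:
  fixes Z :: "real set"
  assumes pos: "\<And>z. z \<in> Z \<Longrightarrow> z > 0"
    and fin: "\<And>x. finite {y \<in> Z. y \<le> x}"
    and unbounded: "\<And>x. \<exists>z\<in>Z. z > x"
  shows "n \<ge> 1 \<Longrightarrow> \<exists>x\<in>Z. card {y \<in> Z. y \<le> x} = n"
proof (induction n)
  case (Suc n)
  obtain x where x: "card {y \<in> Z. y \<le> x} = n"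
  proof (cases "n = 0")
    case True
    have "{y \<in> Z. y \<le> 0} = {}" using pos by force
    with True that[of 0] show thesis by simp
  next
    case False
    with Suc.IH that show thesis by auto
  qed
  obtain z where z: "z \<in> Z" "z > x" using unbounded by blast
  define F where "F = {y \<in> Z. y \<le> z} - {y. y \<le> x}"
  have F: "finite F" "z \<in> F" using z fin by (auto simp: F_def)
  define w where "w = Min F"
  have "F \<noteq> {}" using F by blast
  have w: "w \<in> F" "\<And>y. y \<in> F \<Longrightarrow> w \<le> y"
    unfolding w_def using F Min_in[OF F(1) \<open>F \<noteq> {}\<close>] by simp_all
  have "{y \<in> Z. y \<le> w} = insert w {y \<in> Z. y \<le> x}"
  proof -
    have "y = w" if "y \<in> Z" "y \<le> w" "y > x" for y
    proof -
      have "y \<in> F" using that w(1) by (auto simp: F_def)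
      with w(2)[of y] that show ?thesis by simp
    qed
    moreover have "w \<in> Z" "w > x" using w by (auto simp: F_def)
    ultimately show ?thesis by force
  qed
  moreover have "w \<in> Z" "w \<notin> {y \<in> Z. y \<le> x}" using w by (auto simp: F_def)
  ultimately have "card {y \<in> Z. y \<le> w} = Suc n"
    using card_insert_disjoint[OF fin[of x], of w] x by simp
  with \<open>w \<in> Z\<close> show ?case by blast
qed simp

text \<open>The \<open>THE\<close> is meaningful because the zeros are unbounded and locally finite,
  which yields existence, and because the counting function increases strictly at every zero, which
  yields uniqueness.\<close>

lemma bessel_zero_props:
  assumes "n \<ge> 1"
  shows "bessel_zero (int m) n > 0" (is ?pos)
    and "besselJ (int m) (bessel_zero (int m) n) = 0" (is ?zero)
    and "card {y. 0 < y \<and> y \<le> bessel_zero (int m) n \<and> besselJ (int m) y = 0} = n" (is ?card)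
proof -
  define Z where "Z = {y. 0 < y \<and> besselJ (int m) y = 0}"
  have eq: "{y \<in> Z. y \<le> x} = {y. 0 < y \<and> y \<le> x \<and> besselJ (int m) y = 0}" for x
    by (auto simp: Z_def)
  have fin: "finite {y \<in> Z. y \<le> x}" for x
    unfolding eq by (rule finite_besselJ_zeros)
  have ex: "\<exists>x\<in>Z. card {y \<in> Z. y \<le> x} = n"
  proof (rule ex_nth_element[OF _ fin _ assms])
    show "z > 0" if "z \<in> Z" for z using that by (simp add: Z_def)
    show "\<exists>z\<in>Z. z > x" for x
      using besselJ_large_zero[where X = "max 0 x" and m = m] by (auto simp: Z_def)
  qed
  let ?P = "\<lambda>x. 0 < x \<and> besselJ (int m) x = 0 \<and> finite {y. 0 < y \<and> y \<le> x \<and> besselJ (int m) y = 0} \<and>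
             card {y. 0 < y \<and> y \<le> x \<and> besselJ (int m) y = 0} = n"
  have P: "?P x \<longleftrightarrow> x \<in> Z \<and> card {y \<in> Z. y \<le> x} = n" for x
    unfolding eq using finite_besselJ_zeros[of x m] by (auto simp: Z_def)
  have less: "card {y \<in> Z. y \<le> x} < card {y \<in> Z. y \<le> x'}" if "x' \<in> Z" "x < x'" for x x'
  proof (rule psubset_card_mono[OF fin])
    have "{y \<in> Z. y \<le> x} \<subseteq> {y \<in> Z. y \<le> x'}" using that by auto
    moreover have "x' \<in> {y \<in> Z. y \<le> x'}" "x' \<notin> {y \<in> Z. y \<le> x}" using that by auto
    ultimately show "{y \<in> Z. y \<le> x} \<subset> {y \<in> Z. y \<le> x'}" by blast
  qed
  have "\<exists>!x. ?P x"
    unfolding P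
  proof -
    from ex obtain x where x: "x \<in> Z" "card {y \<in> Z. y \<le> x} = n" by blast
    have "x' = x" if "x' \<in> Z" "card {y \<in> Z. y \<le> x'} = n" for x'
      using less[of x x'] less[of x' x] that x by (cases x x' rule: linorder_cases) auto
    with x show "\<exists>!x. x \<in> Z \<and> card {y \<in> Z. y \<le> x} = n" by blast
  qed
  from theI'[OF this] show ?pos ?zero ?card
    unfolding bessel_zero_def by auto
qed

lemma besselJ_no_sign_change:
  assumes "a \<le> b" and "\<And>x. x \<in> {a..b} \<Longrightarrow> besselJ (int m) x \<noteq> 0" and "s * besselJ (int m) a > 0"
  shows "s * besselJ (int m) b > 0"
proof (rule ccontr)
  assume "\<not> s * besselJ (int m) b > 0"
  moreover have "continuous_on {a..b} (\<lambda>x. s * besselJ (int m) x)"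
    by (intro continuous_intros)
  ultimately obtain x where "x \<in> {a..b}" "s * besselJ (int m) x = 0"
    using IVT2'[of "\<lambda>y. s * besselJ (int m) y" b 0 a] assms by auto
  with assms show False by auto
qed

text \<open>As the positive zeros are simple, \<open>J\<^sub>m\<close> changes sign at each of them, starting from positive
  values near \<open>0\<close>.\<close>

lemma besselJ_sign:
  assumes "x > 0" and "besselJ (int m) x \<noteq> 0"
    and "card {t. 0 < t \<and> t \<le> x \<and> besselJ (int m) t = 0} = n"
  shows "(- 1) ^ n * besselJ (int m) x > 0"
  using assms
proof (induction n arbitrary: x)
  case 0
  then have no: "besselJ (int m) t \<noteq> 0" if "0 < t" "t \<le> x" for t
    using that finite_besselJ_zeros[of x m] by auto
  from besselJ_pos_near_0[of m] obtain e where e: "e > 0" "\<And>y. 0 < y \<Longrightarrow> y < e \<Longrightarrow> besselJ (int m) y > 0"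
    unfolding eventually_at_right_field by auto
  have "1 * besselJ (int m) x > 0"
  proof (rule besselJ_no_sign_change)
    show "min (e / 2) x \<le> x" by simp
    show "1 * besselJ (int m) (min (e / 2) x) > 0" using e 0 by auto
    show "besselJ (int m) t \<noteq> 0" if "t \<in> {min (e / 2) x..x}" for t
      using that no[of t] e(1) 0 by (auto simp: min_def split: if_splits)
  qed
  then show ?case by simp
next
  case (Suc n)
  let ?S = "\<lambda>x. {t. 0 < t \<and> t \<le> x \<and> besselJ (int m) t = 0}"
  define z where "z = Max (?S x)"
  have ne: "?S x \<noteq> {}" using Suc.prems by (metis card.empty nat.distinct(1))
  have z: "0 < z" "z \<le> x" "besselJ (int m) z = 0"
    using Max_in[OF finite_besselJ_zeros[of x m] ne] by (auto simp: z_def)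
  have zx: "z < x" using z Suc.prems(2) by (cases "z = x") auto
  have max: "besselJ (int m) t \<noteq> 0" if "z < t" "t \<le> x" for t
    using Max_ge[OF finite_besselJ_zeros[of x m], of t] that z(1) by (auto simp: z_def)
  have Sz: "?S z = ?S x"
  proof (intro Collect_cong iffI conjI; elim conjE)
    show "t \<le> z" if "t \<le> x" "besselJ (int m) t = 0" for t
      using max[of t] that by linarith
  qed (use z in auto)
  \<comment> \<open>A zero-free interval to the left of the last zero \<open>z\<close>: all its
    points have one zero fewer below them than \<open>x\<close>, so the induction hypothesis applies
    there.\<close>
  obtain e where e: "e > 0" "e < z" "\<And>t. z - e \<le> t \<Longrightarrow> t < z \<Longrightarrow> besselJ (int m) t \<noteq> 0"
  proof (cases "?S x = {z}")
    case True
    show thesis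
    proof (rule that[of "z / 2"])
      show "besselJ (int m) t \<noteq> 0" if t: "z - z / 2 \<le> t" "t < z" for t
      proof
        assume "besselJ (int m) t = 0"
        moreover have "t > 0" "t \<le> x" using t z by linarith+
        ultimately have "t \<in> ?S x" by simp
        with t show False unfolding True by simp
      qed
    qed (use z in simp_all)
  next
    case False
    define w where "w = Max (?S x - {z})"
    have "?S x - {z} \<noteq> {}" using False ne by blast
    moreover have fin: "finite (?S x - {z})" using finite_besselJ_zeros[of x m] by simp
    ultimately have w: "w \<in> ?S x - {z}"
      unfolding w_def by (intro Max_in)
    have w_ge: "t \<le> w" if "t \<in> ?S x - {z}" for t
      unfolding w_def using fin that by (rule Max_ge)
    have "w \<in> ?S z" "w \<noteq> z" using w unfolding Sz by blast+
    then have "w < z" by simp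
    have "w > 0" using w by simp
    show thesis
    proof (rule that[of "(z - w) / 2"])
      show "besselJ (int m) t \<noteq> 0" if t: "z - (z - w) / 2 \<le> t" "t < z" for t
      proof
        assume "besselJ (int m) t = 0"
        moreover have "w < t" using t \<open>w < z\<close> by argo
        moreover from this have "t > 0" "t \<le> x" using t z \<open>w > 0\<close> by linarith+
        ultimately have "t \<in> ?S x - {z}" using t by simp
        from w_ge[OF this] \<open>w < t\<close> show False by simp
      qed
      show "(z - w) / 2 < z" "0 < (z - w) / 2" using \<open>w > 0\<close> \<open>w < z\<close> by argo+
    qed
  qed
  have left: "(- 1) ^ n * besselJ (int m) t > 0" if "z - e \<le> t" "t < z" for t
  proof (rule Suc.IH)
    show "t > 0" using that e(2) by linarith
    show "besselJ (int m) t \<noteq> 0" using that by (rule e(3))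
    have "?S z = insert z (?S t)"
    proof (intro equalityI subsetI)
      fix s assume s: "s \<in> ?S z"
      then have s': "0 < s" "s \<le> z" "besselJ (int m) s = 0" by simp_all
      have "s \<le> t \<or> s = z" using s' e(3)[of s] that by linarith
      with s' show "s \<in> insert z (?S t)" by (elim disjE) simp_all
    next
      fix s assume "s \<in> insert z (?S t)"
      with that z show "s \<in> ?S z" by (elim insertE) simp_all
    qed
    moreover have "z \<notin> ?S t" using that by simp
    ultimately have "card (?S z) = Suc (card (?S t))"
      using finite_besselJ_zeros[of t m] by simp
    then show "card (?S t) = n" using Sz Suc.prems by simp
  qed
  define f where "f t = (- 1) ^ n * besselJ (int m) t" for t
  define D where "D = (- 1) ^ n * - besselJ (int (Suc m)) z"
  have D: "(f has_real_derivative D) (at z)"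
    unfolding f_def D_def by (intro DERIV_cmult DERIV_besselJ_at_zero z)
  \<comment> \<open>Since \<open>f\<close> is positive to the left of its simple zero
    \<open>z\<close>, its slope there must be negative, and \<open>f\<close> is negative just to the
    right.\<close>
  have "D \<noteq> 0" using besselJ_zero_simple[OF z(1,3)] by (simp add: D_def)
  moreover have "\<not> D > 0"
  proof
    assume "D > 0"
    then obtain d where d: "d > 0" "\<And>h. 0 < h \<Longrightarrow> h < d \<Longrightarrow> f (z - h) < f z"
      using DERIV_pos_inc_left[OF D] by auto
    define h where "h = min e (d / 2)"
    have h: "h > 0" "h < d" "h \<le> e" using d(1) e(1) by (auto simp: h_def)
    have "f z = 0" using z(3) by (simp add: f_def)
    with d(2)[OF h(1,2)] have "f (z - h) < 0" by simp
    moreover have "f (z - h) > 0" unfolding f_def using h by (intro left) simp_all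
    ultimately show False by simp
  qed
  ultimately have "D < 0" by simp
  then obtain d where d: "d > 0" "\<And>h. 0 < h \<Longrightarrow> h < d \<Longrightarrow> f z > f (z + h)"
    using DERIV_neg_dec_right[OF D] by auto
  define y where "y = z + min (d / 2) (x - z)"
  have yz: "y > z" "y - z < d" using d(1) zx by (auto simp: y_def)
  have "(- 1) ^ Suc n * besselJ (int m) x > 0"
  proof (rule besselJ_no_sign_change)
    show "y \<le> x" by (simp add: y_def)
    show "besselJ (int m) t \<noteq> 0" if "t \<in> {y..x}" for t
      using that yz by (intro max) simp_all
    have "f z = 0" using z(3) by (simp add: f_def)
    with d(2)[of "y - z"] yz have "f y < 0" by simp
    then show "(- 1) ^ Suc n * besselJ (int m) y > 0" by (simp add: f_def)
  qed
  then show ?case .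
qed

text \<open>Immediately to the right of the \<open>n\<close>-th zero exactly \<open>n\<close> zeros
  have been passed, so the sign is \<open>(- 1) ^ n\<close>; the derivative at the zero, which is
  minus the next order, must agree with it. This is the origin of \<open>(- 1) ^ n\<close> in
  \<open>c_coeff\<close>, because \<open>Psi\<close> is normalised by an absolute value.\<close>

lemma besselJ_Suc_sign_at_zero:
  assumes n: "n \<ge> 1"
  shows "- besselJ (int (Suc m)) (bessel_zero (int m) n) = (- 1) ^ n * \<bar>besselJ (int (Suc m)) (bessel_zero (int m) n)\<bar>"
    and "besselJ (int (Suc m)) (bessel_zero (int m) n) \<noteq> 0"
proof -
  let ?S = "\<lambda>x. {t. 0 < t \<and> t \<le> x \<and> besselJ (int m) t = 0}"
  define z where "z = bessel_zero (int m) n"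
  note z = bessel_zero_props[OF n, of m, folded z_def]
  show nz: "besselJ (int (Suc m)) (bessel_zero (int m) n) \<noteq> 0"
    using besselJ_zero_simple[OF z(1,2)] by (simp add: z_def)
  define f where "f t = (- 1) ^ n * besselJ (int m) t" for t
  define D where "D = (- 1) ^ n * - besselJ (int (Suc m)) z"
  have D: "(f has_real_derivative D) (at z)"
    unfolding f_def D_def by (intro DERIV_cmult DERIV_besselJ_at_zero z)
  have "D \<noteq> 0" using nz by (simp add: D_def z_def)
  moreover have "\<not> D < 0"
  proof
    assume "D < 0"
    then obtain d where d: "d > 0" "\<And>h. 0 < h \<Longrightarrow> h < d \<Longrightarrow> f z > f (z + h)"
      using DERIV_neg_dec_right[OF D] by auto
    obtain z' where z': "z' > z" "besselJ (int m) z' = 0"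
      using besselJ_large_zero by blast
    define w where "w = Min {t \<in> ?S z'. t > z}"
    have F: "finite {t \<in> ?S z'. t > z}"
      by (rule finite_subset[OF _ finite_besselJ_zeros[of z' m]]) auto
    have "z' \<in> {t \<in> ?S z'. t > z}" using z' z(1) by simp
    then have F': "{t \<in> ?S z'. t > z} \<noteq> {}" by blast
    have w: "w > z" "w \<le> z'" "besselJ (int m) w = 0"
      using Min_in[OF F F'] unfolding w_def[symmetric] by simp_all
    have min: "besselJ (int m) t \<noteq> 0" if "z < t" "t < w" for t
    proof
      assume "besselJ (int m) t = 0"
      then have "t \<in> {t \<in> ?S z'. t > z}" using that z(1) w(2) by simp
      from Min_le[OF F this] that(2) show False unfolding w_def[symmetric] by simp
    qed
    define h where "h = min (d / 2) ((w - z) / 2)"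
    have "h \<le> d / 2" "h \<le> (w - z) / 2" unfolding h_def by (rule min.cobounded1 min.cobounded2)+
    moreover have "h > 0" using d(1) w(1) by (simp add: h_def)
    ultimately have h: "h > 0" "h < d" "z + h < w" using d(1) w(1) by argo+
    have "?S (z + h) = ?S z"
    proof (intro Collect_cong iffI conjI; elim conjE)
      show "t \<le> z" if "t \<le> z + h" "besselJ (int m) t = 0" for t
        using min[of t] that h by linarith
    qed (use h in auto)
    then have "f (z + h) > 0" unfolding f_def
      using min[of "z + h"] h(1,3) z by (intro besselJ_sign) simp_all
    with d(2)[OF h(1,2)] z(2) show False by (simp add: f_def)
  qed
  ultimately have "D > 0" by simp
  then show "- besselJ (int (Suc m)) (bessel_zero (int m) n) = (- 1) ^ n * \<bar>besselJ (int (Suc m)) (bessel_zero (int m) n)\<bar>"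
    unfolding z_def[symmetric] by (cases "even n") (auto simp: D_def)
qed

section \<open>Fourier-Bessel coefficients of exponentials\<close>

lemma integral_cis_of_int:
  "((\<lambda>\<theta>. cis (of_int j * \<theta>)) has_integral (if j = 0 then 2 * pi else 0)) {0..2 * pi}"
proof (cases "j = 0")
  case True
  have "((\<lambda>\<theta>. 1 :: complex) has_integral measure lborel {0..2 * pi} *\<^sub>R 1) {0..2 * pi}"
    using has_integral_const[of "1 :: complex" 0 "2 * pi"] by simp
  with True show ?thesis by (simp add: scaleR_conv_of_real)
next
  case False
  define F where "F \<theta> = cis (of_int j * \<theta>) / (\<i> * of_int j)" for \<theta> :: real
  have "(F has_vector_derivative cis (of_int j * \<theta>)) (at \<theta> within {0..2 * pi})" for \<theta>
  proof -
    have "((\<lambda>z. exp (\<i> * of_int j * z) / (\<i> * of_int j)) has_field_derivative exp (\<i> * of_int j * of_real \<theta>)) (at (of_real \<theta>))"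
      using False by (auto intro!: derivative_eq_intros)
    from has_vector_derivative_real_field[OF this, of "{0..2 * pi}"]
    show ?thesis unfolding F_def cis_conv_exp by (simp add: mult_ac)
  qed
  then have "((\<lambda>\<theta>. cis (of_int j * \<theta>)) has_integral F (2 * pi) - F 0) {0..2 * pi}"
    by (intro fundamental_theorem_of_calculus) auto
  moreover have "cis (of_int j * (2 * pi)) = 1"
    using cis_multiple_2pi[of "of_int j"] by (simp add: mult_ac)
  ultimately show ?thesis using False by (simp add: F_def)
qed

text \<open>A coefficient of the Jacobi-Anger expansion, obtained by expanding the exponential series and,
  in its \<open>j\<close>-th term, \<open>(2 cos)\<^sup>j\<close> by the binomial theorem.\<close>

lemma integral_exp_cos:
  "((\<lambda>\<theta>. cis (x * cos (\<theta> - \<phi>)) * cis (- of_int m * \<theta>)) has_integral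
     of_real (2 * pi) * \<i> ^ nat \<bar>m\<bar> * besselJ (int (nat \<bar>m\<bar>)) x * cis (- of_int m * \<phi>)) {0..2 * pi}"
proof -
  define p where "p = nat \<bar>m\<bar>"
  define f where "f j \<theta> = (\<i> * of_real (x * cos (\<theta> - \<phi>))) ^ j / fact j * cis (- of_int m * \<theta>)" for j \<theta>
  \<comment> \<open>Orthogonality keeps only the harmonic \<open>j - 2 * l = m\<close> of the
    \<open>j\<close>-th term; at most one \<open>l\<close> contributes.\<close>
  define N where "N j = (\<Sum>l\<le>j. if int j - 2 * int l = m then real (j choose l) else 0)" for j
  define A where "A j = 2 * pi * cis (- of_int m * \<phi>) * ((\<i> * of_real (x / 2)) ^ j / fact j * of_real (N j))" for j
  have f_A: "(f j has_integral A j) {0..2 * pi}" for j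
  proof -
    have expand: "f j \<theta> = (\<Sum>l\<le>j. (\<i> * of_real (x / 2)) ^ j / fact j * of_nat (j choose l) *
        cis (- of_int (int j - 2 * int l) * \<phi>) * cis (of_int (int j - 2 * int l - m) * \<theta>))" for \<theta>
    proof -
      have "of_real (x * cos (\<theta> - \<phi>)) = of_real (x / 2) * (cis (- (\<theta> - \<phi>)) + cis (\<theta> - \<phi>))"
        using cos_minus[of "\<theta> - \<phi>"] sin_minus[of "\<theta> - \<phi>"] by (simp add: complex_eq_iff)
      then have "(\<i> * of_real (x * cos (\<theta> - \<phi>))) ^ j = (\<i> * of_real (x / 2)) ^ j * (cis (- (\<theta> - \<phi>)) + cis (\<theta> - \<phi>)) ^ j"
        by (simp only: power_mult_distrib mult.assoc)
      also have "(cis (- (\<theta> - \<phi>)) + cis (\<theta> - \<phi>)) ^ j = (\<Sum>l\<le>j. of_nat (j choose l) * cis (- (\<theta> - \<phi>)) ^ l * cis (\<theta> - \<phi>) ^ (j - l))"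
        by (rule binomial_ring)
      also have "\<dots> = (\<Sum>l\<le>j. of_nat (j choose l) * cis (of_int (int j - 2 * int l) * (\<theta> - \<phi>)))"
      proof (rule sum.cong[OF refl])
        fix l assume l: "l \<in> {..j}"
        have "cis (- (\<theta> - \<phi>)) ^ l * cis (\<theta> - \<phi>) ^ (j - l) = cis (real l * (- (\<theta> - \<phi>)) + real (j - l) * (\<theta> - \<phi>))"
          by (simp only: Complex.DeMoivre cis_mult)
        also have "real l * (- (\<theta> - \<phi>)) + real (j - l) * (\<theta> - \<phi>) = of_int (int j - 2 * int l) * (\<theta> - \<phi>)"
          using l by (simp add: of_nat_diff algebra_simps)
        finally show "of_nat (j choose l) * cis (- (\<theta> - \<phi>)) ^ l * cis (\<theta> - \<phi>) ^ (j - l) = of_nat (j choose l) * cis (of_int (int j - 2 * int l) * (\<theta> - \<phi>))"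
          by (simp only: mult.assoc)
      qed
      finally have "f j \<theta> = (\<Sum>l\<le>j. (\<i> * of_real (x / 2)) ^ j / fact j * of_nat (j choose l) *
          (cis (of_int (int j - 2 * int l) * (\<theta> - \<phi>)) * cis (- of_int m * \<theta>)))"
        by (simp add: f_def sum_distrib_left sum_distrib_right mult_ac sum_divide_distrib)
      moreover have "cis (of_int (int j - 2 * int l) * (\<theta> - \<phi>)) * cis (- of_int m * \<theta>)
          = cis (- of_int (int j - 2 * int l) * \<phi>) * cis (of_int (int j - 2 * int l - m) * \<theta>)" for l
        unfolding cis_mult by (rule arg_cong[where f = cis]) (simp add: algebra_simps)
      ultimately show ?thesis by (simp only: mult.assoc)
    qed
    have "(f j has_integral (\<Sum>l\<le>j. (\<i> * of_real (x / 2)) ^ j / fact j * of_nat (j choose l) *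
        cis (- of_int (int j - 2 * int l) * \<phi>) * (if int j - 2 * int l - m = 0 then 2 * pi else 0))) {0..2 * pi}"
      unfolding expand[abs_def]
      by (intro has_integral_sum has_integral_mult_right integral_cis_of_int) auto
    also have "(\<Sum>l\<le>j. (\<i> * of_real (x / 2)) ^ j / fact j * of_nat (j choose l) *
        cis (- of_int (int j - 2 * int l) * \<phi>) * (if int j - 2 * int l - m = 0 then 2 * pi else 0)) = A j"
      unfolding A_def N_def of_real_sum sum_distrib_left
      by (intro sum.cong refl) (auto simp del: of_int_diff)
    finally show ?thesis .
  qed
  have f_sums: "(\<lambda>j. f j \<theta>) sums (cis (x * cos (\<theta> - \<phi>)) * cis (- of_int m * \<theta>))" for \<theta>
  proof -
    have "(\<lambda>j. (\<i> * of_real (x * cos (\<theta> - \<phi>))) ^ j /\<^sub>R fact j) sums exp (\<i> * of_real (x * cos (\<theta> - \<phi>)))"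
      by (rule exp_converges)
    from sums_mult2[OF this, of "cis (- of_int m * \<theta>)"]
    show ?thesis by (simp add: f_def cis_conv_exp scaleR_conv_of_real divide_inverse mult_ac)
  qed
  have "uniform_limit {0..2 * pi} (\<lambda>n \<theta>. \<Sum>j<n. f j \<theta>) (\<lambda>\<theta>. suminf (\<lambda>j. f j \<theta>)) sequentially"
  proof (rule Weierstrass_m_test)
    show "summable (\<lambda>j. inverse (fact j) * \<bar>x\<bar> ^ j)" by (rule summable_exp)
    show "norm (f j \<theta>) \<le> inverse (fact j) * \<bar>x\<bar> ^ j" for j \<theta>
    proof -
      have "\<bar>x * cos (\<theta> - \<phi>)\<bar> ^ j \<le> \<bar>x\<bar> ^ j"
        by (intro power_mono) (auto simp: abs_mult mult_left_le)
      then show ?thesis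
        by (simp add: f_def norm_mult norm_divide norm_power divide_simps abs_mult power_mult_distrib)
    qed
  qed
  then obtain I J where IJ: "\<And>n. ((\<lambda>\<theta>. \<Sum>j<n. f j \<theta>) has_integral I n) {0..2 * pi}"
      "((\<lambda>\<theta>. suminf (\<lambda>j. f j \<theta>)) has_integral J) {0..2 * pi}" "I \<longlonglongrightarrow> J"
  proof (rule uniform_limit_integral)
    show "continuous_on {0..2 * pi} (\<lambda>\<theta>. \<Sum>j<n. f j \<theta>)" for n
      unfolding f_def by (intro continuous_intros) auto
  qed auto
  have "I n = (\<Sum>j<n. A j)" for n
    using IJ(1)[of n] has_integral_sum[of "{..<n}" f A "{0..2 * pi}"] f_A
    by (auto intro: has_integral_unique)
  then have "I = (\<lambda>n. \<Sum>j<n. A j)" by blast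
  then have "A sums J" using IJ(3) by (simp add: sums_def)
  \<comment> \<open>The reflection of \<open>l\<close> to \<open>j - l\<close> turns harmonic
    \<open>m\<close> into \<open>- m\<close>, so the count depends only on the absolute value
    \<open>p\<close>.\<close>
  have N_abs: "N j = (\<Sum>l\<le>j. if int j - 2 * int l = int p then real (j choose l) else 0)" for j
  proof (cases "m \<ge> 0")
    case True
    then show ?thesis by (simp add: N_def p_def)
  next
    case False
    then have m: "m = - int p" by (simp add: p_def)
    show ?thesis unfolding N_def m
      by (rule sum.reindex_bij_witness[of _ "\<lambda>l. j - l" "\<lambda>l. j - l"])
         (auto simp: binomial_symmetric[symmetric] of_nat_diff)
  qed
  have N_zero: "N j = 0" if "j \<notin> range (\<lambda>l. 2 * l + p)" for j
    unfolding N_abs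
  proof (rule sum.neutral, safe)
    fix l
    show "(if int j - 2 * int l = int p then real (j choose l) else 0) = 0"
    proof -
      have "int j - 2 * int l \<noteq> int p" using that by (auto simp: image_iff) presburger
      then show ?thesis by simp
    qed
  qed
  have N_val: "N (2 * l + p) = real ((2 * l + p) choose l)" for l
  proof -
    have "N (2 * l + p) = (\<Sum>i\<le>2 * l + p. if i = l then real ((2 * l + p) choose i) else 0)"
      unfolding N_abs by (intro sum.cong) auto
    then show ?thesis by simp
  qed
  \<comment> \<open>The binomial coefficient replaces the \<open>fact j\<close> of the exponential
    series by \<open>fact l * fact (p + l)\<close>, which are the denominators of the Bessel
    series.\<close>
  have A_val: "A (2 * l + p) = of_real (2 * pi) * \<i> ^ p * cis (- of_int m * \<phi>) *
      of_real ((x / 2) ^ p * (bessel_aux_coeff p l * (x\<^sup>2 / 4) ^ l))" for l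
  proof -
    have b: "real ((2 * l + p) choose l) = fact (2 * l + p) / (fact l * fact (p + l))"
      by (subst binomial_fact) (auto simp: algebra_simps)
    have "(\<i> * of_real (x / 2)) ^ (2 * l + p) = (- 1) ^ l * \<i> ^ p * of_real ((x / 2) ^ p * (x\<^sup>2 / 4) ^ l)"
      unfolding power_add power_mult power_mult_distrib by (simp add: power_divide mult_ac)
    then show ?thesis
      unfolding A_def N_val b bessel_aux_coeff_def by (simp add: of_real_divide)
  qed
  have "A sums (of_real (2 * pi) * \<i> ^ p * cis (- of_int m * \<phi>) * of_real (besselJ (int p) x))"
  proof (subst sums_mono_reindex[where g = "\<lambda>l. 2 * l + p", symmetric])
    show "strict_mono (\<lambda>l. 2 * l + p)" by (rule strict_monoI) auto
    show "A j = 0" if "j \<notin> range (\<lambda>l. 2 * l + p)" for j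
      using N_zero[OF that] by (simp add: A_def)
    have "(\<lambda>l. (x / 2) ^ p * (bessel_aux_coeff p l * (x\<^sup>2 / 4) ^ l)) sums besselJ (int p) x"
      unfolding besselJ_of_nat bessel_aux_def
      by (intro sums_mult summable_sums summable_bessel_aux)
    then show "(\<lambda>l. A (2 * l + p)) sums (of_real (2 * pi) * \<i> ^ p * cis (- of_int m * \<phi>) * of_real (besselJ (int p) x))"
      unfolding A_val by (intro sums_mult sums_of_real)
  qed
  with \<open>A sums J\<close> have "J = of_real (2 * pi) * \<i> ^ p * cis (- of_int m * \<phi>) * of_real (besselJ (int p) x)"
    by (rule sums_unique2)
  moreover have "(\<lambda>\<theta>. suminf (\<lambda>j. f j \<theta>)) = (\<lambda>\<theta>. cis (x * cos (\<theta> - \<phi>)) * cis (- of_int m * \<theta>))"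
    using f_sums by (auto simp: sums_iff)
  ultimately show ?thesis using IJ(2) by (simp add: p_def mult_ac)
qed

text \<open>By \<open>integral_exp_cos\<close> the value is, up to a unimodular factor, the mean of
  unimodular numbers over a full period.\<close>

lemma abs_besselJ_le_1: "\<bar>besselJ (int p) x\<bar> \<le> 1"
proof -
  have "norm (of_real (2 * pi) * \<i> ^ p * besselJ (int p) x * cis (- of_int (int p) * 0)) \<le> 1 * measure lborel (cbox 0 (2 * pi))"
  proof (rule has_integral_bound)
    show "((\<lambda>\<theta>. cis (x * cos (\<theta> - 0)) * cis (- of_int (int p) * \<theta>)) has_integral
        of_real (2 * pi) * \<i> ^ p * besselJ (int p) x * cis (- of_int (int p) * 0)) (cbox 0 (2 * pi))"
      using integral_exp_cos[of x 0 "int p"] by simp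
  qed (auto simp: norm_mult)
  then show ?thesis by (simp add: norm_mult norm_power)
qed

section \<open>Characters of period 2, and reduction to nonnegative order\<close>

definition char2 :: "int \<times> int \<Rightarrow> real \<times> real \<Rightarrow> complex" where
  "char2 k x = cis (pi * (of_int (fst k) * fst x + of_int (snd k) * snd x))"

lemma continuous_char2 [continuous_intros]:
  "continuous_on S f \<Longrightarrow> continuous_on S (\<lambda>x. char2 k (f x))"
  unfolding char2_def by (intro continuous_intros)

definition order_sign :: "int \<Rightarrow> real" where
  "order_sign m = (if m < 0 then (- 1) ^ nat \<bar>m\<bar> else 1)"

lemma besselJ_abs: "besselJ m x = order_sign m * besselJ (int (nat \<bar>m\<bar>)) x"
  using besselJ_neg[of "nat \<bar>m\<bar>" x] by (auto simp: order_sign_def)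

lemma abs_order_sign [simp]: "\<bar>order_sign m\<bar> = 1"
  by (auto simp: order_sign_def)

lemma order_sign_neq_0 [simp]: "order_sign m \<noteq> 0"
  by (auto simp: order_sign_def)

lemma bessel_zero_abs: "bessel_zero m n = bessel_zero (int (nat \<bar>m\<bar>)) n"
proof -
  have "besselJ m x = 0 \<longleftrightarrow> besselJ (int (nat \<bar>m\<bar>)) x = 0" for x
    by (subst besselJ_abs) simp
  then show ?thesis unfolding bessel_zero_def by simp
qed

lemma bessel_zero_pos: "n \<ge> 1 \<Longrightarrow> bessel_zero m n > 0"
  using bessel_zero_props(1)[of n "nat \<bar>m\<bar>"] by (subst bessel_zero_abs)

lemma abs_besselJ_le_1': "\<bar>besselJ m x\<bar> \<le> 1"
  unfolding besselJ_abs[of m] abs_mult abs_order_sign mult_1 by (rule abs_besselJ_le_1)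

lemma continuous_besselJ' [continuous_intros]:
  "continuous_on S f \<Longrightarrow> continuous_on S (\<lambda>x. besselJ m (f x))"
  by (subst besselJ_abs) (intro continuous_intros)

text \<open>For negative \<open>m\<close> the order \<open>m + 1\<close> is minus
  (\<open>nat \<bar>m\<bar>\<close> - 1), one below instead of one above the absolute order. At a
  zero of the middle order the recurrence makes these two neighbours opposite.\<close>

lemma abs_besselJ_succ_at_zero:
  assumes n: "n \<ge> 1"
  shows "\<bar>besselJ (m + 1) (bessel_zero m n)\<bar>
    = \<bar>besselJ (int (Suc (nat \<bar>m\<bar>))) (bessel_zero m n)\<bar>"
proof (cases "m \<ge> 0")
  case True
  then show ?thesis by (simp add: add.commute)
next
  case False
  define p where "p = nat (- m) - 1"
  have m: "m = - int (Suc p)" "nat \<bar>m\<bar> = Suc p" using False by (auto simp: p_def)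
  define z where "z = bessel_zero m n"
  have z: "z > 0" "besselJ (int (Suc p)) z = 0"
    using bessel_zero_props(1,2)[OF n, of "Suc p"] by (simp_all add: z_def bessel_zero_abs[of m] m(2) del: of_nat_Suc)
  have "besselJ (int p) z = - besselJ (int (p + 2)) z"
    using besselJ_recurrence[of z p] z by (simp add: distrib_left[symmetric] del: of_nat_Suc)
  moreover have "\<bar>besselJ (m + 1) z\<bar> = \<bar>besselJ (int p) z\<bar>"
    using besselJ_neg[of p z] by (simp add: m(1) abs_mult)
  ultimately show ?thesis by (simp add: m(2) z_def add.commute)
qed

text \<open>On the disc this is the conjugate of \<open>Psi_polar\<close> times the polar Jacobian.
  The cut-off at \<open>r = 1\<close> is dropped, which makes it jointly continuous.\<close>

definition FB_weight :: "int \<Rightarrow> nat \<Rightarrow> real \<Rightarrow> real \<Rightarrow> complex" where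
  "FB_weight m n \<theta> r = cis (- of_int m * \<theta>) * of_real (besselJ m (bessel_zero m n * r) /
     (sqrt pi * \<bar>besselJ (m + 1) (bessel_zero m n)\<bar>)) * of_real r"

text \<open>For continuous \<open>h\<close> the iterated Lebesgue integral becomes an iterated gauge
  integral, to which exchange of order and the fundamental theorem of calculus apply; the joint
  continuity is recorded for that exchange.\<close>

lemma FB_coeff_eq_integral:
  fixes m :: int and n :: nat and h :: "real \<times> real \<Rightarrow> complex"
  defines "G \<equiv> \<lambda>\<theta> r. h (r * cos \<theta>, r * sin \<theta>) * FB_weight m n \<theta> r"
  assumes h: "continuous_on UNIV h"
  shows "continuous_on (UNIV :: (real \<times> real) set) (\<lambda>(\<theta>, r). G \<theta> r)"
    and "continuous_on S (G \<theta>)"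
    and "FB_coeff m n h = integral {0..2 * pi} (\<lambda>\<theta>. integral {0..1} (G \<theta>))"
proof -
  have h': "continuous_on S (\<lambda>x. h (f x))" if "continuous_on S f" for S and f :: "real \<times> real \<Rightarrow> _"
    by (rule continuous_on_compose2[OF h that]) auto
  show cont: "continuous_on (UNIV :: (real \<times> real) set) (\<lambda>(\<theta>, r). G \<theta> r)"
    unfolding G_def FB_weight_def case_prod_unfold divide_inverse by (intro continuous_intros h')
  have cont': "continuous_on S (G \<theta>)" for \<theta> S
  proof -
    have "continuous_on S (\<lambda>r. (\<theta>, r))" by (intro continuous_intros)
    from continuous_on_compose2[OF cont this] show ?thesis by simp
  qed
  then show "continuous_on S (G \<theta>)" .
  have inner: "(LINT r:{0..1}|lborel. h (r * cos \<theta>, r * sin \<theta>) * cnj (Psi_polar m n r \<theta>) * of_real r)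
      = integral {0..1} (G \<theta>)" for \<theta>
  proof -
    have "(LINT r:{0..1}|lborel. h (r * cos \<theta>, r * sin \<theta>) * cnj (Psi_polar m n r \<theta>) * of_real r)
        = (LINT r:{0..1}|lborel. G \<theta> r)"
      by (intro set_lebesgue_integral_cong)
         (auto simp: Psi_polar_def G_def FB_weight_def exp_cnj cis_conv_exp mult_ac)
    also have "\<dots> = integral {0..1} (G \<theta>)"
      by (intro set_borel_integral_eq_integral borel_integrable_atLeastAtMost' cont')
    finally show ?thesis .
  qed
  have "continuous_on {0..2 * pi} (\<lambda>\<theta>. integral (cbox 0 1) (G \<theta>))"
    by (rule integral_continuous_on_param) (rule continuous_on_subset[OF cont], simp)
  then show "FB_coeff m n h = integral {0..2 * pi} (\<lambda>\<theta>. integral {0..1} (G \<theta>))"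
    unfolding FB_coeff_def inner
    by (intro set_borel_integral_eq_integral borel_integrable_atLeastAtMost') simp
qed

lemma FB_coeff_diff_bound:
  assumes h: "continuous_on UNIV h" and g: "continuous_on UNIV g"
    and e: "\<And>x. norm x \<le> 1 \<Longrightarrow> norm (h x - g x) \<le> e"
  shows "norm (FB_coeff m n h - FB_coeff m n g) \<le> 2 * pi / (sqrt pi * \<bar>besselJ (m + 1) (bessel_zero m n)\<bar>) * e"
proof -
  define c where "c = sqrt pi * \<bar>besselJ (m + 1) (bessel_zero m n)\<bar>"
  define w where "w = FB_weight m n"
  define G where "G u \<theta> r = u (r * cos \<theta>, r * sin \<theta>) * w \<theta> r" for u :: "real \<times> real \<Rightarrow> complex" and \<theta> r
  note F = FB_coeff_eq_integral[where m = m and n = n, folded w_def, folded G_def]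
  have "c \<ge> 0" by (simp add: c_def)
  have "e \<ge> 0" using norm_ge_zero e[of 0, simplified] by (rule order_trans)
  have I1: "G u \<theta> integrable_on {0..1}" if "continuous_on UNIV u" for u \<theta>
    by (intro integrable_continuous_real F(2) that)
  have C2: "continuous_on {0..2 * pi} (\<lambda>\<theta>. integral {0..1} (G u \<theta>))" if "continuous_on UNIV u" for u
  proof -
    have "continuous_on {0..2 * pi} (\<lambda>\<theta>. integral (cbox 0 1) (G u \<theta>))"
      by (rule integral_continuous_on_param) (rule continuous_on_subset[OF F(1)[OF that]], simp)
    then show ?thesis by simp
  qed
  have I2: "(\<lambda>\<theta>. integral {0..1} (G u \<theta>)) integrable_on {0..2 * pi}" if "continuous_on UNIV u" for u
    by (intro integrable_continuous_real C2 that)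
  have "norm (integral {0..1} (G h \<theta>) - integral {0..1} (G g \<theta>)) \<le> e / c" for \<theta>
  proof -
    have "norm (integral {0..1} (\<lambda>r. G h \<theta> r - G g \<theta> r)) \<le> e / c * (1 - 0)"
    proof (rule integral_bound)
      show "continuous_on {0..1} (\<lambda>r. G h \<theta> r - G g \<theta> r)"
        by (intro continuous_on_diff F(2) h g)
      fix r :: real assume r: "r \<in> {0..1}"
      have "norm (r * cos \<theta>, r * sin \<theta>) = \<bar>r\<bar>"
      proof -
        have "(r * cos \<theta>)\<^sup>2 + (r * sin \<theta>)\<^sup>2 = r\<^sup>2 * ((cos \<theta>)\<^sup>2 + (sin \<theta>)\<^sup>2)"
          by (simp only: power_mult_distrib distrib_left)
        then show ?thesis by (simp add: norm_Pair)
      qed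
      then have "norm (h (r * cos \<theta>, r * sin \<theta>) - g (r * cos \<theta>, r * sin \<theta>)) \<le> e"
        using r by (intro e) simp
      moreover have "norm (w \<theta> r) \<le> 1 / c"
      proof -
        have "\<bar>besselJ m (bessel_zero m n * r)\<bar> * \<bar>r\<bar> \<le> 1 * 1"
          using r by (intro mult_mono abs_besselJ_le_1') auto
        then show ?thesis
          using \<open>c \<ge> 0\<close> by (simp add: w_def FB_weight_def c_def[symmetric] norm_mult norm_divide divide_right_mono)
      qed
      ultimately have "norm (h (r * cos \<theta>, r * sin \<theta>) - g (r * cos \<theta>, r * sin \<theta>)) * norm (w \<theta> r) \<le> e * (1 / c)"
        using \<open>e \<ge> 0\<close> by (intro mult_mono) auto
      then show "norm (G h \<theta> r - G g \<theta> r) \<le> e / c"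
        by (simp add: G_def norm_mult flip: left_diff_distrib)
    qed auto
    then show ?thesis using I1[OF h] I1[OF g] by (simp add: integral_diff)
  qed
  then have "norm (integral {0..2 * pi} (\<lambda>\<theta>. integral {0..1} (G h \<theta>) - integral {0..1} (G g \<theta>))) \<le> e / c * (2 * pi - 0)"
    by (intro integral_bound continuous_on_diff C2 h g) auto
  then show ?thesis
    unfolding c_def[symmetric] F(3)[OF h] F(3)[OF g] using I2[OF h] I2[OF g]
    by (simp add: integral_diff mult_ac)
qed

lemma FB_coeff_trig_sum:
  assumes "finite A"
  shows "FB_coeff m n (\<lambda>x. \<Sum>k\<in>A. q k * char2 k x) = (\<Sum>k\<in>A. q k * FB_coeff m n (char2 k))"
proof -
  define w where "w = FB_weight m n"
  define G where "G u \<theta> r = u (r * cos \<theta>, r * sin \<theta>) * w \<theta> r" for u :: "real \<times> real \<Rightarrow> complex" and \<theta> r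
  note F = FB_coeff_eq_integral[where m = m and n = n, folded w_def, folded G_def]
  have c: "continuous_on UNIV (char2 k)" for k
    using continuous_char2[OF continuous_on_id] .
  have I1: "G (char2 k) \<theta> integrable_on {0..1}" for k \<theta>
    by (intro integrable_continuous_real F(2) c)
  have I2: "(\<lambda>\<theta>. integral {0..1} (G (char2 k) \<theta>)) integrable_on {0..2 * pi}" for k
  proof -
    have "continuous_on {0..2 * pi} (\<lambda>\<theta>. integral (cbox 0 1) (G (char2 k) \<theta>))"
      by (rule integral_continuous_on_param) (rule continuous_on_subset[OF F(1)[OF c]], simp)
    then show ?thesis by (intro integrable_continuous_real) simp
  qed
  have "continuous_on UNIV (\<lambda>x. \<Sum>k\<in>A. q k * char2 k x)"
    by (intro continuous_intros)
  from F(3)[OF this] have "FB_coeff m n (\<lambda>x. \<Sum>k\<in>A. q k * char2 k x)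
      = integral {0..2 * pi} (\<lambda>\<theta>. integral {0..1} (G (\<lambda>x. \<Sum>k\<in>A. q k * char2 k x) \<theta>))" .
  also have "(\<lambda>\<theta>. integral {0..1} (G (\<lambda>x. \<Sum>k\<in>A. q k * char2 k x) \<theta>))
      = (\<lambda>\<theta>. \<Sum>k\<in>A. q k * integral {0..1} (G (char2 k) \<theta>))"
  proof
    fix \<theta>
    have "G (\<lambda>x. \<Sum>k\<in>A. q k * char2 k x) \<theta> = (\<lambda>r. \<Sum>k\<in>A. q k * G (char2 k) \<theta> r)"
      by (simp add: G_def[abs_def] sum_distrib_right mult.assoc)
    then show "integral {0..1} (G (\<lambda>x. \<Sum>k\<in>A. q k * char2 k x) \<theta>) = (\<Sum>k\<in>A. q k * integral {0..1} (G (char2 k) \<theta>))"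
      using I1 assms by (simp add: integral_sum integrable_on_mult_right)
  qed
  also have "integral {0..2 * pi} \<dots> = (\<Sum>k\<in>A. q k * integral {0..2 * pi} (\<lambda>\<theta>. integral {0..1} (G (char2 k) \<theta>)))"
    using I2 assms by (simp add: integral_sum integrable_on_mult_right)
  finally show ?thesis unfolding F(3)[OF c] .
qed

text \<open>The two branches of \<open>bessel_quot\<close> are the two Lommel integrals: the
  resonant case \<open>t = z\<close> and the generic case, divided by \<open>t^2 - z^2\<close>. In
  both the boundary term contains minus the next order at \<open>z\<close>, rewritten by the sign
  rule at the zeros.\<close>

lemma integral_bessel_product:
  fixes p n :: nat and t :: real
  assumes n: "n \<ge> 1" and t: "t \<ge> 0"
  defines "z \<equiv> bessel_zero (int p) n"
  shows "((\<lambda>r. r * besselJ (int p) (t * r) * besselJ (int p) (z * r)) has_integral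
    (- 1) ^ n * \<bar>besselJ (int (Suc p)) z\<bar> * z * bessel_quot (int p) n t) {0..1}"
proof -
  note z = bessel_zero_props(1,2)[OF n, of p, folded z_def]
  have sign: "(- 1) ^ n * \<bar>besselJ (int (Suc p)) z\<bar> = - besselJ (int (Suc p)) z"
    using besselJ_Suc_sign_at_zero(1)[OF n, of p] by (simp add: z_def)
  show ?thesis
  proof (cases "t = z")
    case True
    have "deriv (besselJ (int p)) z = - besselJ (int (Suc p)) z"
      by (rule DERIV_imp_deriv) (rule DERIV_besselJ_at_zero[OF z])
    then have "(- 1) ^ n * \<bar>besselJ (int (Suc p)) z\<bar> * z * bessel_quot (int p) n t = (besselJ (int (Suc p)) z)\<^sup>2 / 2"
      unfolding sign using z True by (simp add: bessel_quot_def z_def[symmetric] power2_eq_square)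
    moreover have "((\<lambda>r. r * besselJ (int p) (t * r) * besselJ (int p) (z * r)) has_integral (besselJ (int (Suc p)) z)\<^sup>2 / 2) {0..1}"
      using lommel_integral_zero[OF _ z(2)] z(1) True by (simp add: power2_eq_square mult.assoc)
    ultimately show ?thesis by (simp only:)
  next
    case False
    have nz: "t\<^sup>2 - z\<^sup>2 \<noteq> 0" using False t z(1) by (simp add: power2_eq_iff)
    have "((\<lambda>r. inverse (t\<^sup>2 - z\<^sup>2) * ((t\<^sup>2 - z\<^sup>2) * (r * besselJ (int p) (t * r) * besselJ (int p) (z * r)))) has_integral
     inverse (t\<^sup>2 - z\<^sup>2) * (t * besselJ (int (Suc p)) t * besselJ (int p) z - z * besselJ (int (Suc p)) z * besselJ (int p) t)) {0..1}"
      by (intro has_integral_mult_right lommel_integral)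
    moreover have "inverse (t\<^sup>2 - z\<^sup>2) * (t * besselJ (int (Suc p)) t * besselJ (int p) z - z * besselJ (int (Suc p)) z * besselJ (int p) t)
        = (- 1) ^ n * \<bar>besselJ (int (Suc p)) z\<bar> * z * bessel_quot (int p) n t"
      unfolding sign using False z(2) by (simp add: bessel_quot_def z_def[symmetric] divide_inverse)
    moreover have "inverse (t\<^sup>2 - z\<^sup>2) * ((t\<^sup>2 - z\<^sup>2) * x) = x" for x using nz by simp
    ultimately show ?thesis by simp
  qed
qed

lemma bessel_quot_abs: "bessel_quot m n t = order_sign m * bessel_quot (int (nat \<bar>m\<bar>)) n t"
proof -
  define p where "p = nat \<bar>m\<bar>"
  have "besselJ m = (\<lambda>x. order_sign m * besselJ (int p) x)"
    unfolding p_def by (rule ext) (rule besselJ_abs)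
  moreover have "deriv (\<lambda>x. order_sign m * besselJ (int p) x) y = order_sign m * deriv (besselJ (int p)) y" for y
  proof (rule DERIV_imp_deriv, rule DERIV_cmult)
    show "(besselJ (int p) has_real_derivative deriv (besselJ (int p)) y) (at y)"
      using DERIV_besselJ[of p y] DERIV_imp_deriv by metis
  qed
  ultimately show ?thesis
    unfolding p_def[symmetric] bessel_quot_def bessel_zero_abs[of m, folded p_def] by simp
qed

lemma char2_polar:
  "char2 k (r * cos \<theta>, r * sin \<theta>) =
    cis (pi * norm (real_pair k) * r * cos (\<theta> - polar_angle (real_pair k)))"
proof -
  define w where "w = Complex (of_int (fst k)) (of_int (snd k))"
  have "norm (real_pair k) = cmod w" by (simp add: real_pair_def w_def norm_Pair cmod_def)
  moreover have "polar_angle (real_pair k) = Arg w" by (simp add: polar_angle_def real_pair_def w_def)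
  moreover have "rcis (cmod w) (Arg w) = w" by (rule rcis_cmod_Arg)
  then have "of_int (fst k) = cmod w * cos (Arg w)" "of_int (snd k) = cmod w * sin (Arg w)"
    by (auto simp: w_def complex_eq_iff)
  ultimately show ?thesis
    by (simp add: char2_def cos_diff algebra_simps)
qed

text \<open>\<open>FB_coeff\<close> integrates over the radius first, but it is the angular integral
  that turns a character into a Bessel function; hence the exchange of the two integrals.\<close>

lemma FB_coeff_char2:
  assumes n: "n \<ge> 1"
  shows "FB_coeff m n (char2 k) = 4 * c_coeff k m n"
proof -
  define p where "p = nat \<bar>m\<bar>"
  define z where "z = bessel_zero (int p) n"
  define t where "t = pi * norm (real_pair k)"
  define \<phi> where "\<phi> = polar_angle (real_pair k)"
  define J where "J = \<bar>besselJ (int (Suc p)) z\<bar>"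
  have zm: "bessel_zero m n = z" unfolding z_def p_def by (rule bessel_zero_abs)
  have J0: "J > 0" using besselJ_Suc_sign_at_zero(2)[OF n, of p] by (simp add: J_def z_def)
  have Jm: "\<bar>besselJ (m + 1) z\<bar> = J"
    using abs_besselJ_succ_at_zero[OF n, of m] unfolding zm J_def p_def .
  define G where "G \<theta> r = char2 k (r * cos \<theta>, r * sin \<theta>) * FB_weight m n \<theta> r" for \<theta> r
  have c: "continuous_on UNIV (char2 k)"
    using continuous_char2[OF continuous_on_id] .
  note F = FB_coeff_eq_integral[where m = m and n = n and h = "char2 k", folded G_def, OF c]
  have G: "G \<theta> r = of_real (order_sign m * (r * besselJ (int p) (z * r)) / (sqrt pi * J)) *
      (cis (t * r * cos (\<theta> - \<phi>)) * cis (- of_int m * \<theta>))" for \<theta> r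
    unfolding G_def FB_weight_def char2_polar zm Jm besselJ_abs[of m, folded p_def] t_def \<phi>_def
    by (simp add: mult_ac)
  have inner: "integral {0..2 * pi} (\<lambda>\<theta>. G \<theta> r) =
      2 * sqrt pi * order_sign m / J * (\<i> ^ p * cis (- of_int m * \<phi>)) * of_real (r * besselJ (int p) (t * r) * besselJ (int p) (z * r))" for r
  proof -
    have "((\<lambda>\<theta>. G \<theta> r) has_integral of_real (order_sign m * (r * besselJ (int p) (z * r)) / (sqrt pi * J)) *
        (of_real (2 * pi) * \<i> ^ p * besselJ (int p) (t * r) * cis (- of_int m * \<phi>))) {0..2 * pi}"
      unfolding G p_def by (intro has_integral_mult_right integral_exp_cos)
    moreover have "of_real (order_sign m * (r * besselJ (int p) (z * r)) / (sqrt pi * J)) *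
        (of_real (2 * pi) * \<i> ^ p * besselJ (int p) (t * r) * cis (- of_int m * \<phi>))
        = of_real (2 * (pi / sqrt pi) * order_sign m / J) * (\<i> ^ p * cis (- of_int m * \<phi>)) * of_real (r * besselJ (int p) (t * r) * besselJ (int p) (z * r))"
      by simp
    moreover have "pi / sqrt pi = sqrt pi" by (rule real_div_sqrt) simp
    ultimately show ?thesis by (simp only: integral_unique of_real_mult of_real_divide of_real_numeral)
  qed
  \<comment> \<open>For negative \<open>m\<close> the sign equals
    \<open>(- 1) ^ p = \<i> ^ (2 * p)\<close>, so it turns \<open>\<i> powi m\<close> into the power
    \<open>\<i> ^ p\<close> produced by the angular integral. The other sign, from passing to order
    \<open>p\<close> in the radial factor, is absorbed by \<open>bessel_quot_abs\<close>.\<close>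
  have eps: "eps_sign m * \<i> powi m = \<i> ^ p"
  proof (cases "m \<ge> 0")
    case True
    then show ?thesis by (simp add: eps_sign_def p_def power_int_def)
  next
    case False
    then have m: "m = - int p" by (simp add: p_def)
    have "eps_sign m = (- 1) ^ p"
      using False by (cases "even p") (simp_all add: eps_sign_def m power_int_minus)
    moreover have "(- 1) ^ p = \<i> ^ p * \<i> ^ p"
      by (simp flip: power_mult_distrib)
    ultimately have "eps_sign m * \<i> powi m = \<i> ^ p * \<i> ^ p * inverse (\<i> ^ p)"
      by (simp add: m power_int_minus)
    then show ?thesis by simp
  qed
  have "FB_coeff m n (char2 k) = integral (cbox 0 (2 * pi)) (\<lambda>\<theta>. integral (cbox 0 1) (G \<theta>))"
    using F(3) by simp
  also have "\<dots> = integral (cbox 0 1) (\<lambda>r. integral (cbox 0 (2 * pi)) (\<lambda>\<theta>. G \<theta> r))"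
    by (rule integral_swap_continuous) (rule continuous_on_subset[OF F(1)], simp)
  also have "\<dots> = integral {0..1} (\<lambda>r. of_real (2 * sqrt pi * order_sign m / J) * (\<i> ^ p * cis (- of_int m * \<phi>)) * of_real (r * besselJ (int p) (t * r) * besselJ (int p) (z * r)))"
    by (simp only: inner box_real of_real_mult of_real_divide of_real_numeral)
  also have "\<dots> = of_real (2 * sqrt pi * order_sign m / J) * (\<i> ^ p * cis (- of_int m * \<phi>)) * of_real ((- 1) ^ n * J * z * bessel_quot (int p) n t)"
    unfolding J_def z_def
    by (intro integral_unique has_integral_mult_right has_integral_of_real integral_bessel_product n)
       (simp add: t_def)
  also have "\<dots> = of_real (2 * sqrt pi * (- 1) ^ n * z * (order_sign m * bessel_quot (int p) n t)) * \<i> ^ p * cis (- of_int m * \<phi>)"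
    using J0 by simp
  also have "\<dots> = 4 * c_coeff k m n"
    unfolding c_coeff_def zm eps[symmetric] bessel_quot_abs[of m, folded p_def] t_def[symmetric] \<phi>_def[symmetric]
    by (simp add: cis_conv_exp mult_ac)
  finally show ?thesis .
qed

section \<open>Square summability of the coefficients\<close>

abbreviation freq_box :: "nat \<Rightarrow> (int \<times> int) set" where
  "freq_box K \<equiv> {- int K..int K} \<times> {- int K..int K}"

lemma sum_Times_mult:
  fixes u :: "'a \<Rightarrow> 'c :: comm_semiring_0" and v :: "'b \<Rightarrow> 'c"
  shows "(\<Sum>k\<in>A \<times> B. u (fst k) * v (snd k)) = (\<Sum>a\<in>A. u a) * (\<Sum>b\<in>B. v b)"
  by (simp add: sum_product sum.cartesian_product case_prod_unfold)

lemma norm_Psi_le: "norm (Psi m n x) \<le> 1 / (sqrt pi * \<bar>besselJ (m + 1) (bessel_zero m n)\<bar>)"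
proof -
  have "norm (exp (\<i> * of_int m * complex_of_real (polar_angle x))) = 1"
    by (simp add: norm_exp_eq_Re)
  then show ?thesis
    by (simp add: Psi_def Psi_polar_def norm_mult norm_divide divide_right_mono abs_besselJ_le_1')
qed

text \<open>The two new terms are at most \<open>4 / ((K + 1) * (K + 2))\<close>, which telescopes;
  the subtracted quotient carries the induction, with equality at \<open>K = 0\<close>.\<close>

lemma sum_inverse_one_plus_square_le:
  "(\<Sum>j\<in>{- int K..int K}. 1 / (1 + (real_of_int j)\<^sup>2)) \<le> 5 - 4 / (real K + 1)"
proof (induction K)
  case (Suc K)
  have "{- int (Suc K)..int (Suc K)} = insert (int (Suc K)) (insert (- int (Suc K)) {- int K..int K})"
    by auto
  then have "(\<Sum>j\<in>{- int (Suc K)..int (Suc K)}. 1 / (1 + (real_of_int j)\<^sup>2))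
      = 2 / (1 + (real K + 1)\<^sup>2) + (\<Sum>j\<in>{- int K..int K}. 1 / (1 + (real_of_int j)\<^sup>2))"
    by (simp add: power2_eq_square algebra_simps)
  also have "2 / (1 + (real K + 1)\<^sup>2) \<le> 4 / ((real K + 1) * (real K + 2))"
    by (simp add: divide_simps) (simp add: algebra_simps power2_eq_square)
  also have "4 / ((real K + 1) * (real K + 2)) = 4 / (real K + 1) - 4 / (real (Suc K) + 1)"
    by (simp add: field_simps)
  finally show ?case using Suc.IH by simp
qed simp

lemma norm_c_coeff:
  assumes "n \<ge> 1"
  shows "norm (c_coeff k m n) = sqrt pi / 2 * bessel_zero m n * \<bar>bessel_quot m n (pi * norm (real_pair k))\<bar>"
proof -
  have "norm (exp (- (\<i> * of_int m * complex_of_real (polar_angle (real_pair k))))) = 1"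
    by (simp add: norm_exp_eq_Re)
  moreover have "\<bar>eps_sign m\<bar> = 1" by (simp add: eps_sign_def power_int_abs)
  moreover have "norm (\<i> powi m) = 1" by (simp add: norm_power_int)
  ultimately show ?thesis using bessel_zero_pos[OF assms, of m]
    by (simp add: c_coeff_def norm_mult norm_divide abs_mult norm_power power_abs)
qed

text \<open>At twice the zero or beyond, \<open>t = pi * norm (real_pair k)\<close> is away from the
  resonance: both \<open>4 * z^2\<close> and, since \<open>pi \<ge> 2\<close>, four times the
  squared norm of \<open>k\<close> are at most \<open>t^2\<close>. So the denominator dominates that
  squared norm, and the Bessel numerator is at most \<open>1\<close>.\<close>

lemma norm_c_coeff_decay:
  assumes n: "n \<ge> 1" and far: "pi * norm (real_pair k) \<ge> 2 * bessel_zero m n"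
  shows "norm (c_coeff k m n) \<le> sqrt pi / 2 * bessel_zero m n / (norm (real_pair k))\<^sup>2"
proof -
  define z where "z = bessel_zero m n"
  define t where "t = pi * norm (real_pair k)"
  have z: "z > 0" using bessel_zero_pos[OF n] by (simp add: z_def)
  have "(2 * z)\<^sup>2 \<le> t\<^sup>2" using far z by (intro power_mono) (auto simp: z_def t_def)
  then have zt: "4 * z\<^sup>2 \<le> t\<^sup>2" by (simp add: power_mult_distrib)
  have t: "t > 0" using far z by (simp add: t_def z_def)
  then have k: "norm (real_pair k) > 0" by (simp add: t_def zero_less_mult_iff)
  have "2\<^sup>2 \<le> pi\<^sup>2" using pi_ge_two by (intro power_mono) auto
  then have "4 * (norm (real_pair k))\<^sup>2 \<le> t\<^sup>2"
    unfolding t_def power_mult_distrib by (intro mult_right_mono) auto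
  moreover have "t\<^sup>2 > 0" using t by simp
  ultimately have le: "(norm (real_pair k))\<^sup>2 \<le> t\<^sup>2 - z\<^sup>2" using zt by linarith
  have k2: "(norm (real_pair k))\<^sup>2 > 0" using k by simp
  have "t \<noteq> z" using far z by (auto simp: t_def z_def)
  moreover have "\<bar>t\<^sup>2 - z\<^sup>2\<bar> = t\<^sup>2 - z\<^sup>2" using le k2 by linarith
  ultimately have "\<bar>bessel_quot m n t\<bar> = \<bar>besselJ m t\<bar> / (t\<^sup>2 - z\<^sup>2)"
    by (simp add: bessel_quot_def z_def[symmetric])
  also have "\<dots> \<le> 1 / (norm (real_pair k))\<^sup>2"
    using le k2 by (intro frac_le abs_besselJ_le_1') auto
  finally have "sqrt pi / 2 * z * \<bar>bessel_quot m n t\<bar> \<le> sqrt pi / 2 * z * (1 / (norm (real_pair k))\<^sup>2)"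
    using z by (intro mult_left_mono) auto
  then show ?thesis unfolding norm_c_coeff[OF n] t_def z_def by simp
qed

text \<open>Only finitely many frequencies lie near the resonance. The squares of the others decay
  with order -4 and are dominated by the product weight \<open>w\<close>, whose sum over a box
  factorises into two one-dimensional sums of at most 5 each.\<close>

lemma sum_norm_c_coeff_bounded:
  assumes n: "n \<ge> 1"
  shows "\<exists>B. \<forall>K. (\<Sum>k\<in>freq_box K. (norm (c_coeff k m n))\<^sup>2) \<le> B"
proof -
  define z where "z = bessel_zero m n"
  have z: "z > 0" using bessel_zero_pos[OF n] by (simp add: z_def)
  define w where "w k = 1 / (1 + (real_of_int (fst k))\<^sup>2) * (1 / (1 + (real_of_int (snd k))\<^sup>2))" for k :: "int \<times> int"
  have w: "w k > 0" for k
    unfolding w_def by (intro mult_pos_pos divide_pos_pos add_pos_nonneg) auto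
  define S where "S = {k. pi * norm (real_pair k) < 2 * z}"
  have nk: "(norm (real_pair k))\<^sup>2 = (real_of_int (fst k))\<^sup>2 + (real_of_int (snd k))\<^sup>2" for k
    by (simp add: real_pair_def norm_Pair)
  have "S \<subseteq> freq_box (nat \<lceil>z\<rceil>)"
  proof
    fix k assume "k \<in> S"
    moreover have "2 * norm (real_pair k) \<le> pi * norm (real_pair k)"
      using pi_ge_two by (intro mult_right_mono) auto
    ultimately have k: "norm (real_pair k) < z" by (simp add: S_def)
    have "\<bar>real_of_int (fst k)\<bar> \<le> norm (real_pair k)" "\<bar>real_of_int (snd k)\<bar> \<le> norm (real_pair k)"
      by (simp_all add: real_pair_def norm_Pair)
    with k have "\<bar>real_of_int (fst k)\<bar> \<le> of_int \<lceil>z\<rceil>" "\<bar>real_of_int (snd k)\<bar> \<le> of_int \<lceil>z\<rceil>"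
      by linarith+
    then show "k \<in> freq_box (nat \<lceil>z\<rceil>)" using z by (cases k) auto
  qed
  then have S: "finite S" by (rule finite_subset) simp
  \<comment> \<open>The first summand serves the far frequencies, where
    \<open>(1 / s)^2 \<le> 4 * w k\<close>; the second is large enough for each of the finitely many
    exceptional ones.\<close>
  define C where "C = 4 * (sqrt pi / 2 * z)\<^sup>2 + (\<Sum>k\<in>S. (norm (c_coeff k m n))\<^sup>2 / w k)"
  have exc_nonneg: "(\<Sum>k\<in>S. (norm (c_coeff k m n))\<^sup>2 / w k) \<ge> 0"
    using w by (intro sum_nonneg divide_nonneg_pos) auto
  have c: "(norm (c_coeff k m n))\<^sup>2 \<le> C * w k" for k
  proof (cases "k \<in> S")
    case True
    have "(norm (c_coeff k m n))\<^sup>2 / w k \<le> (\<Sum>k\<in>S. (norm (c_coeff k m n))\<^sup>2 / w k)"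
      using w by (intro member_le_sum S True divide_nonneg_pos) auto
    also have "\<dots> \<le> C" by (simp add: C_def)
    finally show ?thesis using w[of k] by (simp add: pos_divide_le_eq)
  next
    case False
    define s where "s = (norm (real_pair k))\<^sup>2"
    have far: "pi * norm (real_pair k) \<ge> 2 * bessel_zero m n" using False by (simp add: S_def z_def)
    have "real_pair k \<noteq> 0" using far z by (auto simp: z_def)
    then have "fst k \<noteq> 0 \<or> snd k \<noteq> 0" by (auto simp: real_pair_def zero_prod_def)
    then have "(fst k)\<^sup>2 + (snd k)\<^sup>2 \<ge> 1"
      by (metis add_nonneg_eq_0_iff int_one_le_iff_zero_less order_le_less zero_le_power2 add_nonneg_nonneg zero_eq_power2)
    then have "real_of_int ((fst k)\<^sup>2 + (snd k)\<^sup>2) \<ge> 1" by (simp only: of_int_1_le_iff)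
    then have s: "s \<ge> 1" by (simp add: s_def nk)
    have "(1 + (real_of_int (fst k))\<^sup>2) * (1 + (real_of_int (snd k))\<^sup>2) \<le> (2 * s) * (2 * s)"
    proof (rule mult_mono)
      have "s = (real_of_int (fst k))\<^sup>2 + (real_of_int (snd k))\<^sup>2" by (simp add: s_def nk)
      moreover note s zero_le_power2[of "real_of_int (fst k)"] zero_le_power2[of "real_of_int (snd k)"]
      ultimately show "1 + (real_of_int (fst k))\<^sup>2 \<le> 2 * s" "1 + (real_of_int (snd k))\<^sup>2 \<le> 2 * s"
        by linarith+
    qed (use s in auto)
    then have "1 / ((2 * s) * (2 * s)) \<le> w k"
      unfolding w_def using s by (auto intro!: frac_le mult_pos_pos add_pos_nonneg)
    then have inv: "(1 / s)\<^sup>2 \<le> 4 * w k" by (simp add: power2_eq_square)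
    have "(norm (c_coeff k m n))\<^sup>2 \<le> (sqrt pi / 2 * z * (1 / s))\<^sup>2"
      using norm_c_coeff_decay[OF n far] by (intro power_mono) (auto simp: z_def s_def)
    also have "\<dots> = (sqrt pi / 2 * z)\<^sup>2 * (1 / s)\<^sup>2" by (rule power_mult_distrib)
    also have "\<dots> \<le> (sqrt pi / 2 * z)\<^sup>2 * (4 * w k)" using inv by (intro mult_left_mono) auto
    also have "\<dots> \<le> C * w k"
      using mult_nonneg_nonneg[OF exc_nonneg less_imp_le[OF w[of k]]] by (simp add: C_def distrib_right)
    finally show ?thesis .
  qed
  have "C \<ge> 0" unfolding C_def using exc_nonneg by (intro add_nonneg_nonneg) auto
  have "(\<Sum>k\<in>freq_box K. (norm (c_coeff k m n))\<^sup>2) \<le> C * 25" for K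
  proof -
    let ?s = "\<Sum>j\<in>{- int K..int K}. 1 / (1 + (real_of_int j)\<^sup>2)"
    have "?s \<le> 5" using sum_inverse_one_plus_square_le[of K] by (rule order_trans) simp
    moreover have "?s \<ge> 0" by (intro sum_nonneg) auto
    ultimately have s: "?s * ?s \<le> 5 * 5" by (intro mult_mono) auto
    have "(\<Sum>k\<in>freq_box K. (norm (c_coeff k m n))\<^sup>2) \<le> (\<Sum>k\<in>freq_box K. C * w k)"
      by (intro sum_mono c)
    also have "\<dots> = C * (?s * ?s)"
      unfolding w_def sum_distrib_left[symmetric]
        sum_Times_mult[where u = "\<lambda>a. 1 / (1 + (real_of_int a)\<^sup>2)" and v = "\<lambda>a. 1 / (1 + (real_of_int a)\<^sup>2)"] ..
    also have "\<dots> \<le> C * 25" using s \<open>C \<ge> 0\<close> by (intro mult_left_mono) auto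
    finally show ?thesis .
  qed
  then show ?thesis by blast
qed

section \<open>Discrete Fourier analysis on the sampling grid\<close>

definition grid_pt :: "nat \<Rightarrow> int \<times> int \<Rightarrow> real \<times> real" where
  "grid_pt L p = (2 * of_int (fst p) / real L, 2 * of_int (snd p) / real L)"

lemma char2_mult: "char2 k x * char2 k y = char2 k (x + y)"
  by (simp add: char2_def cis_mult algebra_simps)

lemma char2_shift: "char2 k (x + (2 * of_int a, 2 * of_int b)) = char2 k x"
proof -
  have "char2 k (2 * of_int a, 2 * of_int b) = cis (2 * pi * of_int (fst k * a + snd k * b))"
    by (simp add: char2_def algebra_simps)
  also have "\<dots> = 1" by (rule cis_multiple_2pi) simp
  finally show ?thesis by (simp flip: char2_mult)
qed

text \<open>The symmetric range is a complete residue system modulo the odd number \<open>L\<close>;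
  after shifting it by \<open>K\<close> the sum is geometric with an \<open>L\<close>-th root of
  unity as ratio.\<close>

lemma sum_cis_root:
  fixes K :: nat and j :: int
  defines "L \<equiv> 2 * K + 1"
  shows "(\<Sum>p\<in>{- int K..int K}. cis (2 * pi * of_int p * of_int j / L)) = (if int L dvd j then of_nat L else 0)"
proof (cases "int L dvd j")
  case True
  then obtain q where q: "j = int L * q" by auto
  have "cis (2 * pi * of_int p * of_int j / L) = 1" for p
  proof -
    have "2 * pi * of_int p * of_int j / L = 2 * pi * of_int (p * q)"
      by (simp add: q L_def field_simps)
    then show ?thesis using cis_multiple_2pi[of "of_int (p * q)"] by simp
  qed
  then show ?thesis using True by (simp add: L_def)
next
  case False
  define w where "w = cis (2 * pi * of_int j / L)"
  have L: "real L > 0" by (simp add: L_def)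
  have "w \<noteq> 1"
  proof
    assume "w = 1"
    then obtain n :: int where "2 * pi * of_int j / L = of_int (2 * n) * pi"
      unfolding w_def cis_conv_exp exp_eq_1 by auto
    then have "real_of_int j = real_of_int (n * int L)" using L by (simp add: field_simps)
    then have "j = n * int L" by (simp only: of_int_eq_iff)
    with False show False by simp
  qed
  have "(\<Sum>p\<in>{- int K..int K}. cis (2 * pi * of_int p * of_int j / L))
      = (\<Sum>i<L. cis (2 * pi * (real i - real K) * of_int j / L))"
    by (rule sum.reindex_bij_witness[of _ "\<lambda>i. int i - int K" "\<lambda>p. nat (p + int K)"])
       (auto simp: L_def)
  also have "\<dots> = (\<Sum>i<L. cis (- 2 * pi * real K * of_int j / L) * w ^ i)"
    unfolding w_def Complex.DeMoivre cis_mult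
    by (intro sum.cong arg_cong[where f = cis] refl) (use L in \<open>simp add: field_simps\<close>)
  also have "\<dots> = cis (- 2 * pi * real K * of_int j / L) * ((w ^ L - 1) / (w - 1))"
    by (simp only: sum_distrib_left[symmetric] geometric_sum[OF \<open>w \<noteq> 1\<close>])
  also have "w ^ L = 1"
  proof -
    have "w ^ L = cis (2 * pi * of_int j)"
      unfolding w_def Complex.DeMoivre using L by simp
    then show ?thesis using cis_multiple_2pi[of "of_int j"] by simp
  qed
  finally show ?thesis using False by simp
qed

lemma sum_char2_grid:
  fixes K :: nat and p :: "int \<times> int"
  defines "L \<equiv> 2 * K + 1"
  shows "(\<Sum>k\<in>freq_box K. char2 k (grid_pt L p)) = (if int L dvd fst p \<and> int L dvd snd p then of_nat L ^ 2 else 0)"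
proof -
  define C where "C q a = cis (2 * pi * of_int a * of_int q / real L)" for q a :: int
  have "char2 k (grid_pt L p) = C (fst p) (fst k) * C (snd p) (snd k)" for k
    unfolding char2_def grid_pt_def C_def cis_mult by (rule arg_cong[where f = cis]) (simp add: algebra_simps)
  then have "(\<Sum>k\<in>freq_box K. char2 k (grid_pt L p)) = (\<Sum>a\<in>{- int K..int K}. C (fst p) a) * (\<Sum>a\<in>{- int K..int K}. C (snd p) a)"
    by (simp only: sum_Times_mult[where u = "C (fst p)" and v = "C (snd p)"])
  moreover have "(\<Sum>a\<in>{- int K..int K}. C q a) = (if int L dvd q then of_nat L else 0)" for q
    unfolding C_def L_def by (rule sum_cis_root)
  ultimately show ?thesis by (simp add: power2_eq_square)
qed

lemma int_dvd_diff_iff_eq: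
  assumes "a \<in> {- int K..int K}" "b \<in> {- int K..int K}"
  shows "int (2 * K + 1) dvd a - b \<longleftrightarrow> a = b"
proof
  assume dvd: "int (2 * K + 1) dvd a - b"
  show "a = b"
  proof (rule ccontr)
    assume "a \<noteq> b"
    with dvd have "int (2 * K + 1) \<le> \<bar>a - b\<bar>" by (intro zdvd_imp_le) auto
    with assms show False by auto
  qed
qed simp

lemma discrete_parseval:
  fixes t :: "int \<times> int \<Rightarrow> complex" and K :: nat
  defines "L \<equiv> 2 * K + 1"
  shows "(\<Sum>p\<in>freq_box K. (norm (\<Sum>k\<in>freq_box K. t k * char2 k (grid_pt L p)))\<^sup>2)
     = (real L)\<^sup>2 * (\<Sum>k\<in>freq_box K. (norm (t k))\<^sup>2)"
proof -
  let ?B = "freq_box K"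
  \<comment> \<open>At grid points a character is symmetric in frequency and point, so orthogonality
    over the points reduces to \<open>sum_char2_grid\<close>, a sum over frequencies.\<close>
  have swap: "char2 k (grid_pt L p) * cnj (char2 l (grid_pt L p)) = char2 p (grid_pt L (k - l))" for k l p
    unfolding char2_def grid_pt_def cis_cnj cis_mult
    by (rule arg_cong[where f = cis]) (simp add: diff_divide_distrib algebra_simps)
  have orth: "(\<Sum>p\<in>?B. char2 p (grid_pt L (k - l))) = (if k = l then of_nat L ^ 2 else 0)"
    if "k \<in> ?B" "l \<in> ?B" for k l
    unfolding L_def sum_char2_grid using that int_dvd_diff_iff_eq[of "fst k" K "fst l"] int_dvd_diff_iff_eq[of "snd k" K "snd l"]
    by (auto simp: prod_eq_iff)
  have "complex_of_real (\<Sum>p\<in>?B. (norm (\<Sum>k\<in>?B. t k * char2 k (grid_pt L p)))\<^sup>2)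
      = (\<Sum>p\<in>?B. (\<Sum>k\<in>?B. t k * char2 k (grid_pt L p)) * cnj (\<Sum>k\<in>?B. t k * char2 k (grid_pt L p)))"
    by (simp only: of_real_sum complex_norm_square)
  also have "\<dots> = (\<Sum>p\<in>?B. \<Sum>k\<in>?B. \<Sum>l\<in>?B. t k * cnj (t l) * (char2 k (grid_pt L p) * cnj (char2 l (grid_pt L p))))"
    by (simp add: sum_product mult_ac)
  also have "\<dots> = (\<Sum>k\<in>?B. \<Sum>p\<in>?B. \<Sum>l\<in>?B. t k * cnj (t l) * char2 p (grid_pt L (k - l)))"
    unfolding swap by (rule sum.swap)
  also have "\<dots> = (\<Sum>k\<in>?B. \<Sum>l\<in>?B. t k * cnj (t l) * (\<Sum>p\<in>?B. char2 p (grid_pt L (k - l))))"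
    unfolding sum_distrib_left by (intro sum.cong refl sum.swap)
  also have "\<dots> = (\<Sum>k\<in>?B. \<Sum>l\<in>?B. if k = l then t k * cnj (t k) * of_nat L ^ 2 else 0)"
    by (intro sum.cong refl) (simp add: orth)
  also have "\<dots> = (\<Sum>k\<in>?B. t k * cnj (t k) * of_nat L ^ 2)"
    by simp
  also have "\<dots> = of_real ((real L)\<^sup>2) * (\<Sum>k\<in>?B. t k * cnj (t k))"
    by (simp add: sum_distrib_left mult_ac)
  also have "\<dots> = complex_of_real ((real L)\<^sup>2 * (\<Sum>k\<in>?B. (norm (t k))\<^sup>2))"
    by (simp only: of_real_mult of_real_sum complex_norm_square)
  finally show ?thesis by (simp only: of_real_eq_iff)
qed

text \<open>These points lie on the lattice of the \<open>grid_pt\<close> shifted by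
  \<open>- 1\<close>, and for odd \<open>L\<close> they are not on that lattice. A sum of two of
  them is on it up to the period 2, which is why the convolution of samples is evaluated at
  \<open>grid_pt\<close>.\<close>

definition sample_pt :: "nat \<Rightarrow> nat \<times> nat \<Rightarrow> real \<times> real" where
  "sample_pt L a = (grid L (fst a), grid L (snd a))"

lemma finite_FT_eq:
  "finite_FT f k L = (2 / of_nat L)\<^sup>2 * (\<Sum>a\<in>{1..L} \<times> {1..L}. f (sample_pt L a) * char2 k (- sample_pt L a))"
proof -
  have "exp (- (of_real pi * \<i> * of_real (of_int (fst k) * grid L i + of_int (snd k) * grid L j))) = char2 k (- sample_pt L (i, j))" for i j
    by (simp add: char2_def sample_pt_def cis_conv_exp algebra_simps)
  then show ?thesis
    unfolding finite_FT_def by (simp add: sum.cartesian_product sample_pt_def case_prod_unfold)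
qed

text \<open>Shifting a difference of sample points by a period leads outside \<open>(- 1/2, 1/2)\<close>, so that no
  wrap-around occurs in the discrete convolution.\<close>

lemma grid_no_wrap:
  assumes L: "L > 0" and i': "i' \<in> {1..L}" and i: "\<bar>grid L i\<bar> < 1 / 2"
    and p: "\<bar>2 * of_int p / real L\<bar> \<le> 1"
    and dvd: "int L dvd p + 2 - int i - int i'"
  shows "grid L i' = 2 * of_int p / real L - grid L i \<or>
    (\<bar>grid L i'\<bar> \<ge> 1 / 2 \<and> \<bar>2 * of_int p / real L - grid L i\<bar> \<ge> 1 / 2)"
proof -
  define u where "u = 2 * of_int p / real L - grid L i"
  obtain q where q: "p + 2 - int i - int i' = int L * q" using dvd by auto
  have diff: "u - grid L i' = 2 + 2 * of_int q"
  proof -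
    have "u - grid L i' = 2 + 2 * of_int (p + 2 - int i - int i') / real L"
      using L by (simp add: u_def grid_def field_simps)
    then show ?thesis using L by (simp add: q)
  qed
  show ?thesis
  proof (cases "q = - 1")
    case True
    then show ?thesis using diff by (simp add: u_def)
  next
    case False
    then have "\<bar>1 + q\<bar> \<ge> 1" by linarith
    then have "\<bar>1 + real_of_int q\<bar> \<ge> 1" by linarith
    then have "\<bar>u - grid L i'\<bar> \<ge> 2" unfolding diff by linarith
    moreover have "\<bar>u\<bar> < 3 / 2" using p i unfolding u_def by linarith
    moreover have "\<bar>grid L i'\<bar> \<le> 1"
    proof -
      have "0 \<le> real i' - 1" "real i' - 1 \<le> real L" using i' by auto
      then have "0 \<le> (real i' - 1) / real L" "(real i' - 1) / real L \<le> 1" using L by auto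
      moreover have "grid L i' = - 1 + 2 * ((real i' - 1) / real L)" by (simp add: grid_def)
      ultimately show ?thesis unfolding abs_le_iff by linarith
    qed
    ultimately show ?thesis unfolding u_def[symmetric] by linarith
  qed
qed

text \<open>After multiplying out, the sum over frequencies selects the pairs of samples whose sum
  is \<open>grid_pt L p\<close> modulo the period. This circular convolution is the ordinary one by
  \<open>grid_no_wrap\<close>. The factor is
  \<open>(2 / L) ^ 4 / 4 * L^2 = (2 / L)^2\<close>.\<close>

lemma discrete_convolution:
  fixes K :: nat
  defines "L \<equiv> 2 * K + 1"
  assumes f: "\<And>x. norm x \<ge> 1 / 2 \<Longrightarrow> f x = 0" and g: "\<And>x. norm x \<ge> 1 / 2 \<Longrightarrow> g x = 0"
    and p: "p \<in> freq_box K"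
  shows "(\<Sum>k\<in>freq_box K. finite_FT f k L * finite_FT g k L / 4 * char2 k (grid_pt L p))
    = (2 / of_nat L)\<^sup>2 * (\<Sum>a\<in>{1..L} \<times> {1..L}. f (sample_pt L a) * g (grid_pt L p - sample_pt L a))"
proof -
  let ?I = "{1..L} \<times> {1..L}"
  have L: "L > 0" by (simp add: L_def)
  \<comment> \<open>The \<open>2\<close> collects the two offsets in \<open>i - 1\<close> from
    \<open>grid\<close>; the two summands \<open>- 1\<close> of \<open>grid\<close> add up to a full
    period, removed by \<open>char2_shift\<close>.\<close>
  define r where "r a b = (fst p + 2 - int (fst a) - int (fst b), snd p + 2 - int (snd a) - int (snd b))" for a b :: "nat \<times> nat"
  define hit where "hit a b \<longleftrightarrow> int L dvd fst (r a b) \<and> int L dvd snd (r a b)" for a b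
  have shift: "char2 k (- sample_pt L a) * char2 k (- sample_pt L b) * char2 k (grid_pt L p) = char2 k (grid_pt L (r a b))" for k a b
  proof -
    have "- sample_pt L a + - sample_pt L b + grid_pt L p = grid_pt L (r a b) + (2 * of_int 1, 2 * of_int 1)"
      using L by (simp add: sample_pt_def grid_pt_def grid_def r_def prod_eq_iff field_simps)
    then show ?thesis unfolding char2_mult by (simp only: char2_shift)
  qed
  have inner: "f (sample_pt L a) * (\<Sum>b\<in>?I. g (sample_pt L b) * (if hit a b then 1 else 0)) = f (sample_pt L a) * g (grid_pt L p - sample_pt L a)"
    if a: "a \<in> ?I" for a
  proof (cases "f (sample_pt L a) = 0")
    case False
    then have na: "norm (sample_pt L a) < 1 / 2" using f[of "sample_pt L a"] by force
    have i: "\<bar>grid L (fst a)\<bar> < 1 / 2" "\<bar>grid L (snd a)\<bar> < 1 / 2"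
      using na norm_fst_le[of "grid L (fst a)" "grid L (snd a)"] norm_snd_le[of "grid L (snd a)" "grid L (fst a)"]
      unfolding sample_pt_def real_norm_def by linarith+
    \<comment> \<open>The only index in its residue class; \<open>Suc\<close> because indices run
      from \<open>1\<close> to \<open>L\<close> and not from \<open>0\<close>.\<close>
    define nb where "nb q i = Suc (nat ((q + 1 - int i) mod int L))" for q :: int and i :: nat
    have nb: "nb q i \<in> {1..L}" "int L dvd q + 2 - int i - int (nb q i)" for q i
    proof -
      have "0 \<le> (q + 1 - int i) mod int L" "(q + 1 - int i) mod int L < int L" using L by auto
      then show "nb q i \<in> {1..L}" by (auto simp: nb_def)
      have "int (nb q i) = 1 + (q + 1 - int i) mod int L" using L by (simp add: nb_def)
      then have e: "q + 2 - int i - int (nb q i) = (q + 1 - int i) - (q + 1 - int i) mod int L" by simp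
      show "int L dvd q + 2 - int i - int (nb q i)" unfolding e by (rule dvd_minus_mod)
    qed
    have nb_unique: "j = nb q i" if "j \<in> {1..L}" "int L dvd q + 2 - int i - int j" for q i j
    proof -
      have "int L dvd (q + 2 - int i - int j) - (q + 2 - int i - int (nb q i))"
        by (intro dvd_diff that nb)
      then have "int L dvd int (nb q i) - int j" by (simp add: algebra_simps)
      moreover have "\<bar>int (nb q i) - int j\<bar> < int L" using that(1) nb(1)[of q i] by auto
      ultimately show ?thesis using dvd_imp_le_int[of "int (nb q i) - int j" "int L"] by force
    qed
    define b0 where "b0 = (nb (fst p) (fst a), nb (snd p) (snd a))"
    have hit: "hit a b \<longleftrightarrow> b = b0" if "b \<in> ?I" for b
    proof
      assume "hit a b"
      then have "int L dvd fst p + 2 - int (fst a) - int (fst b)" "int L dvd snd p + 2 - int (snd a) - int (snd b)"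
        by (simp_all add: hit_def r_def)
      with that have "fst b = nb (fst p) (fst a)" "snd b = nb (snd p) (snd a)"
        by (auto intro: nb_unique simp: mem_Times_iff)
      then show "b = b0" by (simp add: b0_def prod_eq_iff)
    next
      assume "b = b0"
      then show "hit a b" unfolding hit_def r_def b0_def using nb(2) by simp
    qed
    have b0: "b0 \<in> ?I" using nb by (simp add: b0_def)
    have "(\<Sum>b\<in>?I. g (sample_pt L b) * (if hit a b then 1 else 0)) = (\<Sum>b\<in>?I. if b = b0 then g (sample_pt L b) else 0)"
      by (intro sum.cong refl) (simp add: hit)
    also have "\<dots> = g (sample_pt L b0)" using b0 by simp
    \<comment> \<open>Either the selected sample is the difference itself, or in some coordinate
      both points have absolute value at least \<open>1 / 2\<close>, and then \<open>g\<close>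
      vanishes at both.\<close>
    also have "\<dots> = g (grid_pt L p - sample_pt L a)"
    proof -
      have pl: "\<bar>2 * real_of_int (fst p) / real L\<bar> \<le> 1" "\<bar>2 * real_of_int (snd p) / real L\<bar> \<le> 1"
        using p by (auto simp: L_def mem_Times_iff abs_le_iff divide_simps)
      have big: "g x = 0" if "\<bar>fst x\<bar> \<ge> 1 / 2 \<or> \<bar>snd x\<bar> \<ge> 1 / 2" for x
        using that norm_fst_le[of "fst x" "snd x"] norm_snd_le[of "snd x" "fst x"] by (intro g) auto
      have hit0: "int L dvd fst p + 2 - int (fst a) - int (fst b0)" "int L dvd snd p + 2 - int (snd a) - int (snd b0)"
        using nb by (simp_all add: b0_def)
      have m: "fst b0 \<in> {1..L}" "snd b0 \<in> {1..L}" using b0 by auto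
      show ?thesis
        using grid_no_wrap[OF L m(1) i(1) pl(1) hit0(1)] grid_no_wrap[OF L m(2) i(2) pl(2) hit0(2)]
          big[of "sample_pt L b0"] big[of "grid_pt L p - sample_pt L a"]
        by (auto simp: sample_pt_def grid_pt_def)
    qed
    finally show ?thesis by simp
  qed simp
  have "(\<Sum>k\<in>freq_box K. finite_FT f k L * finite_FT g k L / 4 * char2 k (grid_pt L p))
     = (\<Sum>k\<in>freq_box K. \<Sum>a\<in>?I. \<Sum>b\<in>?I. (2 / of_nat L) ^ 4 / 4 * (f (sample_pt L a) * g (sample_pt L b)) * char2 k (grid_pt L (r a b)))"
  proof (intro sum.cong refl)
    fix k
    define c where "c = (2 / of_nat L :: complex)"
    define u v where "u a = f (sample_pt L a) * char2 k (- sample_pt L a)"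
      and "v a = g (sample_pt L a) * char2 k (- sample_pt L a)" for a
    have "finite_FT f k L * finite_FT g k L / 4 * char2 k (grid_pt L p) = c ^ 4 / 4 * ((\<Sum>a\<in>?I. u a) * (\<Sum>b\<in>?I. v b)) * char2 k (grid_pt L p)"
      by (simp add: finite_FT_eq c_def u_def v_def power2_eq_square power4_eq_xxxx)
    moreover have "\<dots> = (\<Sum>a\<in>?I. \<Sum>b\<in>?I. c ^ 4 / 4 * (u a * v b) * char2 k (grid_pt L p))"
      by (subst sum_product) (simp only: sum_distrib_left sum_distrib_right)
    moreover have "c ^ 4 / 4 * (u a * v b) * char2 k (grid_pt L p) = c ^ 4 / 4 * (f (sample_pt L a) * g (sample_pt L b)) * char2 k (grid_pt L (r a b))" for a b
      unfolding shift[symmetric] u_def v_def by (simp only: mult_ac)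
    ultimately show "finite_FT f k L * finite_FT g k L / 4 * char2 k (grid_pt L p) = (\<Sum>a\<in>?I. \<Sum>b\<in>?I. (2 / of_nat L) ^ 4 / 4 * (f (sample_pt L a) * g (sample_pt L b)) * char2 k (grid_pt L (r a b)))"
      unfolding c_def by (simp only:)
  qed
  also have "\<dots> = (\<Sum>a\<in>?I. \<Sum>k\<in>freq_box K. \<Sum>b\<in>?I. (2 / of_nat L) ^ 4 / 4 * (f (sample_pt L a) * g (sample_pt L b)) * char2 k (grid_pt L (r a b)))"
    by (rule sum.swap)
  also have "\<dots> = (\<Sum>a\<in>?I. \<Sum>b\<in>?I. (2 / of_nat L) ^ 4 / 4 * (f (sample_pt L a) * g (sample_pt L b)) * (\<Sum>k\<in>freq_box K. char2 k (grid_pt L (r a b))))"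
    unfolding sum_distrib_left by (intro sum.cong refl sum.swap)
  also have "\<dots> = (\<Sum>a\<in>?I. \<Sum>b\<in>?I. (2 / of_nat L)\<^sup>2 * (f (sample_pt L a) * (g (sample_pt L b) * (if hit a b then 1 else 0))))"
    unfolding L_def sum_char2_grid unfolding L_def[symmetric] hit_def
    by (intro sum.cong refl) (use L in \<open>simp add: power2_eq_square power4_eq_xxxx field_simps\<close>)
  also have "\<dots> = (2 / of_nat L)\<^sup>2 * (\<Sum>a\<in>?I. f (sample_pt L a) * (\<Sum>b\<in>?I. g (sample_pt L b) * (if hit a b then 1 else 0)))"
    by (simp only: sum_distrib_left)
  also have "\<dots> = (2 / of_nat L)\<^sup>2 * (\<Sum>a\<in>?I. f (sample_pt L a) * g (grid_pt L p - sample_pt L a))"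
    by (intro arg_cong2[where f = "(*)"] sum.cong refl inner)
  finally show ?thesis .
qed

section \<open>Fejer means\<close>

definition fejer :: "nat \<Rightarrow> real \<Rightarrow> real" where
  "fejer n s = (norm (\<Sum>j\<le>n. cis (pi * real j * s)))\<^sup>2 / (real n + 1)"

text \<open>The usual \<open>1 - \<bar>j\<bar> / (n + 1)\<close> inside the range and
  \<open>0\<close> outside, left as the number of pairs in which it arises when the square in
  \<open>fejer\<close> is expanded.\<close>

definition fejer_coeff :: "nat \<Rightarrow> int \<Rightarrow> real" where
  "fejer_coeff n j = (\<Sum>(a, b)\<in>{..n} \<times> {..n}. if int a - int b = j then 1 else 0) / (real n + 1)"

lemma fejer_nonneg: "fejer n s \<ge> 0"
  by (simp add: fejer_def)

lemma continuous_fejer [continuous_intros]: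
  "continuous_on S f \<Longrightarrow> continuous_on S (\<lambda>x. fejer n (f x))"
  unfolding fejer_def divide_inverse by (intro continuous_intros)

lemma fejer_minus: "fejer n (- s) = fejer n s"
proof -
  have "(\<Sum>j\<le>n. cis (pi * real j * - s)) = cnj (\<Sum>j\<le>n. cis (pi * real j * s))"
    by (simp add: cis_cnj)
  then show ?thesis unfolding fejer_def by (simp only: complex_mod_cnj)
qed

lemma fejer_plus_2: "fejer n (s + 2) = fejer n s"
proof -
  have "cis (pi * real j * (s + 2)) = cis (pi * real j * s)" for j
  proof -
    have "cis (pi * real j * (s + 2)) = cis (pi * real j * s) * cis (2 * pi * real j)"
      unfolding cis_mult by (rule arg_cong[where f = cis]) (simp add: algebra_simps)
    also have "cis (2 * pi * real j) = 1" by (rule cis_multiple_2pi) simp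
    finally show ?thesis by simp
  qed
  then show ?thesis by (simp add: fejer_def)
qed

lemma fejer_expand:
  "complex_of_real (fejer n s) = (\<Sum>j\<in>{- int n..int n}. of_real (fejer_coeff n j) * cis (pi * of_int j * s))"
proof -
  let ?I = "{..n} \<times> {..n}"
  have "complex_of_real (fejer n s) = (\<Sum>a\<le>n. cis (pi * real a * s)) * cnj (\<Sum>b\<le>n. cis (pi * real b * s)) / (of_nat n + 1)"
    unfolding fejer_def of_real_divide complex_norm_square by simp
  also have "(\<Sum>a\<le>n. cis (pi * real a * s)) * cnj (\<Sum>b\<le>n. cis (pi * real b * s))
      = (\<Sum>a\<le>n. \<Sum>b\<le>n. cis (pi * of_int (int a - int b) * s))"
    by (simp add: sum_product cis_cnj cis_mult algebra_simps)
  also have "\<dots> = (\<Sum>c\<in>?I. cis (pi * of_int (int (fst c) - int (snd c)) * s))"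
    by (simp add: sum.cartesian_product case_prod_unfold)
  also have "\<dots> = (\<Sum>c\<in>?I. \<Sum>j\<in>{- int n..int n}. (if int (fst c) - int (snd c) = j then 1 else 0) * cis (pi * of_int j * s))"
    by (intro sum.cong refl) (auto simp: if_distrib[where f = "\<lambda>x. x * _"] cong: if_cong)
  also have "\<dots> = (\<Sum>j\<in>{- int n..int n}. (\<Sum>c\<in>?I. if int (fst c) - int (snd c) = j then 1 else 0) * cis (pi * of_int j * s))"
    unfolding sum_distrib_right by (rule sum.swap)
  moreover have "(\<Sum>c\<in>?I. if int (fst c) - int (snd c) = j then 1 else (0 :: complex)) = of_real (fejer_coeff n j * (real n + 1))" for j
  proof -
    have "fejer_coeff n j * (real n + 1) = (\<Sum>c\<in>?I. if int (fst c) - int (snd c) = j then 1 else 0)"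
      by (simp add: fejer_coeff_def case_prod_unfold add_nonneg_eq_0_iff)
    then show ?thesis by (simp add: if_distrib[where f = of_real] cong: if_cong)
  qed
  ultimately have "complex_of_real (fejer n s) = (\<Sum>j\<in>{- int n..int n}. of_real (fejer_coeff n j * (real n + 1)) * cis (pi * of_int j * s)) / (of_nat n + 1)"
    by (simp only:)
  also have "\<dots> = (\<Sum>j\<in>{- int n..int n}. of_real (fejer_coeff n j) * cis (pi * of_int j * s) * (of_nat n + 1)) / (of_nat n + 1)"
    by (simp add: mult_ac)
  also have "\<dots> = (\<Sum>j\<in>{- int n..int n}. of_real (fejer_coeff n j) * cis (pi * of_int j * s))"
    unfolding sum_distrib_right[symmetric]
    by (rule nonzero_mult_div_cancel_right) (metis of_nat_Suc of_nat_eq_0_iff add.commute nat.distinct(1))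
  finally show ?thesis .
qed

lemma integral_cis_pi:
  "((\<lambda>u. cis (pi * of_int j * (y - u))) has_integral (if j = 0 then 2 else 0)) {- 1..1}"
proof (cases "j = 0")
  case True
  then show ?thesis using has_integral_const_real[of "1 :: complex" "- 1" 1] by (simp add: scaleR_conv_of_real)
next
  case False
  define F where "F u = cis (pi * of_int j * (y - u)) / (- \<i> * pi * of_int j)" for u :: real
  have "(F has_vector_derivative cis (pi * of_int j * (y - u))) (at u within {- 1..1})" for u
  proof -
    have "((\<lambda>z. exp (\<i> * pi * of_int j * (of_real y - z)) / (- \<i> * pi * of_int j)) has_field_derivative exp (\<i> * pi * of_int j * (of_real y - of_real u))) (at (of_real u))"
      using False by (auto intro!: derivative_eq_intros)
    from has_vector_derivative_real_field[OF this, of "{- 1..1}"]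
    show ?thesis unfolding F_def cis_conv_exp by (simp add: mult_ac)
  qed
  then have "((\<lambda>u. cis (pi * of_int j * (y - u))) has_integral F 1 - F (- 1)) {- 1..1}"
    by (intro fundamental_theorem_of_calculus) auto
  moreover have "F (- 1) = F 1"
  proof -
    have "cis (pi * of_int j * (y - (- 1))) = cis (pi * of_int j * (y - 1)) * cis (2 * pi * of_int j)"
      unfolding cis_mult by (rule arg_cong[where f = cis]) (simp add: algebra_simps)
    also have "cis (2 * pi * of_int j) = 1" by (rule cis_multiple_2pi) simp
    finally show ?thesis by (simp add: F_def)
  qed
  ultimately show ?thesis using False by simp
qed

lemma integral_fejer: "integral {- 1..1} (\<lambda>u. fejer n (y - u)) = 2"
proof -
  have "fejer_coeff n 0 = 1"
  proof -
    have "(\<Sum>(a, b)\<in>{..n} \<times> {..n}. if int a - int b = 0 then 1 else (0 :: real)) = (\<Sum>a\<le>n. \<Sum>b\<le>n. if a = b then 1 else 0)"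
      unfolding sum.cartesian_product by (intro sum.cong) auto
    also have "\<dots> = real n + 1" by simp
    finally show ?thesis by (simp add: fejer_coeff_def)
  qed
  have "((\<lambda>u. complex_of_real (fejer n (y - u))) has_integral
      (\<Sum>j\<in>{- int n..int n}. of_real (fejer_coeff n j) * (if j = 0 then 2 else 0))) {- 1..1}"
    unfolding fejer_expand by (intro has_integral_sum has_integral_mult_right integral_cis_pi) auto
  also have "(\<Sum>j\<in>{- int n..int n}. complex_of_real (fejer_coeff n j) * (if j = 0 then 2 else 0)) = of_real 2"
    using \<open>fejer_coeff n 0 = 1\<close> by (simp add: if_distrib[where f = "\<lambda>x. _ * x"] cong: if_cong)
  finally have "((\<lambda>u. fejer n (y - u)) has_integral 2) {- 1..1}"
    using has_integral_linear[OF _ bounded_linear_Re, of "\<lambda>u. complex_of_real (fejer n (y - u))"] by (force simp: o_def)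
  then show ?thesis by (rule integral_unique)
qed

text \<open>With \<open>t = x / 2\<close>, the inequality \<open>t * cos t \<le> sin t\<close> gives
  \<open>sin x = 2 * sin t * cos t \<ge> t * (1 + cos x) \<ge> t\<close>. This is cruder than
  Jordan's inequality but enough for the decay of the kernel.\<close>

lemma sin_ge_half:
  assumes "0 \<le> x" "x \<le> pi / 2"
  shows "sin x \<ge> x / 2"
proof -
  define t where "t = x / 2"
  have t: "0 \<le> t" "t \<le> pi / 4" using assms by (auto simp: t_def)
  have "(\<lambda>s. sin s - s * cos s) 0 \<le> (\<lambda>s. sin s - s * cos s) t"
  proof (rule DERIV_nonneg_imp_nondecreasing[OF t(1)])
    fix s assume s: "0 \<le> s" "s \<le> t"
    have "((\<lambda>s. sin s - s * cos s) has_real_derivative s * sin s) (at s)"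
      by (auto intro!: derivative_eq_intros)
    moreover have "s * sin s \<ge> 0" using s t by (intro mult_nonneg_nonneg sin_ge_zero) auto
    ultimately show "\<exists>y. ((\<lambda>s. sin s - s * cos s) has_real_derivative y) (at s) \<and> 0 \<le> y" by blast
  qed
  then have "t * cos t \<le> sin t" by simp
  moreover have "cos t \<ge> 0" using t by (intro cos_ge_zero) auto
  ultimately have "t * cos t * cos t \<le> sin t * cos t"
    by (rule mult_right_mono)
  then have le: "2 * (t * cos t * cos t) \<le> 2 * sin t * cos t" by simp
  have "2 * (cos t * cos t) = 1 + cos x"
    using cos_double_cos[of t] by (simp add: t_def power2_eq_square)
  then have "2 * (t * cos t * cos t) = t * (1 + cos x)" by (metis mult.assoc mult.left_commute)
  moreover have "t \<le> t * (1 + cos x)"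
    using t(1) cos_ge_zero[of x] assms by (simp add: mult_left_mono algebra_simps)
  moreover have "2 * sin t * cos t = sin x" using sin_double[of t] by (simp add: t_def)
  ultimately have "t \<le> sin x" using le by linarith
  then show ?thesis by (simp add: t_def)
qed

text \<open>In the closed form of the geometric sum the numerator is at most 2 and the denominator
  at least \<open>\<bar>s\<bar>\<close>; the constant 4 is the square of that 2.\<close>

lemma fejer_decay:
  assumes "s \<in> {- 1..1}"
  shows "fejer n s * s\<^sup>2 \<le> 4 / (real n + 1)"
proof (cases "s = 0")
  case False
  define w where "w = cis (pi * s)"
  have w1: "norm (w - 1) \<ge> \<bar>s\<bar>"
  proof -
    have "norm (w - 1) = 2 * \<bar>sin (pi * s / 2)\<bar>"
      unfolding w_def cis_conv_exp by (rule dist_exp_i_1)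
    also have "\<bar>sin (pi * s / 2)\<bar> = sin (pi * \<bar>s\<bar> / 2)"
    proof -
      have "sin (pi * \<bar>s\<bar> / 2) \<ge> 0" using assms by (intro sin_ge_zero) (auto simp: mult_left_le)
      then show ?thesis by (auto simp: abs_if)
    qed
    finally have "norm (w - 1) = 2 * sin (pi * \<bar>s\<bar> / 2)" .
    moreover have "pi * \<bar>s\<bar> \<le> pi * 1" using assms by (intro mult_left_mono) auto
    then have "sin (pi * \<bar>s\<bar> / 2) \<ge> pi * \<bar>s\<bar> / 2 / 2" by (intro sin_ge_half) auto
    moreover have "2 * \<bar>s\<bar> \<le> pi * \<bar>s\<bar>" using pi_ge_two by (intro mult_right_mono) auto
    ultimately show ?thesis by linarith
  qed
  then have "w \<noteq> 1" using False by auto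
  have "(\<Sum>j\<le>n. cis (pi * real j * s)) = (\<Sum>j<Suc n. w ^ j)"
    unfolding w_def Complex.DeMoivre lessThan_Suc_atMost by (simp add: mult_ac)
  also have "\<dots> = (w ^ Suc n - 1) / (w - 1)" by (rule geometric_sum[OF \<open>w \<noteq> 1\<close>])
  finally have "norm (\<Sum>j\<le>n. cis (pi * real j * s)) * norm (w - 1) = norm (w ^ Suc n - 1)"
    using \<open>w \<noteq> 1\<close> by (simp add: norm_divide)
  also have "\<dots> \<le> norm (w ^ Suc n) + norm (1 :: complex)" by (rule norm_triangle_ineq4)
  also have "\<dots> = 2" by (simp add: w_def norm_mult norm_power)
  finally have "norm (\<Sum>j\<le>n. cis (pi * real j * s)) * norm (w - 1) \<le> 2" .
  moreover have "norm (\<Sum>j\<le>n. cis (pi * real j * s)) * \<bar>s\<bar> \<le> norm (\<Sum>j\<le>n. cis (pi * real j * s)) * norm (w - 1)"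
    using w1 by (intro mult_left_mono) auto
  ultimately have "norm (\<Sum>j\<le>n. cis (pi * real j * s)) * \<bar>s\<bar> \<le> 2" by simp
  then have "(norm (\<Sum>j\<le>n. cis (pi * real j * s)) * \<bar>s\<bar>)\<^sup>2 \<le> 2\<^sup>2" by (intro power_mono) auto
  then show ?thesis unfolding fejer_def by (simp add: power_mult_distrib divide_right_mono)
qed simp

text \<open>The kernel is even, so only second differences enter, and \<open>s\<^sup>2\<close> times the kernel is \<open>O(1 / n)\<close>.
  The auxiliary function \<open>\<Phi>\<close> is the periodisation of \<open>\<phi>\<close> near \<open>[-1, 1]\<close>.\<close>

lemma fejer_mean_error:
  fixes \<phi> :: "real \<Rightarrow> complex"
  assumes cont: "continuous_on UNIV \<phi>" and zero: "\<And>u. \<bar>u\<bar> \<ge> 1 \<Longrightarrow> \<phi> u = 0"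
    and diff2: "\<And>u s. norm (\<phi> (u + s) + \<phi> (u - s) - 2 * \<phi> u) \<le> A * s\<^sup>2"
    and x: "x \<in> {- 1..1}"
  shows "norm (integral {- 1..1} (\<lambda>u. \<phi> u * fejer n (x - u)) / 2 - \<phi> x) \<le> 6 * A / (real n + 1)"
proof -
  define \<Phi> where "\<Phi> u = \<phi> (u - 2) + \<phi> u + \<phi> (u + 2)" for u
  have c\<phi>: "continuous_on S (\<lambda>u. \<phi> (f u))" if "continuous_on S f" for S and f :: "real \<Rightarrow> real"
    by (rule continuous_on_compose2[OF cont that]) auto
  have c\<Phi>: "continuous_on S (\<lambda>u. \<Phi> (f u))" if "continuous_on S f" for S and f :: "real \<Rightarrow> real"
    unfolding \<Phi>_def by (intro continuous_intros c\<phi> that)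
  define k where "k v = \<phi> v * fejer n (x - v)" for v
  have ck: "continuous_on S k" for S
    unfolding k_def by (intro continuous_intros c\<phi>)
  have ik: "k integrable_on {a..b}" for a b
    by (intro integrable_continuous_real ck)
  \<comment> \<open>By periodicity of the kernel each translate of \<open>\<phi>\<close> contributes
    the integral of \<open>k\<close> over its own window of length 2. The three windows tile
    \<open>[x - 3, x + 3]\<close>, which contains \<open>[-1, 1]\<close>, and \<open>k\<close>
    vanishes off the latter.\<close>
  have shift: "integral {- 1..1} (\<lambda>s. \<phi> (x + s + c) * fejer n s) = integral {x - 1 + c..x + 1 + c} k"
    if "c \<in> {- 2, 0, 2}" for c
  proof -
    have "fejer n (- s - c) = fejer n s" for s
      using that fejer_minus[of n "s + c"] fejer_plus_2[of n s] fejer_plus_2[of n "s - 2"] fejer_minus[of n s] by auto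
    then have "(\<lambda>s. k (s + (x + c))) = (\<lambda>s. \<phi> (x + s + c) * fejer n s)"
      by (simp add: k_def algebra_simps)
    then show ?thesis
      using integral_shift_real_ivl[of "x - 1 + c" "x + c" "x + 1 + c" k] by simp
  qed
  have "integral {- 1..1} (\<lambda>s. \<Phi> (x + s) * fejer n s)
      = integral {- 1..1} (\<lambda>s. \<phi> (x + s + - 2) * fejer n s) + integral {- 1..1} (\<lambda>s. \<phi> (x + s + 0) * fejer n s)
        + integral {- 1..1} (\<lambda>s. \<phi> (x + s + 2) * fejer n s)"
  proof -
    have "(\<lambda>s. \<phi> (x + s + c) * fejer n s) integrable_on {- 1..1}" for c
      by (intro integrable_continuous_real continuous_intros c\<phi>)
    from integral_add[OF integrable_add[OF this[of "- 2"] this[of 0]] this[of 2]] integral_add[OF this[of "- 2"] this[of 0]]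
    show ?thesis by (simp add: \<Phi>_def distrib_right)
  qed
  also have "\<dots> = integral {x - 3..x - 1} k + integral {x - 1..x + 1} k + integral {x + 1..x + 3} k"
    using shift[of "- 2"] shift[of 0] shift[of 2] by (simp add: algebra_simps)
  also have "\<dots> = integral {x - 3..x + 3} k"
    using Henstock_Kurzweil_Integration.integral_combine[of "x - 3" "x - 1" "x + 1" k, OF _ _ ik]
      Henstock_Kurzweil_Integration.integral_combine[of "x - 3" "x + 1" "x + 3" k, OF _ _ ik] by simp
  also have "\<dots> = integral {x - 3..- 1} k + integral {- 1..1} k + integral {1..x + 3} k"
    using Henstock_Kurzweil_Integration.integral_combine[of "x - 3" "- 1" "1" k, OF _ _ ik]
      Henstock_Kurzweil_Integration.integral_combine[of "x - 3" "1" "x + 3" k, OF _ _ ik] x by simp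
  also have "integral {x - 3..- 1} k = integral {x - 3..- 1} (\<lambda>_. 0)"
    by (rule integral_cong) (simp add: k_def zero)
  also have "integral {1..x + 3} k = integral {1..x + 3} (\<lambda>_. 0)"
    by (rule integral_cong) (simp add: k_def zero)
  finally have plus: "integral {- 1..1} (\<lambda>s. \<Phi> (x + s) * fejer n s) = integral {- 1..1} k" by simp
  have minus: "integral {- 1..1} (\<lambda>s. \<Phi> (x - s) * fejer n s) = integral {- 1..1} k"
    using Henstock_Kurzweil_Integration.integral_reflect_real[of 1 "- 1" "\<lambda>s. \<Phi> (x + s) * fejer n s"] plus
    by (simp add: fejer_minus)
  have const: "integral {- 1..1} (\<lambda>s. 2 * \<Phi> x * fejer n s) = 4 * \<Phi> x"
  proof -
    have "integral {- 1..1} (\<lambda>s. fejer n s) = 2"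
      using integral_fejer[of n 0] by (simp add: fejer_minus)
    moreover have "(\<lambda>s. fejer n s) integrable_on {- 1..1}"
      by (intro integrable_continuous_real continuous_intros)
    ultimately have "((\<lambda>s. fejer n s) has_integral 2) {- 1..1}"
      by (metis integrable_integral)
    from integral_unique[OF has_integral_mult_right[OF has_integral_of_real[OF this], of "2 * \<Phi> x"]]
    show ?thesis by simp
  qed
  have "\<Phi> x = \<phi> x" using x by (simp add: \<Phi>_def zero)
  have i: "(\<lambda>s. \<Phi> (x + s) * fejer n s) integrable_on {- 1..1}" "(\<lambda>s. \<Phi> (x - s) * fejer n s) integrable_on {- 1..1}"
      "(\<lambda>s. 2 * \<Phi> x * fejer n s) integrable_on {- 1..1}"
    by (intro integrable_continuous_real continuous_intros c\<Phi>)+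
  have "4 * (integral {- 1..1} k / 2 - \<phi> x) = integral {- 1..1} (\<lambda>s. \<Phi> (x + s) * fejer n s + \<Phi> (x - s) * fejer n s - 2 * \<Phi> x * fejer n s)"
    using integral_diff[OF integrable_add[OF i(1,2)] i(3)] integral_add[OF i(1,2)]
    unfolding plus minus const by (simp add: \<open>\<Phi> x = \<phi> x\<close>)
  \<comment> \<open>The 3 counts the translates in \<open>\<Phi>\<close>, the quotient is the kernel
    decay, and the last factor is the length 2. The total 24, divided by the 4 on the left, gives
    the 6 of the statement.\<close>
  also have "norm \<dots> \<le> 3 * A * (4 / (real n + 1)) * (1 - (- 1))"
  proof (rule integral_bound)
    fix s :: real assume s: "s \<in> {- 1..1}"
    have A: "A \<ge> 0" using order_trans[OF norm_ge_zero diff2[of 0 1]] by simp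
    have "\<Phi> (x + s) + \<Phi> (x - s) - 2 * \<Phi> x = (\<phi> ((x - 2) + s) + \<phi> ((x - 2) - s) - 2 * \<phi> (x - 2))
      + (\<phi> (x + s) + \<phi> (x - s) - 2 * \<phi> x) + (\<phi> ((x + 2) + s) + \<phi> ((x + 2) - s) - 2 * \<phi> (x + 2))"
      by (simp add: \<Phi>_def algebra_simps)
    also have "norm \<dots> \<le> A * s\<^sup>2 + A * s\<^sup>2 + A * s\<^sup>2"
      by (intro norm_triangle_le add_mono diff2)
    finally have "norm (\<Phi> (x + s) + \<Phi> (x - s) - 2 * \<Phi> x) * fejer n s \<le> 3 * A * s\<^sup>2 * fejer n s"
      using fejer_nonneg[of n s] by (intro mult_right_mono) auto
    also have "\<dots> = 3 * A * (fejer n s * s\<^sup>2)" by simp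
    also have "\<dots> \<le> 3 * A * (4 / (real n + 1))"
      using fejer_decay[OF s, of n] A by (intro mult_left_mono) auto
    finally show "norm (\<Phi> (x + s) * fejer n s + \<Phi> (x - s) * fejer n s - 2 * \<Phi> x * fejer n s) \<le> 3 * A * (4 / (real n + 1))"
      using fejer_nonneg[of n s] by (simp add: norm_mult flip: distrib_right left_diff_distrib)
  qed (auto intro!: continuous_intros c\<Phi>)
  finally have "4 * norm (integral {- 1..1} k / 2 - \<phi> x) \<le> 24 * A / (real n + 1)"
    unfolding norm_mult norm_numeral by simp
  then show ?thesis unfolding k_def by simp
qed

section \<open>Convolution of Lipschitz functions\<close>

definition lipschitz_bump :: "(real \<times> real \<Rightarrow> complex) \<Rightarrow> real \<Rightarrow> bool" where
  "lipschitz_bump f \<Lambda> \<longleftrightarrow> (\<forall>x y. norm (f x - f y) \<le> \<Lambda> * norm (x - y)) \<and> (\<forall>x. norm x \<ge> 1 / 2 \<longrightarrow> f x = 0)"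

lemma lipschitz_on_line:
  fixes g :: "real \<Rightarrow> complex"
  assumes "\<And>t. (g has_vector_derivative g' t) (at t)" and "\<And>t. norm (g' t) \<le> B"
  shows "norm (g a - g b) \<le> B * \<bar>a - b\<bar>"
proof -
  have "norm (g a - g b) \<le> B * norm (a - b)"
  proof (rule differentiable_bound[where S = UNIV and f' = "\<lambda>t s. s *\<^sub>R g' t"])
    show "(g has_derivative (\<lambda>s. s *\<^sub>R g' t)) (at t within UNIV)" for t
      using assms(1)[of t] by (simp add: has_vector_derivative_def)
    show "onorm (\<lambda>s. s *\<^sub>R g' t) \<le> B" for t
    proof (rule onorm_le)
      show "norm (s *\<^sub>R g' t) \<le> B * norm s" for s
        using mult_right_mono[OF assms(2)[of t] abs_ge_zero[of s]] by (simp add: mult_ac)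
    qed
  qed auto
  then show ?thesis by simp
qed

text \<open>The partial derivatives vanish on the open exterior of the disc, where \<open>f\<close>
  is locally zero, so by compactness they are bounded everywhere. The increment is then split along
  two axis-parallel segments.\<close>

lemma C1_plane_imp_lipschitz_bump:
  assumes C1: "C1_plane f" and supp: "supported_in f (ball 0 (1 / 2))"
  shows "\<exists>\<Lambda>. lipschitz_bump f \<Lambda>"
proof -
  have zero: "f x = 0" if "norm x \<ge> 1 / 2" for x
  proof (rule ccontr)
    assume "f x \<noteq> 0"
    then have "x \<in> ball 0 (1 / 2)" using supp by (auto simp: supported_in_def)
    with that show False by simp
  qed
  from C1 obtain f1 f2 where cont: "continuous_on UNIV f1" "continuous_on UNIV f2"
    and D: "\<And>x y. ((\<lambda>t. f (t, y)) has_vector_derivative f1 (x, y)) (at x)"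
      "\<And>x y. ((\<lambda>t. f (x, t)) has_vector_derivative f2 (x, y)) (at y)"
    unfolding C1_plane_def by auto
  have bounded: "\<exists>B. \<forall>x. norm (F x) \<le> B"
    if "continuous_on UNIV F" and out: "\<And>x. norm x > 1 / 2 \<Longrightarrow> F x = 0" for F :: "real \<times> real \<Rightarrow> complex"
  proof -
    have "compact (F ` cball 0 (1 / 2))"
      by (intro compact_continuous_image continuous_on_subset[OF that(1)]) auto
    then obtain B where B: "B > 0" "\<And>x. x \<in> cball 0 (1 / 2) \<Longrightarrow> norm (F x) \<le> B"
      using compact_imp_bounded bounded_pos by (metis imageI)
    have "norm (F x) \<le> B" for x
      using B out[of x] by (cases "x \<in> cball 0 (1 / 2)") auto
    then show ?thesis by blast
  qed
  have "f1 x = 0" if "norm x > 1 / 2" for x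
  proof -
    have "open {t. norm (t, snd x) > 1 / 2}"
      by (intro open_Collect_less continuous_intros)
    from has_vector_derivative_transform_within_open[OF D(1)[where x = "fst x" and y = "snd x"] this, of "\<lambda>_. 0"]
    have "((\<lambda>_. 0) has_vector_derivative f1 x) (at (fst x))"
      using that zero by (simp add: less_imp_le)
    then show ?thesis by (rule vector_derivative_unique_at) (rule has_vector_derivative_const)
  qed
  with bounded[OF cont(1)] obtain B1 where B1: "\<And>x. norm (f1 x) \<le> B1" by blast
  have "f2 x = 0" if "norm x > 1 / 2" for x
  proof -
    have "open {t. norm (fst x, t) > 1 / 2}"
      by (intro open_Collect_less continuous_intros)
    from has_vector_derivative_transform_within_open[OF D(2)[where x = "fst x" and y = "snd x"] this, of "\<lambda>_. 0"]
    have "((\<lambda>_. 0) has_vector_derivative f2 x) (at (snd x))"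
      using that zero by (simp add: less_imp_le)
    then show ?thesis by (rule vector_derivative_unique_at) (rule has_vector_derivative_const)
  qed
  with bounded[OF cont(2)] obtain B2 where B2: "\<And>x. norm (f2 x) \<le> B2" by blast
  have "norm (f x - f y) \<le> (B1 + B2) * norm (x - y)" for x y
  proof -
    obtain x1 x2 y1 y2 where [simp]: "x = (x1, x2)" "y = (y1, y2)" by (cases x, cases y) auto
    have B: "B1 \<ge> 0" "B2 \<ge> 0" using order_trans[OF norm_ge_zero B1] order_trans[OF norm_ge_zero B2] by auto
    have "norm (f x - f y) \<le> norm (f (x1, x2) - f (y1, x2)) + norm (f (y1, x2) - f (y1, y2))"
      using norm_triangle_ineq[of "f (x1, x2) - f (y1, x2)" "f (y1, x2) - f (y1, y2)"] by simp
    also have "\<dots> \<le> B1 * \<bar>x1 - y1\<bar> + B2 * \<bar>x2 - y2\<bar>"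
      by (intro add_mono lipschitz_on_line[OF D(1) B1] lipschitz_on_line[OF D(2) B2])
    also have "\<dots> \<le> B1 * norm (x - y) + B2 * norm (x - y)"
      using B norm_fst_le[of "x1 - y1" "x2 - y2"] norm_snd_le[of "x2 - y2" "x1 - y1"]
      by (intro add_mono mult_left_mono) auto
    finally show ?thesis by (simp add: distrib_right)
  qed
  with zero show ?thesis unfolding lipschitz_bump_def by blast
qed

lemma lipschitz_bump_zero: "lipschitz_bump f \<Lambda> \<Longrightarrow> norm x \<ge> 1 / 2 \<Longrightarrow> f x = 0"
  unfolding lipschitz_bump_def by blast

lemma lipschitz_bump_diff: "lipschitz_bump f \<Lambda> \<Longrightarrow> norm (f x - f y) \<le> \<Lambda> * norm (x - y)"
  unfolding lipschitz_bump_def by blast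

lemma lipschitz_bump_nonneg: "lipschitz_bump f \<Lambda> \<Longrightarrow> \<Lambda> \<ge> 0"
  using order_trans[OF norm_ge_zero lipschitz_bump_diff[of f \<Lambda> "(1, 0)" 0]] by (simp add: zero_prod_def norm_Pair)

text \<open>The zero \<open>(1 / 2, 0)\<close> lies within distance 1 of every point of the disc, so
  one constant serves both as Lipschitz constant and as sup bound.\<close>

lemma lipschitz_bump_bound:
  assumes f: "lipschitz_bump f \<Lambda>"
  shows "norm (f x) \<le> \<Lambda>"
proof (cases "norm x \<ge> 1 / 2")
  case True
  then show ?thesis using lipschitz_bump_zero[OF f] lipschitz_bump_nonneg[OF f] by simp
next
  case False
  have e: "norm (1 / 2 :: real, 0 :: real) = 1 / 2" by (simp add: norm_Pair)
  have "norm (f x - f (1 / 2, 0)) \<le> \<Lambda> * norm (x - (1 / 2, 0))" by (rule lipschitz_bump_diff[OF f])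
  also have "norm (x - (1 / 2, 0)) \<le> 1"
    using norm_triangle_ineq4[of x "(1 / 2, 0)"] False unfolding e by linarith
  finally show ?thesis
    using lipschitz_bump_zero[OF f, of "(1 / 2, 0)"] lipschitz_bump_nonneg[OF f] e by (simp add: mult_left_mono)
qed

lemma continuous_lipschitz:
  fixes f :: "'a :: real_normed_vector \<Rightarrow> 'b :: real_normed_vector"
  assumes "\<And>x y. norm (f x - f y) \<le> C * norm (x - y)"
  shows "continuous_on UNIV f"
proof -
  have "norm (f x - f y) \<le> \<bar>C\<bar> * norm (x - y)" for x y
    using order_trans[OF assms mult_right_mono[OF abs_ge_self norm_ge_zero]] .
  then have "\<bar>C\<bar>-lipschitz_on UNIV f" by (intro lipschitz_onI) (auto simp: dist_norm)
  then show ?thesis by (rule lipschitz_on_continuous_on)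
qed

lemma continuous_lipschitz_bump: "lipschitz_bump f \<Lambda> \<Longrightarrow> continuous_on UNIV f"
  by (rule continuous_lipschitz) (rule lipschitz_bump_diff)

lemma continuous_lipschitz_bump_comp:
  "lipschitz_bump f \<Lambda> \<Longrightarrow> continuous_on S g \<Longrightarrow> continuous_on S (\<lambda>x. f (g x))"
  by (rule continuous_on_compose2[OF continuous_lipschitz_bump]) auto

section \<open>Integration over the square\<close>

abbreviation unit_square :: "(real \<times> real) set" where
  "unit_square \<equiv> cbox (- 1, - 1) (1, 1)"

lemma in_unit_square_iff: "x \<in> unit_square \<longleftrightarrow> \<bar>fst x\<bar> \<le> 1 \<and> \<bar>snd x\<bar> \<le> 1"
  by (cases x) (auto simp: abs_le_iff)

lemma outside_unit_square:
  assumes "x \<notin> unit_square"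
  shows "norm x \<ge> 1 / 2"
  using assms norm_fst_le[of "fst x" "snd x"] norm_snd_le[of "snd x" "fst x"]
  unfolding in_unit_square_iff by (auto simp: not_le)

lemma integrable_unit_square: "integrable lborel (\<lambda>x. C * indicator unit_square x :: real)"
  by (intro integrable_mult_right integrable_real_indicator) (auto simp: emeasure_lborel_cbox_eq)

lemma integral_unit_square: "(LINT x|lborel. C * indicator unit_square x) = 4 * (C :: real)"
  by (simp add: content_Pair)

lemma integrable_continuous_compact_support:
  fixes \<phi> :: "real \<times> real \<Rightarrow> complex"
  assumes "continuous_on UNIV \<phi>" and zero: "\<And>x. x \<notin> unit_square \<Longrightarrow> \<phi> x = 0"
  shows "integrable lborel \<phi>"
proof -
  have "integrable lborel (\<lambda>x. indicator unit_square x *\<^sub>R \<phi> x)"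
    by (intro borel_integrable_compact compact_cbox continuous_on_subset[OF assms(1)]) auto
  moreover have "indicator unit_square x *\<^sub>R \<phi> x = \<phi> x" for x
    using zero[of x] by (auto simp: indicator_def)
  ultimately show ?thesis by (simp only:)
qed

lemma lborel_integral_shift:
  fixes F :: "'a :: euclidean_space \<Rightarrow> 'b :: {banach, second_countable_topology}"
  assumes "F \<in> borel_measurable borel"
  shows "(LINT y|lborel. F (v + y)) = (LINT y|lborel. F y)"
  using integral_distr[of "(+) v" lborel borel F] assms by (simp add: lborel_distr_plus)

lemma lborel_integrable_shift:
  fixes F :: "'a :: euclidean_space \<Rightarrow> 'b :: {banach, second_countable_topology}"
  assumes "integrable lborel F"
  shows "integrable lborel (\<lambda>y. F (v + y))"
  using integrable_distr_eq[of "(+) v" lborel borel F] assms by (simp add: lborel_distr_plus)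

context
  fixes f g :: "real \<times> real \<Rightarrow> complex" and \<Lambda> \<Gamma> :: real
  assumes f: "lipschitz_bump f \<Lambda>" and g: "lipschitz_bump g \<Gamma>"
begin

lemma convolution_integrable: "integrable lborel (\<lambda>y. f (v + y) * g (x - y))"
proof -
  have *: "integrable lborel (\<lambda>y. f y * g (x - y))" for x
    by (intro integrable_continuous_compact_support continuous_intros continuous_lipschitz_bump_comp[OF f] continuous_lipschitz_bump_comp[OF g])
       (simp add: lipschitz_bump_zero[OF f outside_unit_square])
  show ?thesis
    using lborel_integrable_shift[OF *[of "x + v"], of v] by (simp add: algebra_simps)
qed

text \<open>Translation of the integration variable allows an increment of the argument to be placed
  on either factor, as the second difference requires.\<close>

lemma convolution_shift: "(LINT y|lborel. f (v + y) * g (x - y)) = convolution f g (v + x)"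
proof -
  have "(\<lambda>y. f y * g (x + v - y)) \<in> borel_measurable borel"
    by (intro borel_measurable_continuous_onI continuous_intros continuous_lipschitz_bump_comp[OF f] continuous_lipschitz_bump_comp[OF g])
  from lborel_integral_shift[OF this, of v] show ?thesis
    by (simp add: convolution_def algebra_simps)
qed

lemma convolution_eq_0:
  assumes "\<bar>fst x\<bar> \<ge> 1 \<or> \<bar>snd x\<bar> \<ge> 1"
  shows "convolution f g x = 0"
proof -
  have "f y * g (x - y) = 0" for y
  proof (rule ccontr)
    assume "f y * g (x - y) \<noteq> 0"
    then have "norm y < 1 / 2" "norm (x - y) < 1 / 2"
      using lipschitz_bump_zero[OF f, of y] lipschitz_bump_zero[OF g, of "x - y"] by force+
    then have "norm x < 1" using norm_triangle_ineq[of y "x - y"] by simp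
    with assms norm_fst_le[of "fst x" "snd x"] norm_snd_le[of "snd x" "fst x"] show False by auto
  qed
  then have "(\<lambda>y. f y * g (x - y)) = (\<lambda>_. 0)" by blast
  then show ?thesis unfolding convolution_def by (simp only: Bochner_Integration.integral_zero)
qed

lemma convolution_lipschitz:
  "norm (convolution f g x - convolution f g x') \<le> 4 * (\<Lambda> * \<Gamma>) * norm (x - x')"
proof -
  have i: "integrable lborel (\<lambda>y. f y * g (x - y))" for x
    using convolution_integrable[of 0 x] by simp
  have "convolution f g x - convolution f g x' = (LINT y|lborel. f y * g (x - y) - f y * g (x' - y))"
    unfolding convolution_def by (rule Bochner_Integration.integral_diff[symmetric]) (rule i)+
  also have "norm \<dots> \<le> (LINT y|lborel. (\<Lambda> * \<Gamma> * norm (x - x')) * indicator unit_square y)"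
  proof (rule Bochner_Integration.integral_norm_bound_integral)
    fix y :: "real \<times> real"
    show "norm (f y * g (x - y) - f y * g (x' - y)) \<le> (\<Lambda> * \<Gamma> * norm (x - x')) * indicator unit_square y"
    proof (cases "y \<in> unit_square")
      case True
      have "norm (f y) * norm (g (x - y) - g (x' - y)) \<le> \<Lambda> * (\<Gamma> * norm (x - x'))"
        using lipschitz_bump_diff[OF g, of "x - y" "x' - y"]
        by (intro mult_mono lipschitz_bump_bound[OF f] lipschitz_bump_nonneg[OF f]) auto
      with True show ?thesis by (simp add: norm_mult mult.assoc flip: right_diff_distrib)
    next
      case False
      then show ?thesis by (simp add: lipschitz_bump_zero[OF f outside_unit_square])
    qed
  qed (intro Bochner_Integration.integrable_diff i integrable_unit_square)+
  finally show ?thesis unfolding integral_unit_square by (simp only: mult.assoc)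
qed

text \<open>The second difference of a convolution is the convolution of two first differences.\<close>

lemma convolution_second_difference:
  "norm (convolution f g (x + v) + convolution f g (x - v) - 2 * convolution f g x) \<le> 8 * (\<Lambda> * \<Gamma>) * (norm v)\<^sup>2"
proof -
  have i: "integrable lborel (\<lambda>y. f (w + y) * g (z - y))" for w z by (rule convolution_integrable)
  define J where "J w z = (LINT y|lborel. f (w + y) * g (z - y))" for w z
  have J: "J w z = convolution f g (w + z)" for w z unfolding J_def by (rule convolution_shift)
  \<comment> \<open>One copy of the convolution at \<open>x\<close> is written as
    \<open>J v (x - v)\<close>, the other as \<open>J 0 x\<close>; the four integrands then factor
    into an increment of \<open>f\<close> times an increment of \<open>g\<close>.\<close>
  have "convolution f g (x + v) + convolution f g (x - v) - 2 * convolution f g x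
      = (J v x - J v (x - v)) - (J 0 x - J 0 (x - v))"
    unfolding J by (simp add: add.commute)
  also have "\<dots> = (LINT y|lborel. (f (v + y) * g (x - y) - f (v + y) * g (x - v - y)) - (f (0 + y) * g (x - y) - f (0 + y) * g (x - v - y)))"
  proof -
    have "J w x - J w (x - v) = (LINT y|lborel. f (w + y) * g (x - y) - f (w + y) * g (x - v - y))" for w
      unfolding J_def by (rule Bochner_Integration.integral_diff[OF i i, symmetric])
    then have "(J v x - J v (x - v)) - (J 0 x - J 0 (x - v))
      = (LINT y|lborel. f (v + y) * g (x - y) - f (v + y) * g (x - v - y)) - (LINT y|lborel. f (0 + y) * g (x - y) - f (0 + y) * g (x - v - y))"
      by (intro arg_cong2[where f = minus])
    also have "\<dots> = (LINT y|lborel. (f (v + y) * g (x - y) - f (v + y) * g (x - v - y)) - (f (0 + y) * g (x - y) - f (0 + y) * g (x - v - y)))"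
      by (rule Bochner_Integration.integral_diff[OF Bochner_Integration.integrable_diff[OF i i] Bochner_Integration.integrable_diff[OF i i], symmetric])
    finally show ?thesis .
  qed
  finally have eq: "convolution f g (x + v) + convolution f g (x - v) - 2 * convolution f g x = \<dots>" .
  \<comment> \<open>The increment of \<open>f\<close> lives on the square or its translate by
    \<open>- v\<close>. Each indicator has integral 4, whence the constant 8.\<close>
  have "norm (LINT y|lborel. (f (v + y) * g (x - y) - f (v + y) * g (x - v - y)) - (f (0 + y) * g (x - y) - f (0 + y) * g (x - v - y)))
    \<le> (LINT y|lborel. (\<Lambda> * \<Gamma> * (norm v)\<^sup>2) * indicator unit_square (v + y) + (\<Lambda> * \<Gamma> * (norm v)\<^sup>2) * indicator unit_square y)"
  proof (rule Bochner_Integration.integral_norm_bound_integral)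
    fix y :: "real \<times> real"
    let ?d = "f (v + y) * g (x - y) - f (v + y) * g (x - v - y) - (f (0 + y) * g (x - y) - f (0 + y) * g (x - v - y))"
    have d: "?d = (f (v + y) - f y) * (g (x - y) - g (x - v - y))" by (simp add: algebra_simps)
    have nn: "\<Lambda> * \<Gamma> * (norm v)\<^sup>2 \<ge> 0"
      using lipschitz_bump_nonneg[OF f] lipschitz_bump_nonneg[OF g] by simp
    show "norm ?d \<le> (\<Lambda> * \<Gamma> * (norm v)\<^sup>2) * indicator unit_square (v + y) + (\<Lambda> * \<Gamma> * (norm v)\<^sup>2) * indicator unit_square y"
    proof (cases "v + y \<in> unit_square \<or> y \<in> unit_square")
      case True
      have "norm ?d \<le> (\<Lambda> * norm v) * (\<Gamma> * norm v)"
        unfolding d norm_mult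
        using lipschitz_bump_diff[OF f, of "v + y" y] lipschitz_bump_diff[OF g, of "x - y" "x - v - y"] lipschitz_bump_nonneg[OF f]
        by (intro mult_mono) auto
      also have "\<dots> = \<Lambda> * \<Gamma> * (norm v)\<^sup>2" by (simp add: power2_eq_square)
      also have "\<dots> \<le> (\<Lambda> * \<Gamma> * (norm v)\<^sup>2) * indicator unit_square (v + y) + (\<Lambda> * \<Gamma> * (norm v)\<^sup>2) * indicator unit_square y"
      proof -
        have "indicator unit_square (v + y) = (1 :: real) \<or> indicator unit_square y = (1 :: real)"
          using True unfolding indicator_eq_1_iff .
        moreover have "indicator unit_square (v + y) \<ge> (0 :: real)" "indicator unit_square y \<ge> (0 :: real)"
          by (rule indicator_pos_le)+
        ultimately have "1 \<le> indicator unit_square (v + y) + (indicator unit_square y :: real)" by linarith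
        from mult_left_mono[OF this nn] show ?thesis by (simp only: mult_1_right distrib_left)
      qed
      finally show ?thesis .
    next
      case False
      then have "f (v + y) = 0" "f y = 0" using lipschitz_bump_zero[OF f outside_unit_square] by blast+
      then show ?thesis using nn unfolding d by simp
    qed
  next
    show "integrable lborel (\<lambda>y. (f (v + y) * g (x - y) - f (v + y) * g (x - v - y)) - (f (0 + y) * g (x - y) - f (0 + y) * g (x - v - y)))"
      by (rule Bochner_Integration.integrable_diff[OF Bochner_Integration.integrable_diff[OF i i] Bochner_Integration.integrable_diff[OF i i]])
    show "integrable lborel (\<lambda>y. (\<Lambda> * \<Gamma> * (norm v)\<^sup>2) * indicator unit_square (v + y) + (\<Lambda> * \<Gamma> * (norm v)\<^sup>2) * indicator unit_square y)"
      by (rule Bochner_Integration.integrable_add[OF lborel_integrable_shift[OF integrable_unit_square] integrable_unit_square])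
  qed
  also have "\<dots> = 8 * (\<Lambda> * \<Gamma> * (norm v)\<^sup>2)"
  proof -
    have m: "(\<lambda>y. (\<Lambda> * \<Gamma> * (norm v)\<^sup>2) * indicator unit_square y :: real) \<in> borel_measurable borel" by measurable
    show ?thesis
      by (subst Bochner_Integration.integral_add)
         (simp_all only: integrable_unit_square lborel_integrable_shift[OF integrable_unit_square]
           lborel_integral_shift[OF m] integral_unit_square)
  qed
  finally show ?thesis unfolding eq by (simp only: mult.assoc)
qed

end

section \<open>Riemann sums and uniform approximation of the convolution\<close>

lemma grid_cell_iff:
  assumes "L > 0"
  shows "x \<in> {grid L i..<grid L i + 2 / real L} \<longleftrightarrow> \<lfloor>(x + 1) * real L / 2\<rfloor> = int i - 1"
  unfolding floor_eq_iff grid_def using assms by (auto simp: field_simps)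

text \<open>The Riemann sum is the integral of the step function \<open>s\<close>, which differs
  from \<open>\<phi>\<close> by at most \<open>C\<close> times \<open>4 / L\<close>, a bound for the
  cell diameter, and only on the square of area 4; the product is the 16.\<close>

lemma riemann_sum_error:
  assumes \<phi>: "lipschitz_bump \<phi> C" and L: "L > 0"
  shows "norm ((2 / of_nat L)\<^sup>2 * (\<Sum>a\<in>{1..L} \<times> {1..L}. \<phi> (sample_pt L a)) - (LINT x|lborel. \<phi> x)) \<le> 16 * C / real L"
proof -
  let ?I = "{1..L} \<times> {1..L}"
  \<comment> \<open>Half-open cells partition the half-open square, so that the sum defining
    \<open>s\<close> has at most one nonzero term, at index \<open>a0 x\<close>.\<close>
  define cell where "cell a = {grid L (fst a)..<grid L (fst a) + 2 / real L} \<times> {grid L (snd a)..<grid L (snd a) + 2 / real L}" for a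
  define a0 where "a0 x = (nat (\<lfloor>(fst x + 1) * real L / 2\<rfloor> + 1), nat (\<lfloor>(snd x + 1) * real L / 2\<rfloor> + 1))" for x :: "real \<times> real"
  have C: "C \<ge> 0" by (rule lipschitz_bump_nonneg[OF \<phi>])
  have cell: "x \<in> cell a \<longleftrightarrow> a = a0 x" if "a \<in> ?I" for x a
  proof -
    have "x \<in> cell a \<longleftrightarrow> \<lfloor>(fst x + 1) * real L / 2\<rfloor> = int (fst a) - 1 \<and> \<lfloor>(snd x + 1) * real L / 2\<rfloor> = int (snd a) - 1"
      unfolding cell_def mem_Times_iff grid_cell_iff[OF L] ..
    also have "\<dots> \<longleftrightarrow> a = a0 x"
      using that unfolding a0_def prod_eq_iff mem_Times_iff by auto
    finally show ?thesis .
  qed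
  have cell_measure: "emeasure lborel (cell a) = ennreal ((2 / real L)\<^sup>2)" for a
  proof -
    have "emeasure lborel (cell a) = emeasure (lborel \<Otimes>\<^sub>M lborel) (cell a)" by (simp add: lborel_prod)
    also have "\<dots> = ennreal (2 / real L) * ennreal (2 / real L)"
      unfolding cell_def by (subst lborel.emeasure_pair_measure_Times) auto
    also have "\<dots> = ennreal ((2 / real L)\<^sup>2)" by (simp add: power2_eq_square ennreal_mult[symmetric])
    finally show ?thesis .
  qed
  have cell_sets: "cell a \<in> sets lborel" for a
    unfolding cell_def by (simp add: borel_Times)
  have cell_int: "integrable lborel (\<lambda>x. indicator (cell a) x :: real)" for a
    using cell_sets cell_measure by (intro integrable_real_indicator) auto
  define s where "s x = (\<Sum>a\<in>?I. indicator (cell a) x *\<^sub>R \<phi> (sample_pt L a))" for x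
  have s_int: "integrable lborel s"
    unfolding s_def by (intro Bochner_Integration.integrable_sum integrable_scaleR_left cell_int)
  have \<phi>_int: "integrable lborel \<phi>"
    by (intro integrable_continuous_compact_support continuous_lipschitz_bump[OF \<phi>] lipschitz_bump_zero[OF \<phi>] outside_unit_square)
  have "(LINT x|lborel. s x) = (\<Sum>a\<in>?I. (LINT x|lborel. indicator (cell a) x) *\<^sub>R \<phi> (sample_pt L a))"
  proof -
    have "(LINT x|lborel. s x) = (\<Sum>a\<in>?I. LINT x|lborel. indicator (cell a) x *\<^sub>R \<phi> (sample_pt L a))"
      unfolding s_def by (rule Bochner_Integration.integral_sum) (intro integrable_scaleR_left cell_int)
    also have "\<dots> = (\<Sum>a\<in>?I. (LINT x|lborel. indicator (cell a) x) *\<^sub>R \<phi> (sample_pt L a))"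
      by (intro sum.cong refl Bochner_Integration.integral_scaleR_left cell_int)
    finally show ?thesis .
  qed
  moreover have "(LINT x|lborel. indicator (cell a) x) = (2 / real L)\<^sup>2" for a
    using cell_measure[of a] cell_sets[of a] by (simp add: measure_def)
  ultimately have "(LINT x|lborel. s x) = (\<Sum>a\<in>?I. (2 / real L)\<^sup>2 *\<^sub>R \<phi> (sample_pt L a))"
    by (simp only:)
  then have s: "(LINT x|lborel. s x) = (2 / of_nat L)\<^sup>2 * (\<Sum>a\<in>?I. \<phi> (sample_pt L a))"
    by (simp add: sum_distrib_left scaleR_conv_of_real)
  have pointwise: "norm (s x - \<phi> x) \<le> (4 * C / real L) * indicator unit_square x" for x
  proof -
    have "s x = (\<Sum>a\<in>?I. if a = a0 x then \<phi> (sample_pt L a) else 0)"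
      unfolding s_def by (intro sum.cong refl) (simp add: cell indicator_def)
    then have sx: "s x = (if a0 x \<in> ?I then \<phi> (sample_pt L (a0 x)) else 0)" by simp
    show ?thesis
    proof (cases "a0 x \<in> ?I")
      case True
      then have "x \<in> cell (a0 x)" by (simp add: cell)
      then have b: "grid L (fst (a0 x)) \<le> fst x" "fst x < grid L (fst (a0 x)) + 2 / real L"
          "grid L (snd (a0 x)) \<le> snd x" "snd x < grid L (snd (a0 x)) + 2 / real L"
        by (auto simp: cell_def mem_Times_iff)
      have grid_bounds: "- 1 \<le> grid L i" "grid L i + 2 / real L \<le> 1" if "i \<in> {1..L}" for i
        using that L by (auto simp: grid_def field_simps)
      have "x \<in> unit_square"
        using b grid_bounds[of "fst (a0 x)"] grid_bounds[of "snd (a0 x)"] True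
        unfolding in_unit_square_iff mem_Times_iff abs_le_iff by (auto simp del: atLeastAtMost_iff)
      moreover have "norm (sample_pt L (a0 x) - x) \<le> 4 / real L"
      proof -
        have "sample_pt L (a0 x) - x = (grid L (fst (a0 x)) - fst x, grid L (snd (a0 x)) - snd x)"
          by (simp add: sample_pt_def prod_eq_iff)
        then have "norm (sample_pt L (a0 x) - x) \<le> \<bar>grid L (fst (a0 x)) - fst x\<bar> + \<bar>grid L (snd (a0 x)) - snd x\<bar>"
          by (simp add: norm_Pair sqrt_sum_squares_le_sum_abs)
        also have "\<dots> \<le> 2 / real L + 2 / real L" using b by linarith
        finally show ?thesis by simp
      qed
      from order_trans[OF lipschitz_bump_diff[OF \<phi>] mult_left_mono[OF this C]]
      have "norm (s x - \<phi> x) \<le> C * (4 / real L)"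
        by (simp only: sx True if_True)
      ultimately show ?thesis by (simp add: mult_ac del: mem_box cbox_Pair_iff)
    next
      case False
      have "\<phi> x = 0"
      proof (rule ccontr)
        assume "\<phi> x \<noteq> 0"
        then have "norm x < 1 / 2" using lipschitz_bump_zero[OF \<phi>, of x] by force
        then have lt: "\<bar>fst x\<bar> < 1" "\<bar>snd x\<bar> < 1"
          using norm_fst_le[of "fst x" "snd x"] norm_snd_le[of "snd x" "fst x"] by auto
        have "nat (\<lfloor>(t + 1) * real L / 2\<rfloor> + 1) \<in> {1..L}" if "\<bar>t\<bar> < 1" for t
        proof -
          have "0 \<le> (t + 1) * real L / 2" using that L by auto
          moreover have "(t + 1) * real L < 2 * real L"
            using that L by (intro mult_strict_right_mono) auto
          then have "(t + 1) * real L / 2 < real L" by simp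
          moreover define m where "m = \<lfloor>(t + 1) * real L / 2\<rfloor>"
          ultimately have "0 \<le> m" "m < int L"
            by (simp_all only: m_def zero_le_floor floor_less_iff of_int_of_nat_eq)
          then show ?thesis unfolding m_def[symmetric] by auto
        qed
        with lt have "a0 x \<in> ?I" by (simp add: a0_def del: atLeastAtMost_iff)
        with False show False by simp
      qed
      with False show ?thesis using C by (simp add: sx)
    qed
  qed
  have "(LINT x|lborel. s x) - (LINT x|lborel. \<phi> x) = (LINT x|lborel. s x - \<phi> x)"
    using s_int \<phi>_int by (rule Bochner_Integration.integral_diff[symmetric])
  moreover have "norm (LINT x|lborel. s x - \<phi> x) \<le> (LINT x|lborel. (4 * C / real L) * indicator unit_square x)"
    by (rule Bochner_Integration.integral_norm_bound_integral[OF Bochner_Integration.integrable_diff[OF s_int \<phi>_int] integrable_unit_square pointwise])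
  ultimately show ?thesis unfolding s integral_unit_square by simp
qed

text \<open>The bump constants bound the suprema as well, so by the product rule for differences the
  integrand is a bump with constant \<open>2 * (\<Lambda> * \<Gamma>)\<close>, which doubles the 16
  to 32.\<close>

lemma convolution_riemann_error:
  assumes f: "lipschitz_bump f \<Lambda>" and g: "lipschitz_bump g \<Gamma>" and L: "L > 0"
  shows "norm ((2 / of_nat L)\<^sup>2 * (\<Sum>a\<in>{1..L} \<times> {1..L}. f (sample_pt L a) * g (x - sample_pt L a)) - convolution f g x)
    \<le> 32 * (\<Lambda> * \<Gamma>) / real L"
proof -
  have "lipschitz_bump (\<lambda>y. f y * g (x - y)) (2 * (\<Lambda> * \<Gamma>))"
    unfolding lipschitz_bump_def
  proof (intro conjI allI impI)
    fix y y' :: "real \<times> real"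
    have eq: "f y * g (x - y) - f y' * g (x - y') = f y * (g (x - y) - g (x - y')) + (f y - f y') * g (x - y')"
      by (simp add: algebra_simps)
    have "norm (f y * g (x - y) - f y' * g (x - y')) \<le> norm (f y) * norm (g (x - y) - g (x - y')) + norm (f y - f y') * norm (g (x - y'))"
      unfolding norm_mult[symmetric] eq by (rule norm_triangle_ineq)
    also have "\<dots> \<le> \<Lambda> * (\<Gamma> * norm (y - y')) + (\<Lambda> * norm (y - y')) * \<Gamma>"
    proof (intro add_mono mult_mono lipschitz_bump_bound[OF f] lipschitz_bump_bound[OF g] lipschitz_bump_diff[OF f])
      show "norm (g (x - y) - g (x - y')) \<le> \<Gamma> * norm (y - y')"
        using lipschitz_bump_diff[OF g, of "x - y" "x - y'"] by (simp add: norm_minus_commute)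
    qed (use lipschitz_bump_nonneg[OF f] in auto)
    also have "\<dots> = 2 * (\<Lambda> * \<Gamma>) * norm (y - y')" by (simp add: algebra_simps)
    finally show "norm (f y * g (x - y) - f y' * g (x - y')) \<le> 2 * (\<Lambda> * \<Gamma>) * norm (y - y')" .
  next
    fix y :: "real \<times> real" assume "norm y \<ge> 1 / 2"
    from lipschitz_bump_zero[OF f this] show "f y * g (x - y) = 0" by simp
  qed
  then have "norm ((2 / of_nat L)\<^sup>2 * (\<Sum>a\<in>{1..L} \<times> {1..L}. f (sample_pt L a) * g (x - sample_pt L a)) - convolution f g x)
      \<le> 16 * (2 * (\<Lambda> * \<Gamma>)) / real L"
    unfolding convolution_def using L by (rule riemann_sum_error)
  then show ?thesis by (simp only: mult.assoc[symmetric])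
qed

text \<open>The one-dimensional mean is taken in one variable after the other. As the kernel is
  nonnegative with mean 1, the second averaging does not enlarge the error of the first, so the two
  errors of size 6 add up to 12.\<close>

lemma fejer_approximation:
  fixes h :: "real \<times> real \<Rightarrow> complex"
  assumes cont: "continuous_on UNIV h"
    and zero: "\<And>x. \<bar>fst x\<bar> \<ge> 1 \<or> \<bar>snd x\<bar> \<ge> 1 \<Longrightarrow> h x = 0"
    and diff2: "\<And>x v. norm (h (x + v) + h (x - v) - 2 * h x) \<le> A * (norm v)\<^sup>2"
  shows "\<exists>q. \<forall>x\<in>unit_square. norm ((\<Sum>k\<in>freq_box n. q k * char2 k x) - h x) \<le> 12 * A / (real n + 1)"
proof -
  let ?J = "{- int n..int n}"
  define c where "c j = complex_of_real (fejer_coeff n j)" for j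
  \<comment> \<open>Fourier coefficients in the first variable only; taking those of
    \<open>\<eta>\<close> in the second variable gives \<open>q\<close>, which must not depend on
    the point \<open>x\<close>.\<close>
  define \<eta> where "\<eta> j v = integral {- 1..1} (\<lambda>u. h (u, v) * cis (- (pi * of_int j * u)))" for j :: int and v
  define q where "q k = c (fst k) * c (snd k) / 4 * integral {- 1..1} (\<lambda>v. \<eta> (fst k) v * cis (- (pi * of_int (snd k) * v)))" for k
  have ch: "continuous_on S (\<lambda>x. h (a x, b x))" if "continuous_on S a" "continuous_on S b" for S :: "'a :: topological_space set" and a b
    by (rule continuous_on_compose2[OF cont]) (auto intro!: continuous_intros that)
  have expand: "complex_of_real (fejer n (x - u)) = (\<Sum>j\<in>?J. c j * cis (pi * of_int j * x) * cis (- (pi * of_int j * u)))" for x u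
    unfolding fejer_expand c_def mult.assoc cis_mult by (simp add: algebra_simps)
  have c\<eta>: "continuous_on S (\<eta> j)" for S j
  proof -
    have "continuous_on UNIV (\<lambda>v. integral (cbox (- 1) 1) (\<lambda>u. h (u, v) * cis (- (pi * of_int j * u))))"
      by (rule integral_continuous_on_param) (auto simp: case_prod_unfold intro!: continuous_intros ch)
    then show ?thesis unfolding \<eta>_def[abs_def] box_real(2) by (rule continuous_on_subset) simp
  qed
  have "norm ((\<Sum>k\<in>freq_box n. q k * char2 k x) - h x) \<le> 12 * A / (real n + 1)" if x: "x \<in> unit_square" for x
  proof -
    obtain x1 x2 where x_eq: "x = (x1, x2)" by (cases x)
    have x12: "x1 \<in> {- 1..1}" "x2 \<in> {- 1..1}" using x by (auto simp: x_eq)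
    define \<epsilon> where "\<epsilon> = 6 * A / (real n + 1)"
    define H where "H v = integral {- 1..1} (\<lambda>u. h (u, v) * fejer n (x1 - u)) / 2" for v
    have H: "H v = (\<Sum>j\<in>?J. c j * cis (pi * of_int j * x1) / 2 * \<eta> j v)" for v
    proof -
      have "(\<lambda>u. h (u, v) * fejer n (x1 - u)) = (\<lambda>u. \<Sum>j\<in>?J. c j * cis (pi * of_int j * x1) * (h (u, v) * cis (- (pi * of_int j * u))))"
        unfolding expand by (simp add: sum_distrib_left mult_ac)
      moreover have "integral {- 1..1} (\<lambda>u. \<Sum>j\<in>?J. c j * cis (pi * of_int j * x1) * (h (u, v) * cis (- (pi * of_int j * u))))
          = (\<Sum>j\<in>?J. c j * cis (pi * of_int j * x1) * \<eta> j v)"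
        unfolding \<eta>_def
        by (subst integral_sum) (auto intro!: integrable_continuous_real continuous_intros ch)
      ultimately show ?thesis by (simp add: H_def sum_divide_distrib)
    qed
    have cH: "continuous_on S H" for S
      unfolding H[abs_def] by (intro continuous_intros c\<eta>)
    have "norm (integral {- 1..1} (\<lambda>u. h (u, v) * fejer n (x1 - u)) / 2 - h (x1, v)) \<le> 6 * A / (real n + 1)" for v
    proof (rule fejer_mean_error[OF _ _ _ x12(1)])
      show "continuous_on UNIV (\<lambda>u. h (u, v))" by (intro ch continuous_intros)
      show "h (u, v) = 0" if "\<bar>u\<bar> \<ge> 1" for u using that by (intro zero) simp
      show "norm (h (u + s, v) + h (u - s, v) - 2 * h (u, v)) \<le> A * s\<^sup>2" for u s
        using diff2[of "(u, v)" "(s, 0)"] by (simp add: norm_Pair)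
    qed
    then have H_err: "norm (H v - h (x1, v)) \<le> \<epsilon>" for v by (simp add: H_def \<epsilon>_def)
    have second: "norm (integral {- 1..1} (\<lambda>v. h (x1, v) * fejer n (x2 - v)) / 2 - h (x1, x2)) \<le> 6 * A / (real n + 1)"
    proof (rule fejer_mean_error[OF _ _ _ x12(2)])
      show "continuous_on UNIV (\<lambda>u. h (x1, u))" by (intro ch continuous_intros)
      show "h (x1, u) = 0" if "\<bar>u\<bar> \<ge> 1" for u using that by (intro zero) simp
      show "norm (h (x1, u + s) + h (x1, u - s) - 2 * h (x1, u)) \<le> A * s\<^sup>2" for u s
        using diff2[of "(x1, u)" "(0, s)"] by (simp add: norm_Pair)
    qed
    have int_H: "(\<lambda>v. H v * fejer n (x2 - v)) integrable_on {- 1..1}"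
      and int_h: "(\<lambda>v. h (x1, v) * fejer n (x2 - v)) integrable_on {- 1..1}"
      and int_F: "(\<lambda>v. \<epsilon> * fejer n (x2 - v)) integrable_on {- 1..1}"
      by (intro integrable_continuous_real continuous_intros cH ch)+
    have "integral {- 1..1} (\<lambda>v. H v * fejer n (x2 - v)) - integral {- 1..1} (\<lambda>v. h (x1, v) * fejer n (x2 - v))
      = integral {- 1..1} (\<lambda>v. H v * fejer n (x2 - v) - h (x1, v) * fejer n (x2 - v))"
      using int_H int_h by (rule integral_diff[symmetric])
    moreover have "norm (integral {- 1..1} (\<lambda>v. H v * fejer n (x2 - v) - h (x1, v) * fejer n (x2 - v))) \<le> integral {- 1..1} (\<lambda>v. \<epsilon> * fejer n (x2 - v))"
    proof (rule Henstock_Kurzweil_Integration.integral_norm_bound_integral)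
      show "norm (H v * fejer n (x2 - v) - h (x1, v) * fejer n (x2 - v)) \<le> \<epsilon> * fejer n (x2 - v)" for v
        using mult_right_mono[OF H_err[of v] fejer_nonneg[of n "x2 - v"]] fejer_nonneg[of n "x2 - v"]
        by (simp add: norm_mult flip: left_diff_distrib)
    qed (intro integrable_diff int_H int_h int_F)+
    moreover have "integral {- 1..1} (\<lambda>v. \<epsilon> * fejer n (x2 - v)) = \<epsilon> * 2"
      by (simp only: Henstock_Kurzweil_Integration.integral_mult_right integral_fejer)
    ultimately have "norm (integral {- 1..1} (\<lambda>v. H v * fejer n (x2 - v)) - integral {- 1..1} (\<lambda>v. h (x1, v) * fejer n (x2 - v))) \<le> \<epsilon> * 2"
      by (simp only:)
    then have first: "norm (integral {- 1..1} (\<lambda>v. H v * fejer n (x2 - v)) / 2 - integral {- 1..1} (\<lambda>v. h (x1, v) * fejer n (x2 - v)) / 2) \<le> \<epsilon>"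
      by (simp add: norm_divide flip: diff_divide_distrib)
    have "integral {- 1..1} (\<lambda>v. H v * fejer n (x2 - v)) / 2 = (\<Sum>k\<in>freq_box n. q k * char2 k x)"
    proof -
      have "(\<lambda>v. H v * fejer n (x2 - v)) = (\<lambda>v. \<Sum>k\<in>freq_box n. c (fst k) * c (snd k) / 2 * char2 k x * (\<eta> (fst k) v * cis (- (pi * of_int (snd k) * v))))"
      proof
        fix v
        have "H v * fejer n (x2 - v) = (\<Sum>j\<in>?J. \<Sum>l\<in>?J. c j * cis (pi * of_int j * x1) / 2 * \<eta> j v * (c l * cis (pi * of_int l * x2) * cis (- (pi * of_int l * v))))"
          unfolding H expand by (rule sum_product)
        also have "\<dots> = (\<Sum>j\<in>?J. \<Sum>l\<in>?J. c j * c l / 2 * char2 (j, l) x * (\<eta> j v * cis (- (pi * of_int l * v))))"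
          by (intro sum.cong refl) (simp add: char2_def x_eq distrib_left mult.assoc flip: cis_mult)
        finally show "H v * fejer n (x2 - v) = (\<Sum>k\<in>freq_box n. c (fst k) * c (snd k) / 2 * char2 k x * (\<eta> (fst k) v * cis (- (pi * of_int (snd k) * v))))"
          by (simp add: sum.cartesian_product case_prod_unfold)
      qed
      moreover have "integral {- 1..1} (\<lambda>v. \<Sum>k\<in>freq_box n. c (fst k) * c (snd k) / 2 * char2 k x * (\<eta> (fst k) v * cis (- (pi * of_int (snd k) * v))))
        = (\<Sum>k\<in>freq_box n. c (fst k) * c (snd k) / 2 * char2 k x * integral {- 1..1} (\<lambda>v. \<eta> (fst k) v * cis (- (pi * of_int (snd k) * v))))"
        by (subst integral_sum) (auto intro!: integrable_continuous_real continuous_intros c\<eta>)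
      ultimately show ?thesis by (simp add: q_def sum_divide_distrib mult_ac)
    qed
    with first second show ?thesis
      unfolding \<epsilon>_def x_eq
      using norm_triangle_ineq[of "integral {- 1..1} (\<lambda>v. H v * fejer n (x2 - v)) / 2 - integral {- 1..1} (\<lambda>v. h (x1, v) * fejer n (x2 - v)) / 2"
          "integral {- 1..1} (\<lambda>v. h (x1, v) * fejer n (x2 - v)) / 2 - h (x1, x2)"]
      by simp
  qed
  then show ?thesis by blast
qed

section \<open>The error estimate\<close>

text \<open>Here \<open>q\<close> holds the coefficients of the Fejer mean. On the grid both
  polynomials are close to the convolution, hence to each other, and Parseval turns this into
  closeness of their coefficients.\<close>

lemma discrete_convolution_error:
  assumes f: "lipschitz_bump f \<Lambda>" and g: "lipschitz_bump g \<Gamma>"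
  shows "\<exists>A>0. \<forall>K\<ge>1. \<exists>q.
    (\<forall>x. norm x \<le> 1 \<longrightarrow> norm ((\<Sum>k\<in>freq_box K. q k * char2 k x) - convolution f g x) \<le> A / real K) \<and>
    (\<Sum>k\<in>freq_box K. (norm (finite_FT f k (2 * K + 1) * finite_FT g k (2 * K + 1) - 4 * q k))\<^sup>2) \<le> (A / real K)\<^sup>2"
proof -
  define C where "C = \<Lambda> * \<Gamma>"
  have C: "C \<ge> 0" using lipschitz_bump_nonneg[OF f] lipschitz_bump_nonneg[OF g] by (simp add: C_def)
  show ?thesis
  \<comment> \<open>The Fejer error contributes \<open>12 * 8 = 96\<close> and the Riemann sum 32;
    their sum 128 is multiplied by 4 in comparing with \<open>4 * q\<close>. The added 1 keeps the
    constant positive when \<open>C = 0\<close>.\<close>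
  proof (intro exI[of _ "512 * C + 1"] conjI allI impI)
    show "512 * C + 1 > 0" using C by simp
    fix K :: nat assume K: "K \<ge> 1"
    define L where "L = 2 * K + 1"
    have L: "L > 0" "real L \<ge> real K" by (simp_all add: L_def)
    let ?h = "convolution f g"
    have "\<exists>q. \<forall>x\<in>unit_square. norm ((\<Sum>k\<in>freq_box K. q k * char2 k x) - ?h x) \<le> 12 * (8 * C) / (real K + 1)"
      unfolding C_def
      by (intro fejer_approximation continuous_lipschitz[OF convolution_lipschitz[OF f g]]
          convolution_eq_0[OF f g] convolution_second_difference[OF f g])
    then obtain q where q: "\<And>x. x \<in> unit_square \<Longrightarrow> norm ((\<Sum>k\<in>freq_box K. q k * char2 k x) - ?h x) \<le> 12 * (8 * C) / (real K + 1)"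
      by blast
    have q': "norm ((\<Sum>k\<in>freq_box K. q k * char2 k x) - ?h x) \<le> 96 * C / real K" if "x \<in> unit_square" for x
    proof -
      have "12 * (8 * C) / (real K + 1) \<le> 96 * C / real K" using C K by (intro frac_le) auto
      with q[OF that] show ?thesis by simp
    qed
    define t where "t k = finite_FT f k L * finite_FT g k L / 4 - q k" for k
    have grid_le: "norm (\<Sum>k\<in>freq_box K. t k * char2 k (grid_pt L p)) \<le> 128 * C / real K" if p: "p \<in> freq_box K" for p
    proof -
      let ?x = "grid_pt L p"
      let ?S = "\<Sum>k\<in>freq_box K. finite_FT f k L * finite_FT g k L / 4 * char2 k ?x"
      let ?Q = "\<Sum>k\<in>freq_box K. q k * char2 k ?x"
      have sq: "?x \<in> unit_square"
        using p L(1) unfolding in_unit_square_iff by (auto simp: grid_pt_def L_def abs_le_iff divide_simps)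
      have "?S = (2 / of_nat L)\<^sup>2 * (\<Sum>a\<in>{1..L} \<times> {1..L}. f (sample_pt L a) * g (?x - sample_pt L a))"
        unfolding L_def by (rule discrete_convolution[OF lipschitz_bump_zero[OF f] lipschitz_bump_zero[OF g] p])
      then have "norm (?S - ?h ?x) \<le> 32 * C / real L"
        unfolding C_def by (simp only: convolution_riemann_error[OF f g L(1)])
      also have "\<dots> \<le> 32 * C / real K" using C K L by (intro frac_le) auto
      finally have S: "norm (?S - ?h ?x) \<le> 32 * C / real K" .
      have "(\<Sum>k\<in>freq_box K. t k * char2 k ?x) = ?S - ?Q"
        by (simp add: t_def left_diff_distrib sum_subtractf)
      also have "\<dots> = (?S - ?h ?x) - (?Q - ?h ?x)" by simp
      also have "norm \<dots> \<le> 32 * C / real K + 96 * C / real K"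
        by (rule order_trans[OF norm_triangle_ineq4 add_mono[OF S q'[OF sq]]])
      finally show ?thesis by (simp add: add_divide_distrib[symmetric])
    qed
    have "(real L)\<^sup>2 * (\<Sum>k\<in>freq_box K. (norm (t k))\<^sup>2) = (\<Sum>p\<in>freq_box K. (norm (\<Sum>k\<in>freq_box K. t k * char2 k (grid_pt L p)))\<^sup>2)"
      unfolding L_def by (rule discrete_parseval[symmetric])
    also have "\<dots> \<le> (\<Sum>p\<in>freq_box K. (128 * C / real K)\<^sup>2)"
      by (intro sum_mono power_mono grid_le) auto
    \<comment> \<open>The number of grid points equals the factor in Parseval's identity, so the
      pointwise bound passes to the coefficients without any loss in \<open>K\<close>.\<close>
    also have "\<dots> = (real L)\<^sup>2 * (128 * C / real K)\<^sup>2"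
      by (simp add: card_cartesian_product L_def power2_eq_square algebra_simps)
    finally have "(\<Sum>k\<in>freq_box K. (norm (t k))\<^sup>2) \<le> (128 * C / real K)\<^sup>2"
      using L(1) by simp
    then have "16 * (\<Sum>k\<in>freq_box K. (norm (t k))\<^sup>2) \<le> 16 * (128 * C / real K)\<^sup>2" by simp
    moreover have "(norm (finite_FT f k L * finite_FT g k L - 4 * q k))\<^sup>2 = 16 * (norm (t k))\<^sup>2" for k
    proof -
      have "finite_FT f k L * finite_FT g k L - 4 * q k = 4 * t k" by (simp add: t_def algebra_simps)
      then show ?thesis by (simp add: norm_mult power_mult_distrib)
    qed
    moreover have "16 * (128 * C / real K)\<^sup>2 = (512 * C / real K)\<^sup>2" by (simp add: power2_eq_square)
    moreover have "(512 * C / real K)\<^sup>2 \<le> ((512 * C + 1) / real K)\<^sup>2"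
      using C K by (intro power_mono divide_right_mono) auto
    ultimately have "(\<Sum>k\<in>freq_box K. (norm (finite_FT f k (2 * K + 1) * finite_FT g k (2 * K + 1) - 4 * q k))\<^sup>2) \<le> ((512 * C + 1) / real K)\<^sup>2"
      unfolding L_def[symmetric] by (simp only: sum_distrib_left[symmetric])
    moreover have "norm ((\<Sum>k\<in>freq_box K. q k * char2 k x) - ?h x) \<le> (512 * C + 1) / real K" if "norm x \<le> 1" for x
    proof -
      have "x \<in> unit_square"
        using that norm_fst_le[of "fst x" "snd x"] norm_snd_le[of "snd x" "fst x"] unfolding in_unit_square_iff by auto
      note q'[OF this]
      also have "96 * C / real K \<le> (512 * C + 1) / real K" using C by (intro divide_right_mono) auto
      finally show ?thesis .
    qed
    ultimately show "\<exists>q. (\<forall>x. norm x \<le> 1 \<longrightarrow> norm ((\<Sum>k\<in>freq_box K. q k * char2 k x) - ?h x) \<le> (512 * C + 1) / real K) \<and>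
      (\<Sum>k\<in>freq_box K. (norm (finite_FT f k (2 * K + 1) * finite_FT g k (2 * K + 1) - 4 * q k))\<^sup>2) \<le> ((512 * C + 1) / real K)\<^sup>2"
      by blast
  qed
qed

text \<open>On the polynomial \<open>Q\<close> the discrete formula is exact, which splits the error
  in two: a sum against \<open>c_coeff\<close>, estimated by Cauchy-Schwarz, and the uniform
  distance of \<open>Q\<close> from the convolution on the unit disc.\<close>

lemma approx_coeff_error:
  assumes n: "n \<ge> 1" and h: "continuous_on UNIV (convolution f g)"
    and B: "(\<Sum>k\<in>freq_box K. (norm (c_coeff k m n))\<^sup>2) \<le> B"
    and q: "\<And>x. norm x \<le> 1 \<Longrightarrow> norm ((\<Sum>k\<in>freq_box K. q k * char2 k x) - convolution f g x) \<le> e"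
    and FT: "(\<Sum>k\<in>freq_box K. (norm (finite_FT f k (2 * K + 1) * finite_FT g k (2 * K + 1) - 4 * q k))\<^sup>2) \<le> e\<^sup>2"
  shows "norm (approx_coeff K m n f g - FB_coeff m n (convolution f g))
    \<le> (sqrt B + 2 * pi / (sqrt pi * \<bar>besselJ (m + 1) (bessel_zero m n)\<bar>)) * e"
proof -
  define d where "d k = finite_FT f k (2 * K + 1) * finite_FT g k (2 * K + 1) - 4 * q k" for k
  define Q where "Q x = (\<Sum>k\<in>freq_box K. q k * char2 k x)" for x
  have "e \<ge> 0" using order_trans[OF norm_ge_zero q[of 0]] by simp
  have "FB_coeff m n Q = (\<Sum>k\<in>freq_box K. q k * (4 * c_coeff k m n))"
    unfolding Q_def by (subst FB_coeff_trig_sum) (simp_all add: FB_coeff_char2[OF n])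
  then have eq: "approx_coeff K m n f g - FB_coeff m n (convolution f g)
      = (\<Sum>k\<in>freq_box K. c_coeff k m n * d k) + (FB_coeff m n Q - FB_coeff m n (convolution f g))"
    by (simp add: approx_coeff_def d_def right_diff_distrib sum_subtractf mult_ac)
  have "norm (\<Sum>k\<in>freq_box K. c_coeff k m n * d k) \<le> (\<Sum>k\<in>freq_box K. norm (c_coeff k m n * d k))"
    by (rule norm_sum)
  also have "\<dots> = (\<Sum>k\<in>freq_box K. \<bar>norm (c_coeff k m n)\<bar> * \<bar>norm (d k)\<bar>)"
    by (simp add: norm_mult)
  also have "\<dots> \<le> L2_set (\<lambda>k. norm (c_coeff k m n)) (freq_box K) * L2_set (\<lambda>k. norm (d k)) (freq_box K)"
    by (rule L2_set_mult_ineq)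
  also have "\<dots> \<le> sqrt B * e"
  proof (rule mult_mono)
    show "L2_set (\<lambda>k. norm (c_coeff k m n)) (freq_box K) \<le> sqrt B"
      unfolding L2_set_def using B by simp
    show "L2_set (\<lambda>k. norm (d k)) (freq_box K) \<le> e"
      unfolding L2_set_def using FT \<open>e \<ge> 0\<close> by (intro real_le_lsqrt) (auto simp: d_def sum_nonneg)
    show "sqrt B \<ge> 0" using order_trans[OF sum_nonneg B] by simp
  qed simp
  finally have 1: "norm (\<Sum>k\<in>freq_box K. c_coeff k m n * d k) \<le> sqrt B * e" .
  have "continuous_on UNIV Q"
    unfolding Q_def by (intro continuous_intros)
  then have 2: "norm (FB_coeff m n Q - FB_coeff m n (convolution f g))
      \<le> 2 * pi / (sqrt pi * \<bar>besselJ (m + 1) (bessel_zero m n)\<bar>) * e"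
    using h by (rule FB_coeff_diff_bound) (use q in \<open>simp add: Q_def\<close>)
  show ?thesis unfolding eq distrib_right
    by (rule order_trans[OF norm_triangle_ineq add_mono[OF 1 2]])
qed

theorem theorem5p5:
  shows "\<exists>(d :: (real \<times> real \<Rightarrow> complex) \<Rightarrow> (real \<times> real \<Rightarrow> complex) \<Rightarrow> real)
           (D :: nat \<Rightarrow> nat \<Rightarrow> real).
    \<forall>(f :: real \<times> real \<Rightarrow> complex) (g :: real \<times> real \<Rightarrow> complex) (M :: nat) (N :: nat).
      C1_plane f \<longrightarrow> C1_plane g \<longrightarrow>
      supported_in f (ball 0 (1 / 2)) \<longrightarrow> supported_in g (ball 0 (1 / 2)) \<longrightarrow>
      M \<ge> 1 \<longrightarrow> N \<ge> 1 \<longrightarrow>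
        d f g > 0 \<and> D M N > 0 \<and>
        (\<forall>K :: nat. K \<ge> 1 \<longrightarrow> int K \<ge> K_max M N \<longrightarrow>
          sup_norm (\<lambda>x. approx_sum K M N f g x - FB_sum M N (convolution f g) x)
            \<le> ereal (2 * d f g * D M N / real K))"
proof -
  define adm where "adm f \<longleftrightarrow> C1_plane f \<and> supported_in f (ball 0 (1 / 2))" for f
  have bump: "\<exists>\<Lambda>. lipschitz_bump f \<Lambda>" if "adm f" for f
    using that C1_plane_imp_lipschitz_bump by (auto simp: adm_def)
  define good where "good A K f g q \<longleftrightarrow>
      (\<forall>x. norm x \<le> 1 \<longrightarrow> norm ((\<Sum>k\<in>freq_box K. q k * char2 k x) - convolution f g x) \<le> A / real K) \<and>
      (\<Sum>k\<in>freq_box K. (norm (finite_FT f k (2 * K + 1) * finite_FT g k (2 * K + 1) - 4 * q k))\<^sup>2) \<le> (A / real K)\<^sup>2"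
    for A and K :: nat and f g q
  \<comment> \<open>\<open>d\<close> has to be fixed as a function of \<open>f\<close> and
    \<open>g\<close> alone, before \<open>M\<close>, \<open>N\<close> and \<open>K\<close>; outside
    the admissible class any positive number serves, so the choice always succeeds.\<close>
  have ex_d: "\<exists>A. A > 0 \<and> (adm f \<longrightarrow> adm g \<longrightarrow> (\<forall>K\<ge>1. \<exists>q. good A K f g q))" for f g
  proof (cases "adm f \<and> adm g")
    case True
    then obtain \<Lambda> \<Gamma> where "lipschitz_bump f \<Lambda>" "lipschitz_bump g \<Gamma>" using bump by blast
    from discrete_convolution_error[OF this] show ?thesis unfolding good_def by blast
  next
    case False
    then show ?thesis using zero_less_one by blast
  qed
  define d where "d f g = (SOME A. A > 0 \<and> (adm f \<longrightarrow> adm g \<longrightarrow> (\<forall>K\<ge>1. \<exists>q. good A K f g q)))" for f g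
  have d: "d f g > 0" "adm f \<Longrightarrow> adm g \<Longrightarrow> K \<ge> 1 \<Longrightarrow> \<exists>q. good (d f g) K f g q" for f g K
    using someI_ex[OF ex_d[of f g]] unfolding d_def[symmetric] by blast+
  have ex_B: "\<exists>B. n \<ge> 1 \<longrightarrow> (\<forall>K. (\<Sum>k\<in>freq_box K. (norm (c_coeff k m n))\<^sup>2) \<le> B)" for m n
    using sum_norm_c_coeff_bounded by blast
  define B where "B m n = (SOME B. n \<ge> 1 \<longrightarrow> (\<forall>K. (\<Sum>k\<in>freq_box K. (norm (c_coeff k m n))\<^sup>2) \<le> B))" for m n
  have B: "(\<Sum>k\<in>freq_box K. (norm (c_coeff k m n))\<^sup>2) \<le> B m n" if "n \<ge> 1" for m n K
    using someI_ex[OF ex_B[of n m]] that unfolding B_def[symmetric] by blast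
  define P where "P m n = 1 / (sqrt pi * \<bar>besselJ (m + 1) (bessel_zero m n)\<bar>)" for m n
  define G where "G m n = (sqrt (B m n) + 2 * pi * P m n) * P m n" for m n
  \<comment> \<open>\<open>G\<close> is the bound for a coefficient error, per unit of
    \<open>d f g / K\<close>, times the sup bound \<open>P\<close> of \<open>Psi\<close>. The 1
    secures positivity, and halving compensates for the factor 2 in the claimed estimate.\<close>
  define D where "D M N = (1 + (\<Sum>m = - int M..int M. \<Sum>n = 1..N. G m n)) / 2" for M N
  have P: "P m n \<ge> 0" for m n by (simp add: P_def)
  have G: "G m n \<ge> 0" if "n \<ge> 1" for m n
    using P order_trans[OF sum_nonneg B[OF that]] by (simp add: G_def)
  have D: "D M N > 0" for M N
    using G by (auto simp: D_def intro!: divide_pos_pos add_pos_nonneg sum_nonneg)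
  have main: "norm (approx_sum K M N f g x - FB_sum M N (convolution f g) x) \<le> 2 * d f g * D M N / real K"
    if adm: "adm f" "adm g" and K: "K \<ge> 1" for f g M N K x
  proof -
    obtain \<Lambda> \<Gamma> where bumps: "lipschitz_bump f \<Lambda>" "lipschitz_bump g \<Gamma>" using bump adm by blast
    have h: "continuous_on UNIV (convolution f g)"
      by (rule continuous_lipschitz[OF convolution_lipschitz[OF bumps]])
    obtain q where q: "good (d f g) K f g q" using d(2)[OF adm K] by blast
    have term_le: "norm ((approx_coeff K m n f g - FB_coeff m n (convolution f g)) * Psi m n x) \<le> d f g / real K * G m n"
      if n: "n \<ge> 1" for m n
    proof -
      have "norm (approx_coeff K m n f g - FB_coeff m n (convolution f g)) \<le> (sqrt (B m n) + 2 * pi * P m n) * (d f g / real K)"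
      proof -
        from q have q1: "norm ((\<Sum>k\<in>freq_box K. q k * char2 k x) - convolution f g x) \<le> d f g / real K" if "norm x \<le> 1" for x
          using that unfolding good_def by blast
        from q have q2: "(\<Sum>k\<in>freq_box K. (norm (finite_FT f k (2 * K + 1) * finite_FT g k (2 * K + 1) - 4 * q k))\<^sup>2) \<le> (d f g / real K)\<^sup>2"
          unfolding good_def by (rule conjunct2)
        from approx_coeff_error[OF n h B[OF n] q1 q2] show ?thesis unfolding P_def by simp
      qed
      moreover have "norm (Psi m n x) \<le> P m n" unfolding P_def by (rule norm_Psi_le)
      ultimately have "norm ((approx_coeff K m n f g - FB_coeff m n (convolution f g)) * Psi m n x)
          \<le> ((sqrt (B m n) + 2 * pi * P m n) * (d f g / real K)) * P m n"
        unfolding norm_mult by (intro mult_mono) (auto intro: order_trans[OF norm_ge_zero])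
      then show ?thesis by (simp add: G_def mult_ac)
    qed
    have eq: "approx_sum K M N f g x - FB_sum M N (convolution f g) x
        = (\<Sum>m = - int M..int M. \<Sum>n = 1..N. (approx_coeff K m n f g - FB_coeff m n (convolution f g)) * Psi m n x)"
      by (simp add: approx_sum_def FB_sum_def sum_subtractf left_diff_distrib)
    have "norm (approx_sum K M N f g x - FB_sum M N (convolution f g) x) \<le> (\<Sum>m = - int M..int M. \<Sum>n = 1..N. d f g / real K * G m n)"
      unfolding eq by (intro sum_norm_le term_le) simp
    also have "\<dots> = d f g / real K * (2 * D M N - 1)"
    proof -
      have "2 * D M N - 1 = (\<Sum>m = - int M..int M. \<Sum>n = 1..N. G m n)"
        unfolding D_def by (simp add: field_simps)
      then show ?thesis by (simp only: sum_distrib_left)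
    qed
    also have "\<dots> \<le> d f g / real K * (2 * D M N)"
      using d(1)[of f g] by (intro mult_left_mono) auto
    also have "\<dots> = 2 * d f g * D M N / real K" by simp
    finally show ?thesis .
  qed
  show ?thesis
  proof (intro exI[of _ d] exI[of _ D] allI impI conjI)
    fix f g M N and K :: nat
    assume "C1_plane f" "C1_plane g" "supported_in f (ball 0 (1 / 2))" "supported_in g (ball 0 (1 / 2))" "K \<ge> 1"
    then show "sup_norm (\<lambda>x. approx_sum K M N f g x - FB_sum M N (convolution f g) x) \<le> ereal (2 * d f g * D M N / real K)"
      unfolding sup_norm_def by (intro SUP_least) (simp add: main adm_def)
  qed (use d(1) D in auto)
qed

end
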